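(* Under the assumptions of the context (i.i.d. $X_{i,j}\in\mathbb{R}^d$ with mean $\mu_0$, eigenvalues of $\operatorname{Cov}(X_{1,1})$ bounded away from zero and infinity, $\operatorname{E}\|X_{1,1}\|_2^\beta<\infty$ for some $\beta\ge4$, $K=O(N^{1-2/\beta})$), suppose the initial value satisfies $\|\widehat\lambda_0-\widehat\lambda^*\|_2=O_p(n^{-1/2})$ and the number of rounds satisfies $T\ge\lfloor \log K/\log n\rfloor+1$. Let $\widehat\lambda_T$ be the output of the multi-round distributed algorithm described in the context (run with $\mu=\mu_0$). Then (a) $\|\widehat\lambda_T-\widehat\lambda^*\|_2=o_p(N^{-1/2})$; (b) $\ell_{DEL}(\mu_0)\xrightarrow{d}\chi^2_{(d)}$ as $n\to\infty$, where $\ell_{DEL}(\mu)=2\sum_{i=1}^K\sum_{j=1}^n\log[1+\widehat\lambda_T^\top(X_{i,j}-\mu)]$ and $\chi^2_{(d)}$ is the chi-squared distribution with $d$ degrees of freedom.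
   Context: Data are split across $K$ machines with $n$ observations each; $X_{i,j}$ is the $j$-th observation on machine $i$, $N=nK$; the $X_{i,j}$ are i.i.d. random vectors in $\mathbb{R}^d$ ($d$ fixed) with $\operatorname{E}X_{1,1}=\mu_0$. Asymptotics are as $n\to\infty$, with $K$ allowed to depend on $n$. Local optimal functions: $g_i(\lambda)=-\frac1n\sum_{j=1}^n\log[1+\lambda^\top(X_{i,j}-\mu_0)]$; global: $g(\lambda)=\frac1K\sum_{i=1}^Kg_i(\lambda)$; $\widehat\lambda^*=\arg\min_\lambda g(\lambda)$. Multi-round distributed algorithm: given an initial $\widehat\lambda_0$ and $T$, for $t=0,1,\dots,T-1$: each machine $i$ computes $\nabla g_i(\widehat\lambda_t)$; the center forms $\nabla g(\widehat\lambda_t)=\frac1K\sum_i\nabla g_i(\widehat\lambda_t)$ and broadcasts it; each machine computes $\widehat\lambda^{(i)}_{t+1}=\arg\min_\lambda\{g_i(\lambda)+[\nabla g(\widehat\lambda_t)-\nabla g_i(\widehat\lambda_t)]^\top\lambda\}$; the center sets $\widehat\lambda_{t+1}=\frac1K\sum_{i=1}^K\widehat\lambda^{(i)}_{t+1}$. The output is $\widehat\lambda_T$. *)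

theory Defs
  imports "HOL-Probability.Probability" "HOL-Library.Landau_Symbols"
begin

(* Data at one stage n: Y i j = X_{i,j}, i < K machines, j < n observations. *)

definition gi :: "nat \<Rightarrow> (nat \<Rightarrow> real^'d) \<Rightarrow> real^'d \<Rightarrow> real^'d \<Rightarrow> real" where
  "gi n x mu lam = - (1 / real n) * (\<Sum>j<n. ln (1 + lam \<bullet> (x j - mu)))"

definition grad_gi :: "nat \<Rightarrow> (nat \<Rightarrow> real^'d) \<Rightarrow> real^'d \<Rightarrow> real^'d \<Rightarrow> real^'d" where
  "grad_gi n x mu lam = - (1 / real n) *\<^sub>R (\<Sum>j<n. (1 / (1 + lam \<bullet> (x j - mu))) *\<^sub>R (x j - mu))"

definition dom_gi :: "nat \<Rightarrow> (nat \<Rightarrow> real^'d) \<Rightarrow> real^'d \<Rightarrow> (real^'d) set" where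
  "dom_gi n x mu = {lam. \<forall>j<n. 0 < 1 + lam \<bullet> (x j - mu)}"

definition g_glob :: "nat \<Rightarrow> nat \<Rightarrow> (nat \<Rightarrow> nat \<Rightarrow> real^'d) \<Rightarrow> real^'d \<Rightarrow> real^'d \<Rightarrow> real" where
  "g_glob K n Y mu lam = (1 / real K) * (\<Sum>i<K. gi n (Y i) mu lam)"

definition grad_g :: "nat \<Rightarrow> nat \<Rightarrow> (nat \<Rightarrow> nat \<Rightarrow> real^'d) \<Rightarrow> real^'d \<Rightarrow> real^'d \<Rightarrow> real^'d" where
  "grad_g K n Y mu lam = (1 / real K) *\<^sub>R (\<Sum>i<K. grad_gi n (Y i) mu lam)"

definition dom_g :: "nat \<Rightarrow> nat \<Rightarrow> (nat \<Rightarrow> nat \<Rightarrow> real^'d) \<Rightarrow> real^'d \<Rightarrow> (real^'d) set" where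
  "dom_g K n Y mu = {lam. \<forall>i<K. \<forall>j<n. 0 < 1 + lam \<bullet> (Y i j - mu)}"

definition surrogate :: "nat \<Rightarrow> nat \<Rightarrow> (nat \<Rightarrow> nat \<Rightarrow> real^'d) \<Rightarrow> real^'d \<Rightarrow> nat \<Rightarrow> real^'d \<Rightarrow> real^'d \<Rightarrow> real" where
  "surrogate K n Y mu i lt lam =
     gi n (Y i) mu lam + (grad_g K n Y mu lt - grad_gi n (Y i) mu lt) \<bullet> lam"

definition is_min_on :: "('b \<Rightarrow> real) \<Rightarrow> 'b set \<Rightarrow> 'b \<Rightarrow> bool" where
  "is_min_on f S x \<longleftrightarrow> x \<in> S \<and> (\<forall>y\<in>S. f x \<le> f y)"

definition is_argmin :: "('b \<Rightarrow> real) \<Rightarrow> 'b set \<Rightarrow> 'b \<Rightarrow> bool" where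
  "is_argmin f S x \<longleftrightarrow> ((\<exists>y. is_min_on f S y) \<longrightarrow> is_min_on f S x)"

definition l_DEL :: "nat \<Rightarrow> nat \<Rightarrow> (nat \<Rightarrow> nat \<Rightarrow> real^'d) \<Rightarrow> real^'d \<Rightarrow> real^'d \<Rightarrow> real" where
  "l_DEL K n Y mu lam = 2 * (\<Sum>i<K. \<Sum>j<n. ln (1 + lam \<bullet> (Y i j - mu)))"

definition bigO_p :: "'a measure \<Rightarrow> (nat \<Rightarrow> 'a \<Rightarrow> real) \<Rightarrow> (nat \<Rightarrow> real) \<Rightarrow> bool" where
  "bigO_p M Z r \<longleftrightarrow> (\<forall>e>0. \<exists>C. \<forall>\<^sub>F n in sequentially.
      measure M {\<omega> \<in> space M. C * r n < \<bar>Z n \<omega>\<bar>} < e)"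

definition smallo_p :: "'a measure \<Rightarrow> (nat \<Rightarrow> 'a \<Rightarrow> real) \<Rightarrow> (nat \<Rightarrow> real) \<Rightarrow> bool" where
  "smallo_p M Z r \<longleftrightarrow> (\<forall>e>0.
      (\<lambda>n. measure M {\<omega> \<in> space M. e * r n < \<bar>Z n \<omega>\<bar>}) \<longlonglongrightarrow> 0)"

definition is_eigenvalue :: "real^'n^'n \<Rightarrow> real \<Rightarrow> bool" where
  "is_eigenvalue A c \<longleftrightarrow> (\<exists>v. v \<noteq> 0 \<and> A *v v = c *\<^sub>R v)"

definition cov_matrix :: "(real^'d) measure \<Rightarrow> real^'d \<Rightarrow> real^'d^'d" where
  "cov_matrix D mu = (\<chi> i j. \<integral>x. (x $ i - mu $ i) * (x $ j - mu $ j) \<partial>D)"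

definition chi_squared :: "nat \<Rightarrow> real measure" where
  "chi_squared k = distr (PiM {..<k} (\<lambda>_. std_normal_distribution)) borel
                         (\<lambda>z. \<Sum>i<k. (z i)\<^sup>2)"

end

theory Submission
  imports Defs "HOL-Real_Asymp.Real_Asymp"
begin

text \<open>
  Write \<open>z = X - mu0\<close>, \<open>A\<close> for the covariance matrix, \<open>S i\<close> for the empirical covariance of machine \<open>i\<close>
  and \<open>e\<close> for the current error. The stationarity condition of a local problem reads
  \<open>A v i = (A - S i) v i - R i (v i) + (E i - average of E)\<close>, where \<open>v i\<close> is the local error after the
  round, \<open>E i\<close> is the local gradient increment, close to \<open>A e\<close>, and \<open>R i\<close> is the remainder of the
  linearised gradient. Averaging over the machines annihilates the last bracket, while
  \<open>v i\<close> is itself of order \<open>q i * norm e\<close> with \<open>q i\<close> bounding \<open>S i - A\<close> and \<open>R i\<close>; so one round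
  contracts the error by a multiple of the average of \<open>(q i)\<^sup>2\<close>, which is \<open>o(1 / sqrt n)\<close> in probability.
  As \<open>K \<le> n ^ T\<close>, after \<open>T\<close> rounds an error of order \<open>1 / sqrt n\<close> has become \<open>o(1 / sqrt (n K))\<close>.
  This needs the local covariances to be close to \<open>A\<close> uniformly over the machines, which follows from
  truncation at \<open>sqrt n\<close> and an exponential moment bound, since the growth condition on \<open>K\<close> says that
  \<open>K\<close> is at most of order \<open>n powr (beta / 2 - 1)\<close>.

  For the limit law, the statistic equals \<open>n K (x \<bullet> A x)\<close> with \<open>A x\<close> the mean of all \<open>z\<close>, up to \<open>o(1)\<close>
  in probability. In an orthonormal basis for the form \<open>A\<close> this is a sum of squares of scaled sums; its
  Laplace transform is a Gaussian average of characteristic functions of one-dimensional scaled sums.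
\<close>

section \<open>Minimisers of logarithmic sums\<close>

text \<open>The predicate \<open>is_argmin\<close> says nothing when no minimiser exists, so
  stationarity of \<open>lamstar\<close> and of the local minimisers has to be earned. Convexity
  does this: an objective that is larger on a sphere than at its centre has a minimiser, and every
  minimiser lies inside. The data limit the radii: a parameter of norm B is harmless when B * norm z
  is small for every observation, and since the largest observation is o(sqrt n) in probability, any
  fixed multiple of 1 / sqrt n is allowed, which is the order of the initial error. The estimates
  are deterministic once six bounds hold (\<open>good\<close>). Four are bounds in probability whose
  constant C depends on the tolerated probability; the other two hold with probability tending to 1
  for every eta > 0. C is chosen before eta, so constants built from C can be multiplied by an
  arbitrarily small eta: the source of every little-o. The uniform bound on the local covariances
  has no rate, the mean-square bound has the rate 1 / n but only on average; the former makes each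
  local problem tractable, the latter enters the contraction factor.\<close>

lemma ln_one_plus_cubic:
  fixes s :: real
  assumes "\<bar>s\<bar> \<le> 1/2"
  shows "\<bar>ln (1 + s) - s + s\<^sup>2 / 2\<bar> \<le> \<bar>s\<bar> ^ 3"
proof -
  define f where "f = (\<lambda>s::real. ln (1 + s) - s + s\<^sup>2 / 2)"
  \<comment> \<open>Both \<open>f\<close> and \<open>g\<close> vanish at 0 and are nondecreasing,
    because the derivative x^2 / (1 + x) of \<open>f\<close> lies between 0 and 3 * x^2. So
    \<open>f s\<close> lies between 0 and s^3 for either sign of s.\<close>
  define g where "g = (\<lambda>s::real. s ^ 3 - f s)"
  have f': "(f has_real_derivative (x\<^sup>2 / (1 + x))) (at x)" if "\<bar>x\<bar> \<le> 1/2" for x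
    unfolding f_def using that
    by (auto intro!: derivative_eq_intros simp: field_simps power2_eq_square)
  have g': "(g has_real_derivative (3 * x\<^sup>2 - x\<^sup>2 / (1 + x))) (at x)" if "\<bar>x\<bar> \<le> 1/2" for x
    unfolding g_def using that by (auto intro!: derivative_eq_intros f')
  have pos: "0 \<le> x\<^sup>2 / (1 + x)" "0 \<le> 3 * x\<^sup>2 - x\<^sup>2 / (1 + x)" if "\<bar>x\<bar> \<le> 1/2" for x :: real
  proof -
    show "0 \<le> x\<^sup>2 / (1 + x)" using that by simp
    have "x\<^sup>2 * 1 \<le> x\<^sup>2 * (3 * (1 + x))" using that by (intro mult_left_mono) auto
    then show "0 \<le> 3 * x\<^sup>2 - x\<^sup>2 / (1 + x)"
      using that by (simp add: divide_simps algebra_simps)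
  qed
  have mono: "f a \<le> f b" "g a \<le> g b" if "a \<le> b" "\<bar>a\<bar> \<le> 1/2" "\<bar>b\<bar> \<le> 1/2" for a b
  proof -
    have "\<bar>x\<bar> \<le> 1/2" if "a \<le> x" "x \<le> b" for x
      using that \<open>\<bar>a\<bar> \<le> 1/2\<close> \<open>\<bar>b\<bar> \<le> 1/2\<close> by (auto simp: abs_le_iff)
    then show "f a \<le> f b" "g a \<le> g b"
      using f' g' pos by (intro DERIV_nonneg_imp_nondecreasing[OF that(1)]; blast)+
  qed
  have 0: "f 0 = 0" "g 0 = 0" by (auto simp: f_def g_def)
  have "\<bar>f s\<bar> \<le> \<bar>s\<bar> ^ 3"
  proof (cases "0 \<le> s")
    case True
    then show ?thesis using mono[of 0 s] assms 0 by (auto simp: g_def)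
  next
    case False
    then have "\<bar>s\<bar> ^ 3 = - (s ^ 3)" by (simp add: power3_eq_cube)
    then show ?thesis using mono[of s 0] assms False 0 by (auto simp: g_def)
  qed
  then show ?thesis by (simp add: f_def)
qed

lemma ln_one_plus_le:
  fixes s :: real
  assumes "\<bar>s\<bar> \<le> 1/4"
  shows "ln (1 + s) \<le> s - s\<^sup>2 / 4"
proof -
  have "\<bar>s\<bar> ^ 3 = \<bar>s\<bar> * s\<^sup>2" by (simp add: power3_eq_cube power2_eq_square)
  also have "\<dots> \<le> 1/4 * s\<^sup>2" using assms by (intro mult_right_mono) auto
  finally show ?thesis using ln_one_plus_cubic[of s] assms by (auto simp: abs_le_iff)
qed

text \<open>One shape serves both kinds of objective: a surrogate has its gradient correction as
  \<open>b\<close> and weight 1 / n; the global objective has \<open>b\<close> = 0 and pairs of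
  machine and observation as indices.\<close>

lemma ln_sum_convex_on:
  fixes z :: "'i \<Rightarrow> 'v::real_inner"
  assumes "0 \<le> w"
  shows "convex_on {x. \<forall>a\<in>A. 0 < 1 + x \<bullet> z a} (\<lambda>x. b \<bullet> x - w * (\<Sum>a\<in>A. ln (1 + x \<bullet> z a)))"
    (is "convex_on ?S _")
proof -
  have conv: "convex ?S"
  proof -
    have "?S = (\<Inter>a\<in>A. {x. z a \<bullet> x > -1})"
      by (fastforce simp: inner_commute)
    then show ?thesis by (auto intro!: convex_INT convex_halfspace_gt)
  qed
  show ?thesis
  proof (rule convex_onI[OF _ conv])
    fix t :: real and x y assume t: "0 < t" "t < 1" and xy: "x \<in> ?S" "y \<in> ?S"
    have "(1 - t) * ln (1 + x \<bullet> z a) + t * ln (1 + y \<bullet> z a) \<le> ln (1 + ((1 - t) *\<^sub>R x + t *\<^sub>R y) \<bullet> z a)"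
      if "a \<in> A" for a
    proof -
      have "(1 - t) * ln (1 + x \<bullet> z a) + t * ln (1 + y \<bullet> z a)
            \<le> ln ((1 - t) *\<^sub>R (1 + x \<bullet> z a) + t *\<^sub>R (1 + y \<bullet> z a))"
        using concave_onD[OF ln_concave, of t "1 + x \<bullet> z a" "1 + y \<bullet> z a"] t xy that
        by auto
      also have "(1 - t) *\<^sub>R (1 + x \<bullet> z a) + t *\<^sub>R (1 + y \<bullet> z a) = 1 + ((1 - t) *\<^sub>R x + t *\<^sub>R y) \<bullet> z a"
        by (simp add: inner_simps algebra_simps)
      finally show ?thesis .
    qed
    then have "(\<Sum>a\<in>A. (1 - t) * ln (1 + x \<bullet> z a) + t * ln (1 + y \<bullet> z a))
        \<le> (\<Sum>a\<in>A. ln (1 + ((1 - t) *\<^sub>R x + t *\<^sub>R y) \<bullet> z a))"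
      by (rule sum_mono)
    then have "w * ((1 - t) * (\<Sum>a\<in>A. ln (1 + x \<bullet> z a)) + t * (\<Sum>a\<in>A. ln (1 + y \<bullet> z a)))
        \<le> w * (\<Sum>a\<in>A. ln (1 + ((1 - t) *\<^sub>R x + t *\<^sub>R y) \<bullet> z a))"
      using assms by (intro mult_left_mono) (simp_all add: sum.distrib sum_distrib_left)
    then show "b \<bullet> ((1 - t) *\<^sub>R x + t *\<^sub>R y) - w * (\<Sum>a\<in>A. ln (1 + ((1 - t) *\<^sub>R x + t *\<^sub>R y) \<bullet> z a))
      \<le> (1 - t) * (b \<bullet> x - w * (\<Sum>a\<in>A. ln (1 + x \<bullet> z a)))
        + t * (b \<bullet> y - w * (\<Sum>a\<in>A. ln (1 + y \<bullet> z a)))"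
      by (simp add: inner_simps algebra_simps)
  qed
qed

text \<open>Convexity carries the strict inequality on the sphere outwards along rays from
  \<open>p\<close>, so the minimum over the compact ball is a minimum over \<open>S\<close>. This
  supplies the existence without which \<open>is_argmin\<close> is empty, and strictness keeps every
  minimiser in the open ball, as the derivative test requires.\<close>

lemma argmin_in_ball:
  fixes f :: "'v::euclidean_space \<Rightarrow> real"
  assumes conv: "convex_on S f" and r: "0 < r" and sub: "cball p r \<subseteq> S"
    and cont: "continuous_on (cball p r) f"
    and sph: "\<And>x. dist p x = r \<Longrightarrow> f p < f x"
    and am: "is_argmin f S x"
  shows "is_min_on f S x" "dist p x < r"
proof -
  have pS: "p \<in> S" using sub r by auto
  have outside: "f p < f y" if y: "y \<in> S" "r \<le> dist p y" for y
  proof -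
    \<comment> \<open>\<open>q\<close> will be the point where the segment from \<open>p\<close> to
      \<open>y\<close> crosses the sphere.\<close>
    define t where "t = r / dist p y"
    have t: "0 < t" "t \<le> 1" using r y by (auto simp: t_def divide_simps)
    define q where "q = (1 - t) *\<^sub>R p + t *\<^sub>R y"
    have "q - p = t *\<^sub>R (y - p)" by (simp add: q_def algebra_simps)
    then have "dist p q = r"
      using t r y by (metis abs_of_pos dist_commute dist_norm divide_eq_0_iff linorder_not_le
          nonzero_eq_divide_eq norm_scaleR order_less_irrefl t_def)
    then have "f p < f q" by (rule sph)
    also have "f q \<le> (1 - t) * f p + t * f y"
      unfolding q_def using convex_onD[OF conv, of t p y] t y pS by auto
    finally have "t * f p < t * f y" by (simp add: algebra_simps)
    then show ?thesis using t by simp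
  qed
  obtain m where m: "m \<in> cball p r" "\<And>y. y \<in> cball p r \<Longrightarrow> f m \<le> f y"
    using continuous_attains_inf[OF compact_cball _ cont] r by fastforce
  have "is_min_on f S m"
    unfolding is_min_on_def
  proof (intro conjI ballI)
    show "m \<in> S" using m sub by auto
    fix y assume "y \<in> S"
    show "f m \<le> f y"
    proof (cases "dist p y \<le> r")
      case True then show ?thesis using m by auto
    next
      case False
      then have "f p < f y" using outside \<open>y \<in> S\<close> by auto
      moreover have "f m \<le> f p" using m r by auto
      ultimately show ?thesis by auto
    qed
  qed
  then show *: "is_min_on f S x" using am by (auto simp: is_argmin_def)
  show "dist p x < r"
    using outside[of x] * pS by (force simp: is_min_on_def)
qed

text \<open>Around \<open>p\<close> the objective grows by at least its linear part plus w / 9 times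
  the sum of squares, so the sphere hypothesis says that curvature beats the gradient at
  \<open>p\<close>. The minimiser is then interior and its derivative vanishes. The centre will be 0
  for the global problem and the global minimiser for the local ones.\<close>

lemma argmin_ln_sum:
  fixes z :: "'i \<Rightarrow> 'v::euclidean_space"
  assumes fin: "finite A" and w: "0 < w" and r: "0 < r"
    and p: "\<And>a. a \<in> A \<Longrightarrow> \<bar>p \<bullet> z a\<bar> \<le> 1/2"
    and rz: "\<And>a. a \<in> A \<Longrightarrow> r * norm (z a) \<le> 1/8"
    and sph: "\<And>u. norm u = r \<Longrightarrow>
        0 < w / 9 * (\<Sum>a\<in>A. (u \<bullet> z a)\<^sup>2) + u \<bullet> (b - w *\<^sub>R (\<Sum>a\<in>A. (1 / (1 + p \<bullet> z a)) *\<^sub>R z a))"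
    and am: "is_argmin (\<lambda>x. b \<bullet> x - w * (\<Sum>a\<in>A. ln (1 + x \<bullet> z a))) {x. \<forall>a\<in>A. 0 < 1 + x \<bullet> z a} x"
  shows "norm (x - p) < r \<and> b = w *\<^sub>R (\<Sum>a\<in>A. (1 / (1 + x \<bullet> z a)) *\<^sub>R z a)"
proof -
  define f where "f = (\<lambda>x. b \<bullet> x - w * (\<Sum>a\<in>A. ln (1 + x \<bullet> z a)))"
  define S where "S = {x. \<forall>a\<in>A. 0 < 1 + x \<bullet> z a}"
  have uz: "\<bar>u \<bullet> z a\<bar> \<le> 1/8" if "norm u \<le> r" "a \<in> A" for u a
  proof -
    have "\<bar>u \<bullet> z a\<bar> \<le> norm u * norm (z a)" by (rule Cauchy_Schwarz_ineq2)
    also have "\<dots> \<le> r * norm (z a)" using that by (intro mult_right_mono) auto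
    finally show ?thesis using rz[OF that(2)] by simp
  qed
  have sub: "cball p r \<subseteq> S"
  proof
    fix y assume "y \<in> cball p r"
    then have "norm (y - p) \<le> r" by (simp add: dist_norm norm_minus_commute)
    then have yz: "\<bar>(y - p) \<bullet> z a\<bar> \<le> 1/8" if "a \<in> A" for a using uz that by blast
    then have "0 < 1 + y \<bullet> z a" if "a \<in> A" for a
      using p[OF that] yz[OF that] unfolding inner_diff_left by linarith
    then show "y \<in> S" by (simp add: S_def)
  qed
  have cont: "continuous_on S f"
    unfolding f_def S_def by (intro continuous_intros) auto
  have sphere: "f p < f y" if "dist p y = r" for y
  proof -
    define u where "u = y - p"
    have u: "norm u = r" "y = p + u" using that by (auto simp: u_def dist_norm norm_minus_commute)
    have "ln (1 + y \<bullet> z a) \<le> ln (1 + p \<bullet> z a) + (u \<bullet> z a) / (1 + p \<bullet> z a) - (u \<bullet> z a)\<^sup>2 / 9"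
      if a: "a \<in> A" for a
    proof -
      define s where "s = (u \<bullet> z a) / (1 + p \<bullet> z a)"
      have den: "1/2 \<le> 1 + p \<bullet> z a" "1 + p \<bullet> z a \<le> 3/2" using p[OF a] by auto
      have "\<bar>s\<bar> = \<bar>u \<bullet> z a\<bar> / (1 + p \<bullet> z a)" using den by (simp add: s_def)
      also have "\<dots> \<le> (1/8) / (1/2)" using uz[of u a] u a den by (intro frac_le) auto
      finally have s: "\<bar>s\<bar> \<le> 1/4" by simp
      \<comment> \<open>The 1/9 is (2/3)^2 / 4: here 2/3 is the least value of 1 / (1 + p . z), and
        1/4 is the constant of \<open>ln_one_plus_le\<close>.\<close>
      have "(2/3)\<^sup>2 * (u \<bullet> z a)\<^sup>2 \<le> (1 / (1 + p \<bullet> z a))\<^sup>2 * (u \<bullet> z a)\<^sup>2"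
        using den by (intro mult_right_mono power_mono) (auto simp: divide_simps)
      also have "\<dots> = s\<^sup>2" by (simp add: s_def power_divide)
      finally have s2: "(u \<bullet> z a)\<^sup>2 / 9 \<le> s\<^sup>2 / 4" by (simp add: power2_eq_square)
      have "1 + y \<bullet> z a = (1 + p \<bullet> z a) * (1 + s)"
        using den by (simp add: s_def u inner_add_left field_simps)
      then have "ln (1 + y \<bullet> z a) = ln (1 + p \<bullet> z a) + ln (1 + s)"
        using den s by (simp add: ln_mult)
      also have "\<dots> \<le> ln (1 + p \<bullet> z a) + (s - s\<^sup>2 / 4)"
        using ln_one_plus_le[OF s] by simp
      finally show ?thesis using s2 by (simp add: s_def)
    qed
    then have "(\<Sum>a\<in>A. ln (1 + y \<bullet> z a))
        \<le> (\<Sum>a\<in>A. ln (1 + p \<bullet> z a) + (u \<bullet> z a) / (1 + p \<bullet> z a) - (u \<bullet> z a)\<^sup>2 / 9)"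
      by (rule sum_mono)
    also have "\<dots> = (\<Sum>a\<in>A. ln (1 + p \<bullet> z a)) + u \<bullet> (\<Sum>a\<in>A. (1 / (1 + p \<bullet> z a)) *\<^sub>R z a)
        - (\<Sum>a\<in>A. (u \<bullet> z a)\<^sup>2) / 9"
      by (simp add: sum.distrib sum_subtractf inner_sum_right sum_divide_distrib)
    finally have "w * (\<Sum>a\<in>A. ln (1 + y \<bullet> z a)) \<le> w * \<dots>" using w by (intro mult_left_mono) auto
    then show ?thesis using sph[OF u(1)]
      by (simp add: f_def u(2) inner_simps algebra_simps inner_commute[of b u])
  qed
  have conv: "convex_on S f" unfolding S_def f_def using w by (intro ln_sum_convex_on) auto
  have am': "is_argmin f S x" using am by (simp add: f_def S_def)
  note min = argmin_in_ball[OF conv r sub continuous_on_subset[OF cont sub] sphere am']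
  have x: "norm (x - p) < r" using min(2) by (simp add: dist_norm norm_minus_commute)
  define D where "D = b - w *\<^sub>R (\<Sum>a\<in>A. (1 / (1 + x \<bullet> z a)) *\<^sub>R z a)"
  have xS: "x \<in> S" using min by (auto simp: is_min_on_def)
  have der: "(f has_derivative (\<lambda>h. D \<bullet> h)) (at x)"
    unfolding f_def using xS
    apply (auto intro!: derivative_eq_intros simp: S_def)
    apply (simp add: D_def inner_simps inner_sum_left fun_eq_iff divide_simps)
    apply (simp add: inner_commute)
    done
  have "(\<lambda>h. D \<bullet> h) = (\<lambda>h. 0)"
  proof (rule differential_zero_maxmin[OF _ _ der])
    show "x \<in> ball p r" using min(2) by simp
    show "(\<forall>y\<in>ball p r. f y \<le> f x) \<or> (\<forall>y\<in>ball p r. f x \<le> f y)"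
      using min(1) sub ball_subset_cball[of p r] unfolding is_min_on_def by blast
  qed auto
  then have "D \<bullet> D = 0" by meson
  then show ?thesis using x by (simp add: D_def)
qed

section \<open>Contraction of one round\<close>

text \<open>The norm on matrices, as vectors of rows, is the Frobenius norm; this is Cauchy-Schwarz
  in each row.\<close>

lemma norm_matrix_vector_le:
  fixes A :: "real^'n^'m"
  shows "norm (A *v x) \<le> norm A * norm x"
proof -
  have "norm (A *v x) = L2_set (\<lambda>i. (A *v x) $ i) UNIV" by (simp add: norm_vec_def L2_set_def)
  also have "\<dots> = L2_set (\<lambda>i. \<bar>A $ i \<bullet> x\<bar>) UNIV"
    by (simp add: matrix_vector_mul_component L2_set_def)
  also have "\<dots> \<le> L2_set (\<lambda>i. norm (A $ i) * norm x) UNIV"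
    by (intro L2_set_mono Cauchy_Schwarz_ineq2) auto
  also have "\<dots> = norm A * norm x"
    by (simp add: L2_set_left_distrib norm_vec_def)
  finally show ?thesis .
qed

text \<open>Plays the part of a bound on the inverse of \<open>A\<close>: an equation A v = w yields
  norm v <= norm w / c without forming the inverse.\<close>

lemma coercive_norm_le:
  fixes A :: "real^'d^'d"
  assumes "\<And>v. c * (norm v)\<^sup>2 \<le> v \<bullet> (A *v v)"
  shows "c * norm v \<le> norm (A *v v)"
proof (cases "v = 0")
  case False
  have "norm v * (c * norm v) \<le> norm v * norm (A *v v)"
    using assms[of v] norm_cauchy_schwarz[of v "A *v v"] by (simp add: power2_eq_square mult_ac)
  then show ?thesis using False by simp
qed auto

text \<open>Centred at the given \<open>mu\<close> instead of the sample mean, so that at the true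
  mean it is an average of i.i.d. terms with expectation the covariance. It is also the Hessian of
  \<open>gi\<close> at 0.\<close>

definition emp_cov :: "nat \<Rightarrow> (nat \<Rightarrow> real^'d) \<Rightarrow> real^'d \<Rightarrow> real^'d^'d" where
  "emp_cov n x mu = (\<chi> k l. (1 / real n) * (\<Sum>j<n. (x j $ k - mu $ k) * (x j $ l - mu $ l)))"

lemma emp_cov_mult:
  "emp_cov n x mu *v v = (1 / real n) *\<^sub>R (\<Sum>j<n. (v \<bullet> (x j - mu)) *\<^sub>R (x j - mu))"
proof (subst vec_eq_iff, intro allI)
  fix k
  have "(emp_cov n x mu *v v) $ k
      = (\<Sum>l\<in>UNIV. (1 / real n) * (\<Sum>j<n. (x j $ k - mu $ k) * (x j $ l - mu $ l) * v $ l))"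
    by (simp add: matrix_vector_mult_def emp_cov_def sum_distrib_left sum_distrib_right mult_ac)
  also have "\<dots> = (1 / real n) * (\<Sum>j<n. \<Sum>l\<in>UNIV. (x j $ k - mu $ k) * (x j $ l - mu $ l) * v $ l)"
    by (subst sum.swap) (simp add: sum_distrib_left)
  also have "\<dots> = ((1 / real n) *\<^sub>R (\<Sum>j<n. (v \<bullet> (x j - mu)) *\<^sub>R (x j - mu))) $ k"
    by (simp add: inner_vec_def sum_distrib_left sum_distrib_right mult_ac)
  finally show "(emp_cov n x mu *v v) $ k
      = ((1 / real n) *\<^sub>R (\<Sum>j<n. (v \<bullet> (x j - mu)) *\<^sub>R (x j - mu))) $ k" .
qed

lemma emp_cov_quadratic:
  "v \<bullet> (emp_cov n x mu *v v) = (1 / real n) * (\<Sum>j<n. (v \<bullet> (x j - mu))\<^sup>2)"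
  by (simp add: emp_cov_mult inner_sum_right power2_eq_square)

definition mom3 :: "nat \<Rightarrow> (nat \<Rightarrow> real^'d) \<Rightarrow> real^'d \<Rightarrow> real" where
  "mom3 n x mu = (1 / real n) * (\<Sum>j<n. norm (x j - mu) ^ 3)"

lemma mom3_nonneg: "0 \<le> mom3 n x mu"
  by (simp add: mom3_def sum_nonneg)

text \<open>The difference 1 / (1 + b) - 1 / (1 + a) equals (a - b) / ((1 + a) * (1 + b)); the
  quantity bounded here is its relative departure from a - b. The 10 is 5/2 from the numerator over
  1/4 from the denominator.\<close>

lemma inverse_product_bound:
  fixes a b t :: real
  assumes "\<bar>a\<bar> \<le> t" "\<bar>b\<bar> \<le> t" "t \<le> 1/2"
  shows "\<bar>1 - 1 / ((1 + a) * (1 + b))\<bar> \<le> 10 * t"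
proof -
  have d: "1/2 * (1/2) \<le> (1 + a) * (1 + b)" using assms by (intro mult_mono) auto
  then have nz: "1 + a \<noteq> 0" "1 + b \<noteq> 0" by auto
  have "\<bar>a + b + a * b\<bar> \<le> \<bar>a\<bar> + \<bar>b\<bar> + \<bar>a\<bar> * \<bar>b\<bar>"
    by (metis abs_mult abs_triangle_ineq add_le_cancel_right order_trans)
  also have "\<dots> \<le> t + t + (1/2) * t" using assms by (intro add_mono mult_mono) auto
  finally have num: "\<bar>a + b + a * b\<bar> \<le> 5/2 * t" by simp
  have "1 - 1 / ((1 + a) * (1 + b)) = (a + b + a * b) / ((1 + a) * (1 + b))"
    using nz by (simp add: diff_divide_eq_iff) (simp add: algebra_simps)
  then have "\<bar>1 - 1 / ((1 + a) * (1 + b))\<bar> = \<bar>a + b + a * b\<bar> / ((1 + a) * (1 + b))"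
    using d by (simp add: abs_divide)
  also have "\<dots> \<le> (5/2 * t) / (1/4)" using num d assms by (intro frac_le) auto
  finally show ?thesis by simp
qed

lemma sum_norm_scaled_le:
  fixes f :: "'i \<Rightarrow> 'v::real_normed_vector"
  assumes "0 \<le> w" "\<And>i. i \<in> I \<Longrightarrow> norm (f i) \<le> g i"
  shows "norm (w *\<^sub>R sum f I) \<le> w * sum g I"
  using assms by (auto intro!: mult_left_mono sum_norm_le)

text \<open>Each summand of the gradient increment is ((v - v') . z) z divided by (1 + v . z) * (1 +
  v' . z), and replacing that divisor by 1 costs at most 10 * B * norm z relatively. Keeping the
  factor norm (v - v') lets the remainder act like a perturbation of the matrix, for the old as well
  as the new iterate.\<close>

lemma grad_gi_diff:
  assumes B: "\<And>j. j < n \<Longrightarrow> B * norm (x j - mu) \<le> 1/2"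
    and v: "norm v \<le> B" and v': "norm v' \<le> B"
  shows "norm (grad_gi n x mu v - grad_gi n x mu v' - emp_cov n x mu *v (v - v'))
         \<le> 10 * B * mom3 n x mu * norm (v - v')"
proof -
  have term_le: "norm (((v - v') \<bullet> z) *\<^sub>R z - (1 / (1 + v' \<bullet> z)) *\<^sub>R z + (1 / (1 + v \<bullet> z)) *\<^sub>R z)
      \<le> 10 * B * norm z ^ 3 * norm (v - v')" if Bz: "B * norm z \<le> 1/2" for z
  proof -
    have le: "\<bar>u \<bullet> z\<bar> \<le> B * norm z" if "norm u \<le> B" for u
      by (rule order_trans[OF Cauchy_Schwarz_ineq2]) (use that in \<open>auto intro: mult_right_mono\<close>)
    have nz: "1 + v \<bullet> z \<noteq> 0" "1 + v' \<bullet> z \<noteq> 0" using le[OF v] le[OF v'] Bz by linarith+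
    have "((v - v') \<bullet> z) *\<^sub>R z - (1 / (1 + v' \<bullet> z)) *\<^sub>R z + (1 / (1 + v \<bullet> z)) *\<^sub>R z
      = ((v - v') \<bullet> z * (1 - 1 / ((1 + v \<bullet> z) * (1 + v' \<bullet> z)))) *\<^sub>R z"
      unfolding scaleR_left_distrib[symmetric] scaleR_left_diff_distrib[symmetric]
      using nz by (intro arg_cong[where f="\<lambda>t. t *\<^sub>R z"]) (simp add: divide_simps inner_diff_left, simp add: algebra_simps)
    then have "norm (((v - v') \<bullet> z) *\<^sub>R z - (1 / (1 + v' \<bullet> z)) *\<^sub>R z + (1 / (1 + v \<bullet> z)) *\<^sub>R z)
      = \<bar>(v - v') \<bullet> z\<bar> * \<bar>1 - 1 / ((1 + v \<bullet> z) * (1 + v' \<bullet> z))\<bar> * norm z"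
      by (simp add: abs_mult)
    also have "\<dots> \<le> (norm (v - v') * norm z) * (10 * (B * norm z)) * norm z"
      using le[OF v] le[OF v'] Bz
      by (intro mult_right_mono mult_mono Cauchy_Schwarz_ineq2 inverse_product_bound) auto
    finally show ?thesis by (simp add: power3_eq_cube mult_ac)
  qed
  define d where "d = (\<lambda>z. ((v - v') \<bullet> z) *\<^sub>R z - (1 / (1 + v' \<bullet> z)) *\<^sub>R z + (1 / (1 + v \<bullet> z)) *\<^sub>R z)"
  have d: "norm (d (x j - mu)) \<le> 10 * B * norm (x j - mu) ^ 3 * norm (v - v')" if "j < n" for j
    unfolding d_def by (rule term_le, rule B, rule that)
  have "grad_gi n x mu v - grad_gi n x mu v' - emp_cov n x mu *v (v - v')
     = - ((1 / real n) *\<^sub>R (\<Sum>j<n. d (x j - mu)))"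
    by (simp add: d_def grad_gi_def emp_cov_mult sum.distrib sum_subtractf algebra_simps)
  also have "norm \<dots> \<le> (1 / real n) * (\<Sum>j<n. 10 * B * norm (x j - mu) ^ 3 * norm (v - v'))"
    unfolding norm_minus_cancel using d by (intro sum_norm_scaled_le) auto
  also have "\<dots> = 10 * B * mom3 n x mu * norm (v - v')"
    by (simp add: mom3_def sum_distrib_left[symmetric] sum_distrib_right[symmetric])
  finally show ?thesis .
qed

text \<open>The averaged error is of second order in the local discrepancies \<open>q\<close>: the first-order
  terms \<open>E i\<close> cancel when averaged.\<close>

lemma average_second_order:
  fixes A :: "real^'d^'d" and E W v :: "nat \<Rightarrow> real^'d" and e :: "real^'d"
  assumes K: "0 < K" and c: "0 < c" and coer: "\<And>v. c * (norm v)\<^sup>2 \<le> v \<bullet> (A *v v)"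
    and eq: "\<And>i. i < K \<Longrightarrow> A *v v i = W i + (E i - (1 / real K) *\<^sub>R (\<Sum>i<K. E i))"
    and W: "\<And>i. i < K \<Longrightarrow> norm (W i) \<le> q i * norm (v i)"
    and E: "\<And>i. i < K \<Longrightarrow> norm (E i - A *v e) \<le> q i * norm e"
    and q: "\<And>i. i < K \<Longrightarrow> 0 \<le> q i" "\<And>i. i < K \<Longrightarrow> q i \<le> c / 2"
  shows "norm ((1 / real K) *\<^sub>R (\<Sum>i<K. v i)) \<le> 4 / c\<^sup>2 * ((1 / real K) * (\<Sum>i<K. (q i)\<^sup>2)) * norm e"
proof -
  define w where "w = 1 / real K"
  define qb where "qb = w * (\<Sum>i<K. q i)"
  define Eb where "Eb = w *\<^sub>R (\<Sum>i<K. E i)"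
  have w: "0 < w" "w * real K = 1" using K by (auto simp: w_def)
  have qb: "0 \<le> qb" unfolding qb_def using w q by (intro mult_nonneg_nonneg sum_nonneg) auto
  have "Eb - A *v e = w *\<^sub>R (\<Sum>i<K. E i - A *v e)"
    using w by (simp add: Eb_def sum_subtractf scaleR_diff_right sum_constant_scaleR del: sum_constant)
  also have "norm \<dots> \<le> w * (\<Sum>i<K. q i * norm e)"
    using w E by (intro sum_norm_scaled_le) auto
  finally have Eb: "norm (Eb - A *v e) \<le> qb * norm e"
    by (simp only: qb_def sum_distrib_right[symmetric] mult.assoc)
  \<comment> \<open>A preliminary bound, of first order only. The term q i * norm (v i) is absorbed
    on the left since q i <= c / 2.\<close>
  have vi: "norm (v i) \<le> 2 / c * (q i + qb) * norm e" if i: "i < K" for i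
  proof -
    have "c * norm (v i) \<le> norm (A *v v i)" by (rule coercive_norm_le[OF coer])
    also have "A *v v i = W i + (E i - A *v e) - (Eb - A *v e)" using eq[OF i] by (simp add: Eb_def w_def)
    also have "norm \<dots> \<le> norm (W i) + norm (E i - A *v e) + norm (Eb - A *v e)"
      by (intro order_trans[OF norm_triangle_ineq4] add_mono norm_triangle_ineq order_refl)
    also have "\<dots> \<le> q i * norm (v i) + q i * norm e + qb * norm e"
      by (intro add_mono W E Eb i)
    also have "q i * norm (v i) \<le> c / 2 * norm (v i)" using q i by (intro mult_right_mono) auto
    finally have "c * norm (v i) \<le> 2 * ((q i + qb) * norm e)" by (simp add: algebra_simps)
    then show ?thesis using c by (simp add: field_simps)
  qed
  \<comment> \<open>The mean discrepancy \<open>qb\<close> occurs in every local bound; averaged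
    against q i it leaves its own square, which Cauchy-Schwarz turns into a mean of squares.\<close>
  have qb2: "qb * qb \<le> w * (\<Sum>i<K. (q i)\<^sup>2)"
  proof -
    have "(\<Sum>i<K. q i)\<^sup>2 \<le> real K * (\<Sum>i<K. (q i)\<^sup>2)"
      using sum_squared_le_sum_of_squares[of q "{..<K}"] by (simp add: mult.commute)
    then have "w * w * (\<Sum>i<K. q i)\<^sup>2 \<le> w * w * (real K * (\<Sum>i<K. (q i)\<^sup>2))"
      using w by (intro mult_left_mono) auto
    also have "\<dots> = w * (\<Sum>i<K. (q i)\<^sup>2)" using w by (simp add: mult_ac)
    finally show ?thesis by (simp add: qb_def power2_eq_square mult_ac)
  qed
  define vb where "vb = w *\<^sub>R (\<Sum>i<K. v i)"
  have "A *v vb = w *\<^sub>R (\<Sum>i<K. A *v v i)"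
    unfolding vb_def by (simp add: matrix_vector_mult_scaleR linear_sum[OF matrix_vector_mul_linear, symmetric])
  also have "(\<Sum>i<K. A *v v i) = (\<Sum>i<K. W i) + (\<Sum>i<K. E i) - real K *\<^sub>R Eb"
    by (simp add: eq Eb_def w_def sum.distrib sum_subtractf sum_constant_scaleR del: sum_constant)
  also have "real K *\<^sub>R Eb = (\<Sum>i<K. E i)" using w by (simp add: Eb_def mult.commute)
  finally have "A *v vb = w *\<^sub>R (\<Sum>i<K. W i)" by simp
  then have "c * norm vb \<le> norm (w *\<^sub>R (\<Sum>i<K. W i))" using coercive_norm_le[OF coer, of vb] by simp
  \<comment> \<open>Each W i carries one factor q i, and the first-order bound on v i supplies the
    second.\<close>
  also have "\<dots> \<le> w * (\<Sum>i<K. q i * (2 / c * (q i + qb) * norm e))"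
    using w q
    by (intro sum_norm_scaled_le order_trans[OF W] mult_left_mono vi) auto
  also have "\<dots> = 2 / c * norm e * (w * (\<Sum>i<K. (q i)\<^sup>2) + qb * qb)"
    by (simp add: qb_def sum.distrib sum_distrib_left sum_distrib_right algebra_simps power2_eq_square)
  also have "\<dots> \<le> 2 / c * norm e * (2 * (w * (\<Sum>i<K. (q i)\<^sup>2)))"
    using c qb2 by (intro mult_left_mono) auto
  finally have "c * norm vb \<le> 2 / c * norm e * (2 * (w * (\<Sum>i<K. (q i)\<^sup>2)))" .
  then have "norm vb \<le> 4 / c\<^sup>2 * (w * (\<Sum>i<K. (q i)\<^sup>2)) * norm e"
    using c by (simp add: field_simps power2_eq_square)
  then show ?thesis by (simp add: vb_def w_def)
qed

text \<open>Expanding each local problem at \<open>ls\<close> rather than at the current iterate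
  makes its gradient there \<open>Eb\<close> - E i. Both E i and its mean are within c / 40 * norm e
  of A e, so this gradient is small against the curvature on the sphere of radius B / 2 about
  \<open>ls\<close>. Hence the local minimiser exists, is stationary and stays in the ball of radius
  \<open>B\<close> where the linearisation holds, and its equation has the shape required by
  \<open>average_second_order\<close>.\<close>

lemma round_contraction:
  fixes A :: "real^'d^'d" and Y :: "nat \<Rightarrow> nat \<Rightarrow> real^'d" and mu lt ls :: "real^'d"
  assumes K: "0 < K" and n: "0 < n" and c: "0 < c"
    and coer: "\<And>v. c * (norm v)\<^sup>2 \<le> v \<bullet> (A *v v)"
    and B: "0 < B" "\<And>i j. i < K \<Longrightarrow> j < n \<Longrightarrow> B * norm (Y i j - mu) \<le> 1/8"
    and ls: "norm ls \<le> B / 2" "norm (lt - ls) \<le> B / 2"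
    and stat: "grad_g K n Y mu ls = 0"
    and q_def: "\<And>i. q i = norm (emp_cov n (Y i) mu - A) + 10 * B * mom3 n (Y i) mu"
    and q: "\<And>i. i < K \<Longrightarrow> q i \<le> c / 40"
    and am: "\<And>i. i < K \<Longrightarrow> is_argmin (surrogate K n Y mu i lt) (dom_gi n (Y i) mu) (loc i)"
  shows "norm ((1 / real K) *\<^sub>R (\<Sum>i<K. loc i) - ls)
         \<le> 4 / c\<^sup>2 * ((1 / real K) * (\<Sum>i<K. (q i)\<^sup>2)) * norm (lt - ls)"
proof -
  define w where "w = 1 / real K"
  have w: "0 < w" "w * real K = 1" using K by (auto simp: w_def)
  define G where "G = (\<lambda>i. grad_gi n (Y i) mu)"
  define S where "S = (\<lambda>i. emp_cov n (Y i) mu)"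
  define D where "D = (\<lambda>i v. G i v - G i ls - S i *v (v - ls))"
  define E where "E = (\<lambda>i. G i lt - G i ls)"
  define Eb where "Eb = w *\<^sub>R (\<Sum>i<K. E i)"
  define e where "e = lt - ls"
  have q0: "0 \<le> q i" "norm (S i - A) \<le> q i" for i
    using B by (auto simp: q_def S_def mom3_nonneg)
  have Bz: "B * norm (Y i j - mu) \<le> 1/2" if "i < K" "j < n" for i j using B(2)[OF that] by simp
  have D: "norm (D i v) \<le> 10 * B * mom3 n (Y i) mu * norm (v - ls)" if "i < K" "norm v \<le> B" for i v
    unfolding D_def G_def S_def using Bz that ls B by (intro grad_gi_diff) auto
  have lt: "norm lt \<le> B" using norm_triangle_ineq[of "lt - ls" ls] ls by simp
  have E: "norm (E i - A *v e) \<le> q i * norm e" if i: "i < K" for i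
  proof -
    have "E i - A *v e = (S i - A) *v e + D i lt"
      by (simp add: E_def D_def e_def matrix_vector_mult_diff_rdistrib)
    also have "norm \<dots> \<le> norm (S i - A) * norm e + 10 * B * mom3 n (Y i) mu * norm e"
      unfolding e_def using D[OF i lt]
      by (intro order_trans[OF norm_triangle_ineq] add_mono norm_matrix_vector_le)
    finally show ?thesis by (simp add: q_def S_def algebra_simps)
  qed
  have "Eb - A *v e = w *\<^sub>R (\<Sum>i<K. E i - A *v e)"
    using w by (simp add: Eb_def sum_subtractf scaleR_diff_right sum_constant_scaleR del: sum_constant)
  also have "norm \<dots> \<le> w * (\<Sum>i<K. c / 40 * norm e)"
    using w E q by (intro sum_norm_scaled_le order_trans[OF E] mult_right_mono) auto
  also have "\<dots> = c / 40 * norm e" using w by simp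
  finally have Ebe: "norm (Eb - A *v e) \<le> c / 40 * norm e" .
  \<comment> \<open>As \<open>ls\<close> is stationary, subtracting its vanishing gradient turns the
    broadcast gradient into the mean of the local increments.\<close>
  have grad: "grad_g K n Y mu lt = Eb"
    using stat by (simp add: grad_g_def Eb_def E_def G_def w_def sum_subtractf scaleR_diff_right)
  have loc: "norm (loc i - ls) < B / 2" "G i (loc i) - G i ls = E i - Eb" if i: "i < K" for i
  proof -
    let ?b = "Eb - G i lt"
    have sphere: "0 < 1 / real n / 9 * (\<Sum>j<n. (u \<bullet> (Y i j - mu))\<^sup>2)
       + u \<bullet> (?b - (1 / real n) *\<^sub>R (\<Sum>j<n. (1 / (1 + ls \<bullet> (Y i j - mu))) *\<^sub>R (Y i j - mu)))"
      if u: "norm u = B / 2" for u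
    proof -
      have 1: "1 / real n / 9 * (\<Sum>j<n. (u \<bullet> (Y i j - mu))\<^sup>2) = 1/9 * (u \<bullet> (S i *v u))"
        by (simp add: S_def emp_cov_quadratic)
      have "(A - S i) *v u = A *v u - S i *v u" by (simp add: matrix_vector_mult_diff_rdistrib)
      then have "u \<bullet> (A *v u) - u \<bullet> (S i *v u) = u \<bullet> ((A - S i) *v u)"
        by (simp add: inner_diff_right)
      also have "\<dots> \<le> norm u * (norm (A - S i) * norm u)"
        by (rule order_trans[OF norm_cauchy_schwarz]) (intro mult_left_mono norm_matrix_vector_le; simp)
      also have "\<dots> \<le> norm u * (c / 40 * norm u)"
        using q[OF i] q0[of i] by (intro mult_left_mono mult_right_mono) (auto simp: norm_minus_commute)
      finally have 2: "c * (norm u)\<^sup>2 - c / 40 * (norm u)\<^sup>2 \<le> u \<bullet> (S i *v u)"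
        using coer[of u] by (simp add: power2_eq_square mult_ac)
      have 3: "?b - (1 / real n) *\<^sub>R (\<Sum>j<n. (1 / (1 + ls \<bullet> (Y i j - mu))) *\<^sub>R (Y i j - mu)) = Eb - E i"
        by (simp add: E_def G_def grad_gi_def)
      have "norm (Eb - E i) = norm ((Eb - A *v e) - (E i - A *v e))" by simp
      also have "\<dots> \<le> c / 40 * norm e + c / 40 * norm e"
        using q[OF i] by (intro order_trans[OF norm_triangle_ineq4] add_mono Ebe order_trans[OF E[OF i]] mult_right_mono) auto
      also have "\<dots> \<le> c / 20 * norm u"
        using ls c u by (simp add: e_def)
      finally have "norm u * norm (Eb - E i) \<le> norm u * (c / 20 * norm u)" by (intro mult_left_mono) auto
      moreover have "- (u \<bullet> (Eb - E i)) \<le> norm u * norm (Eb - E i)"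
        using norm_cauchy_schwarz[of "-u" "Eb - E i"] by simp
      ultimately have "u \<bullet> (Eb - E i) \<ge> - (c / 20 * (norm u)\<^sup>2)" by (simp add: power2_eq_square mult_ac)
      moreover have "0 < norm u" using u B(1) by linarith
      then have "0 < c * (norm u)\<^sup>2" using c by simp
      \<comment> \<open>The margin: curvature at least 39/40 * c / 9 against a gradient of at most c
        / 20, each times the squared radius.\<close>
      ultimately show ?thesis unfolding 1 3 using 2 by (simp add: algebra_simps)
    qed
    have *: "norm (loc i - ls) < B / 2 \<and>
        ?b = (1 / real n) *\<^sub>R (\<Sum>j<n. (1 / (1 + loc i \<bullet> (Y i j - mu))) *\<^sub>R (Y i j - mu))"
    proof (rule argmin_ln_sum[OF _ _ _ _ _ sphere])
      show "\<bar>ls \<bullet> (Y i j - mu)\<bar> \<le> 1/2" if "j \<in> {..<n}" for j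
      proof -
        have "\<bar>ls \<bullet> (Y i j - mu)\<bar> \<le> norm ls * norm (Y i j - mu)" by (rule Cauchy_Schwarz_ineq2)
        also have "\<dots> \<le> B * norm (Y i j - mu)" using ls B by (intro mult_right_mono) auto
        finally show ?thesis using Bz[of i j] i that by simp
      qed
      show "B / 2 * norm (Y i j - mu) \<le> 1/8" if "j \<in> {..<n}" for j
      proof -
        have "B / 2 * norm (Y i j - mu) \<le> B * norm (Y i j - mu)" using B by (intro mult_right_mono) auto
        then show ?thesis using B(2)[of i j] i that by simp
      qed
      have "dom_gi n (Y i) mu = {x. \<forall>a\<in>{..<n}. 0 < 1 + x \<bullet> (Y i a - mu)}" by (auto simp: dom_gi_def)
      moreover have "surrogate K n Y mu i lt
          = (\<lambda>x. ?b \<bullet> x - 1 / real n * (\<Sum>a\<in>{..<n}. ln (1 + x \<bullet> (Y i a - mu))))"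
        by (simp add: surrogate_def gi_def fun_eq_iff grad G_def)
      ultimately show "is_argmin (\<lambda>x. ?b \<bullet> x - 1 / real n * (\<Sum>a\<in>{..<n}. ln (1 + x \<bullet> (Y i a - mu))))
          {x. \<forall>a\<in>{..<n}. 0 < 1 + x \<bullet> (Y i a - mu)} (loc i)"
        using am[OF i] by simp
    qed (use n B in auto)
    show "norm (loc i - ls) < B / 2" using * by blast
    have "Eb - G i lt = - G i (loc i)" using * by (simp add: G_def grad_gi_def)
    then show "G i (loc i) - G i ls = E i - Eb" by (simp add: E_def algebra_simps)
  qed
  define v where "v = (\<lambda>i. loc i - ls)"
  have "norm ((1 / real K) *\<^sub>R (\<Sum>i<K. v i)) \<le> 4 / c\<^sup>2 * ((1 / real K) * (\<Sum>i<K. (q i)\<^sup>2)) * norm e"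
  proof (rule average_second_order[OF K c coer, where E=E and W="\<lambda>i. (A - S i) *v v i - D i (loc i)"])
    fix i assume i: "i < K"
    show "A *v v i = (A - S i) *v v i - D i (loc i) + (E i - (1 / real K) *\<^sub>R (\<Sum>i<K. E i))"
      using loc(2)[OF i]
      by (simp add: D_def v_def matrix_vector_mult_diff_rdistrib Eb_def w_def)
    have "norm (loc i) \<le> B"
      using norm_triangle_ineq[of "loc i - ls" ls] loc(1)[OF i] ls by simp
    then have "norm ((A - S i) *v v i - D i (loc i)) \<le> norm (A - S i) * norm (v i) + 10 * B * mom3 n (Y i) mu * norm (v i)"
      unfolding v_def using D[OF i]
      by (intro order_trans[OF norm_triangle_ineq4] add_mono norm_matrix_vector_le)
    then show "norm ((A - S i) *v v i - D i (loc i)) \<le> q i * norm (v i)"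
      by (simp add: q_def S_def algebra_simps norm_minus_commute)
    show "norm (E i - A *v e) \<le> q i * norm e" by (rule E[OF i])
    show "0 \<le> q i" by (rule q0)
    show "q i \<le> c / 2" using q[OF i] c by simp
  qed
  moreover have "(1 / real K) *\<^sub>R (\<Sum>i<K. v i) = (1 / real K) *\<^sub>R (\<Sum>i<K. loc i) - ls"
    using w by (simp add: v_def w_def sum_subtractf scaleR_diff_right sum_constant_scaleR del: sum_constant)
  ultimately show ?thesis by (simp add: e_def)
qed

lemma iterated_contraction:
  fixes A :: "real^'d^'d" and Y :: "nat \<Rightarrow> nat \<Rightarrow> real^'d" and mu ls :: "real^'d" and l :: "nat \<Rightarrow> real^'d"
  assumes K: "0 < K" and n: "0 < n" and c: "0 < c"
    and coer: "\<And>v. c * (norm v)\<^sup>2 \<le> v \<bullet> (A *v v)"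
    and B: "0 < B" "\<And>i j. i < K \<Longrightarrow> j < n \<Longrightarrow> B * norm (Y i j - mu) \<le> 1/8"
    and ls: "norm ls \<le> B / 2" "norm (l 0 - ls) \<le> B / 2"
    and stat: "grad_g K n Y mu ls = 0"
    and q_def: "\<And>i. q i = norm (emp_cov n (Y i) mu - A) + 10 * B * mom3 n (Y i) mu"
    and q: "\<And>i. i < K \<Longrightarrow> q i \<le> c / 40"
    and rho: "4 / c\<^sup>2 * ((1 / real K) * (\<Sum>i<K. (q i)\<^sup>2)) \<le> rho" "rho \<le> 1"
    and am: "\<And>i t. i < K \<Longrightarrow> t < T \<Longrightarrow> is_argmin (surrogate K n Y mu i (l t)) (dom_gi n (Y i) mu) (loc (Suc t) i)"
    and step: "\<And>t. t < T \<Longrightarrow> l (Suc t) = (1 / real K) *\<^sub>R (\<Sum>i<K. loc (Suc t) i)"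
  shows "norm (l T - ls) \<le> rho ^ T * norm (l 0 - ls)"
proof -
  have "0 \<le> 4 / c\<^sup>2 * ((1 / real K) * (\<Sum>i<K. (q i)\<^sup>2))" by (simp add: sum_nonneg)
  then have rho0: "0 \<le> rho" using rho by linarith
  have "norm (l t - ls) \<le> rho ^ t * norm (l 0 - ls)" if "t \<le> T" for t
    using that
  proof (induction t)
    case (Suc t)
    have IH: "norm (l t - ls) \<le> rho ^ t * norm (l 0 - ls)" using Suc by simp
    \<comment> \<open>\<open>rho\<close> <= 1 keeps every iterate within B / 2 of \<open>ls\<close>,
      the range in which a round is known to contract.\<close>
    also have "\<dots> \<le> 1 * norm (l 0 - ls)" using rho rho0 by (intro mult_right_mono power_le_one) auto
    finally have small: "norm (l t - ls) \<le> B / 2" using ls by simp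
    have "norm (l (Suc t) - ls) \<le> 4 / c\<^sup>2 * ((1 / real K) * (\<Sum>i<K. (q i)\<^sup>2)) * norm (l t - ls)"
      using step[of t] round_contraction[OF K n c coer B ls(1) small stat q_def q am[of _ t]] Suc.prems by simp
    also have "\<dots> \<le> rho * (rho ^ t * norm (l 0 - ls))"
      using rho rho0 IH by (intro mult_mono) auto
    finally show ?case by (simp add: mult.assoc)
  qed simp
  then show ?thesis by simp
qed

text \<open>This is \<open>argmin_ln_sum\<close> centred at 0 with all observations in one index
  set. On the sphere the averaged squares are at least c / 2 * r^2, and the factor 1/9 leaves c *
  r^2 / 18; hence the 18 in the condition on the gradient at 0.\<close>

lemma global_argmin:
  fixes A :: "real^'d^'d" and Y :: "nat \<Rightarrow> nat \<Rightarrow> real^'d" and mu ls :: "real^'d"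
  assumes K: "0 < K" and n: "0 < n" and c: "0 < c"
    and coer: "\<And>v. c * (norm v)\<^sup>2 \<le> v \<bullet> (A *v v)"
    and r: "0 < r" "\<And>i j. i < K \<Longrightarrow> j < n \<Longrightarrow> r * norm (Y i j - mu) \<le> 1/8"
    and S: "\<And>i. i < K \<Longrightarrow> norm (emp_cov n (Y i) mu - A) \<le> c / 2"
    and Zb: "18 * norm (grad_g K n Y mu 0) < c * r"
    and am: "is_argmin (g_glob K n Y mu) (dom_g K n Y mu) ls"
  shows "norm ls < r" "grad_g K n Y mu ls = 0"
proof -
  define w where "w = 1 / real K * (1 / real n)"
  have w: "0 < w" using K n by (simp add: w_def)
  let ?A = "{..<K} \<times> {..<n}"
  define z where "z = (\<lambda>a. Y (fst a) (snd a) - mu)"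
  have gg: "grad_g K n Y mu x = - w *\<^sub>R (\<Sum>a\<in>?A. (1 / (1 + x \<bullet> z a)) *\<^sub>R z a)" for x
    by (simp add: grad_g_def grad_gi_def z_def w_def sum.cartesian_product' scaleR_sum_right sum_negf mult.assoc)
  have *: "norm (ls - 0) < r \<and> 0 = w *\<^sub>R (\<Sum>a\<in>?A. (1 / (1 + ls \<bullet> z a)) *\<^sub>R z a)"
  proof (rule argmin_ln_sum[OF _ w r(1)])
    fix u :: "real^'d" assume u: "norm u = r"
    have "c / 2 * (norm u)\<^sup>2 \<le> u \<bullet> (emp_cov n (Y i) mu *v u)" if "i < K" for i
    proof -
      have "u \<bullet> (A *v u) - u \<bullet> (emp_cov n (Y i) mu *v u) = u \<bullet> ((A - emp_cov n (Y i) mu) *v u)"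
        by (simp add: inner_diff_right matrix_vector_mult_diff_rdistrib)
      also have "\<dots> \<le> norm u * (norm (A - emp_cov n (Y i) mu) * norm u)"
        by (rule order_trans[OF norm_cauchy_schwarz]) (intro mult_left_mono norm_matrix_vector_le; simp)
      also have "\<dots> \<le> norm u * (c / 2 * norm u)"
        using S[OF that] by (intro mult_left_mono mult_right_mono) (auto simp: norm_minus_commute)
      finally show ?thesis using coer[of u] by (simp add: power2_eq_square mult_ac)
    qed
    then have "1 / real K * (\<Sum>i<K. c / 2 * (norm u)\<^sup>2) \<le> 1 / real K * (\<Sum>i<K. u \<bullet> (emp_cov n (Y i) mu *v u))"
      by (intro mult_left_mono sum_mono) auto
    also have "\<dots> = w * (\<Sum>a\<in>?A. (u \<bullet> z a)\<^sup>2)"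
      by (simp add: emp_cov_quadratic z_def w_def sum.cartesian_product' sum_distrib_left mult_ac)
    finally have 1: "c / 2 * r\<^sup>2 \<le> w * (\<Sum>a\<in>?A. (u \<bullet> z a)\<^sup>2)" using K u by simp
    have 2: "0 - w *\<^sub>R (\<Sum>a\<in>?A. (1 / (1 + 0 \<bullet> z a)) *\<^sub>R z a) = grad_g K n Y mu 0"
      by (simp add: gg)
    have "- (u \<bullet> grad_g K n Y mu 0) \<le> r * norm (grad_g K n Y mu 0)"
      using norm_cauchy_schwarz[of "-u" "grad_g K n Y mu 0"] u by simp
    moreover have "r * (18 * norm (grad_g K n Y mu 0)) < r * (c * r)"
      using Zb r by (intro mult_strict_left_mono) auto
    ultimately show "0 < w / 9 * (\<Sum>a\<in>?A. (u \<bullet> z a)\<^sup>2)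
        + u \<bullet> (0 - w *\<^sub>R (\<Sum>a\<in>?A. (1 / (1 + 0 \<bullet> z a)) *\<^sub>R z a))"
      unfolding 2 using 1 by (simp add: power2_eq_square mult_ac)
  next
    show "is_argmin (\<lambda>x. 0 \<bullet> x - w * (\<Sum>a\<in>?A. ln (1 + x \<bullet> z a))) {x. \<forall>a\<in>?A. 0 < 1 + x \<bullet> z a} ls"
    proof -
      have "dom_g K n Y mu = {x. \<forall>a\<in>?A. 0 < 1 + x \<bullet> z a}" by (auto simp: dom_g_def z_def)
      moreover have "g_glob K n Y mu = (\<lambda>x. 0 \<bullet> x - w * (\<Sum>a\<in>?A. ln (1 + x \<bullet> z a)))"
        by (simp add: g_glob_def gi_def fun_eq_iff w_def z_def sum.cartesian_product' sum_distrib_left sum_negf)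
      ultimately show ?thesis using am by simp
    qed
  qed (use r in \<open>auto simp: z_def\<close>)
  show "norm ls < r" using * by simp
  show "grad_g K n Y mu ls = 0" using * unfolding gg by simp
qed

text \<open>Since A x is minus the gradient at 0, the quadratic part 2 (l . A x) - l . A l of the
  statistic falls short of x . A x by a square in l - x. An error in \<open>l\<close> is thus felt
  to second order only. The bound is meant for \<open>B\<close> of order 1 / sqrt N, where the
  prefactor N * B^2 stays bounded and the bracket is small.\<close>

lemma l_DEL_expansion:
  fixes A :: "real^'d^'d" and Y :: "nat \<Rightarrow> nat \<Rightarrow> real^'d" and mu l ls x :: "real^'d"
  assumes K: "0 < K" and n: "0 < n" and c: "0 < c"
    and coer: "\<And>v. c * (norm v)\<^sup>2 \<le> v \<bullet> (A *v v)"
    and sym: "\<And>u v. u \<bullet> (A *v v) = v \<bullet> (A *v u)"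
    and B: "\<And>i j. i < K \<Longrightarrow> j < n \<Longrightarrow> B * norm (Y i j - mu) \<le> 1/2"
    and ls: "norm ls \<le> B" and l: "norm l \<le> B" and del: "norm (l - ls) \<le> del * B"
    and S: "\<And>i. i < K \<Longrightarrow> norm (emp_cov n (Y i) mu - A) \<le> eta"
    and stat: "grad_g K n Y mu ls = 0"
    and x: "A *v x = - grad_g K n Y mu 0"
    and m: "1 / real K * (\<Sum>i<K. mom3 n (Y i) mu) \<le> m"
  shows "\<bar>l_DEL K n Y mu l - real (n * K) * (x \<bullet> (A *v x))\<bar>
     \<le> real (n * K) * B\<^sup>2 * (norm A * (del + (eta + 10 * B * m) / c)\<^sup>2 + eta + 2 * B * m)"
proof -
  define w where "w = 1 / real K"
  have w: "0 < w" "w * real K = 1" using K by (auto simp: w_def)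
  define S where "S = w *\<^sub>R (\<Sum>i<K. emp_cov n (Y i) mu)"
  define Zb where "Zb = - grad_g K n Y mu 0"
  have Smult: "S *v v = w *\<^sub>R (\<Sum>i<K. emp_cov n (Y i) mu *v v)" for v
  proof -
    have lin: "linear (\<lambda>M::real^'d^'d. M *v v)"
      by (intro linearI) (auto simp: matrix_vector_mult_add_rdistrib scaleR_matrix_vector_assoc)
    show ?thesis unfolding S_def linear_scale[OF lin] linear_sum[OF lin] ..
  qed
  have "S - A = w *\<^sub>R (\<Sum>i<K. emp_cov n (Y i) mu - A)"
    using w by (simp add: S_def sum_subtractf scaleR_diff_right sum_constant_scaleR del: sum_constant)
  also have "norm \<dots> \<le> w * (\<Sum>i<K. eta)" using w assms by (intro sum_norm_scaled_le) auto
  finally have SA: "norm (S - A) \<le> eta" using w by (simp add: mult.assoc[symmetric])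
  have B0: "0 \<le> B" using ls norm_ge_zero[of ls] by linarith
  have gr: "norm (Zb - S *v ls) \<le> 10 * B * m * norm ls"
  proof -
    have "Zb - S *v ls = w *\<^sub>R (\<Sum>i<K. grad_gi n (Y i) mu ls - grad_gi n (Y i) mu 0 - emp_cov n (Y i) mu *v (ls - 0))"
      using stat by (simp add: Zb_def Smult grad_g_def w_def sum_subtractf scaleR_diff_right)
    also have "norm \<dots> \<le> w * (\<Sum>i<K. 10 * B * mom3 n (Y i) mu * norm (ls - 0))"
      using B ls B0 w by (intro sum_norm_scaled_le grad_gi_diff) auto
    also have "\<dots> = 10 * B * norm ls * (w * (\<Sum>i<K. mom3 n (Y i) mu))"
      by (simp add: sum_distrib_left mult_ac)
    also have "\<dots> \<le> 10 * B * norm ls * m" using m B0 by (intro mult_left_mono) (auto simp: w_def)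
    finally show ?thesis by (simp add: mult_ac)
  qed
  have "0 \<le> 1 / real K * (\<Sum>i<K. mom3 n (Y i) mu)" by (simp add: sum_nonneg mom3_nonneg)
  then have m0: "0 \<le> m" using m by linarith
  have eta0: "0 \<le> eta" using SA norm_ge_zero[of "S - A"] by linarith
  \<comment> \<open>Stationarity of \<open>ls\<close> makes S ls nearly equal to \<open>Zb\<close>,
    which is A x; coercivity transfers this to ls - x.\<close>
  have lsx: "norm (ls - x) \<le> (eta + 10 * B * m) / c * B"
  proof -
    have "c * norm (ls - x) \<le> norm (A *v (ls - x))" by (rule coercive_norm_le[OF coer])
    also have "A *v (ls - x) = - ((S - A) *v ls) - (Zb - S *v ls)"
      using x by (simp add: Zb_def matrix_vector_mult_diff_distrib matrix_vector_mult_diff_rdistrib)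
    also have "norm \<dots> \<le> eta * norm ls + 10 * B * m * norm ls"
      using gr SA
      by (intro add_mono[THEN order_trans[OF norm_triangle_ineq4]])
         (auto intro!: order_trans[OF norm_matrix_vector_le] mult_right_mono)
    also have "\<dots> \<le> (eta + 10 * B * m) * B"
      using ls eta0 B0 m0 by (simp add: distrib_right[symmetric] mult_left_mono)
    finally show ?thesis using c by (simp add: field_simps)
  qed
  have lx: "norm (l - x) \<le> (del + (eta + 10 * B * m) / c) * B"
    using norm_triangle_ineq[of "l - ls" "ls - x"] del lsx by (simp add: algebra_simps)
  define err where "err = (\<lambda>i. (1 / real n) * (\<Sum>j<n. ln (1 + l \<bullet> (Y i j - mu)) - l \<bullet> (Y i j - mu) + (l \<bullet> (Y i j - mu))\<^sup>2 / 2))"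
  define Err where "Err = w * (\<Sum>i<K. err i)"
  have "l_DEL K n Y mu l = real (n * K) * 2 * (w * (\<Sum>i<K. (1 / real n) * (\<Sum>j<n. ln (1 + l \<bullet> (Y i j - mu)))))"
    using K n by (simp add: l_DEL_def w_def sum_distrib_left[symmetric] sum_divide_distrib[symmetric])
  also have "(\<Sum>i<K. (1 / real n) * (\<Sum>j<n. ln (1 + l \<bullet> (Y i j - mu))))
     = (\<Sum>i<K. err i - l \<bullet> grad_gi n (Y i) mu 0 - (l \<bullet> (emp_cov n (Y i) mu *v l)) / 2)"
  proof (rule sum.cong[OF refl])
    fix i
    have "l \<bullet> grad_gi n (Y i) mu 0 = - ((1 / real n) * (\<Sum>j<n. l \<bullet> (Y i j - mu)))"
      by (simp add: grad_gi_def inner_sum_right)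
    then show "(1 / real n) * (\<Sum>j<n. ln (1 + l \<bullet> (Y i j - mu)))
      = err i - l \<bullet> grad_gi n (Y i) mu 0 - (l \<bullet> (emp_cov n (Y i) mu *v l)) / 2"
      by (simp add: err_def emp_cov_quadratic sum.distrib sum_subtractf sum_divide_distrib[symmetric]
          add_divide_distrib diff_divide_distrib)
  qed
  also have "w * \<dots> = Err + l \<bullet> Zb - l \<bullet> (S *v l) / 2"
    by (simp add: Err_def Zb_def grad_g_def Smult sum_subtractf inner_sum_right w_def
        sum_divide_distrib[symmetric] right_diff_distrib)
  finally have l_eq: "l_DEL K n Y mu l = real (n * K) * (2 * (l \<bullet> (A *v x)) - l \<bullet> (S *v l) + 2 * Err)"
    using x by (simp add: Zb_def algebra_simps)
  have "\<bar>Err\<bar> \<le> w * (\<Sum>i<K. norm l ^ 3 * mom3 n (Y i) mu)"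
  proof -
    have lz: "\<bar>ln (1 + l \<bullet> (Y i j - mu)) - l \<bullet> (Y i j - mu) + (l \<bullet> (Y i j - mu))\<^sup>2 / 2\<bar> \<le> norm l ^ 3 * norm (Y i j - mu) ^ 3"
      if "i < K" "j < n" for i j
    proof -
      have 1: "\<bar>l \<bullet> (Y i j - mu)\<bar> \<le> norm l * norm (Y i j - mu)" by (rule Cauchy_Schwarz_ineq2)
      also have "\<dots> \<le> B * norm (Y i j - mu)" using l by (intro mult_right_mono) auto
      also have "\<dots> \<le> 1/2" by (rule B[OF that])
      finally have "\<bar>ln (1 + l \<bullet> (Y i j - mu)) - l \<bullet> (Y i j - mu) + (l \<bullet> (Y i j - mu))\<^sup>2 / 2\<bar> \<le> \<bar>l \<bullet> (Y i j - mu)\<bar> ^ 3"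
        by (rule ln_one_plus_cubic)
      also have "\<dots> \<le> (norm l * norm (Y i j - mu)) ^ 3" using 1 by (intro power_mono) auto
      finally show ?thesis by (simp add: power_mult_distrib)
    qed
    have "\<bar>(1 / real n) * (\<Sum>j<n. ln (1 + l \<bullet> (Y i j - mu)) - l \<bullet> (Y i j - mu) + (l \<bullet> (Y i j - mu))\<^sup>2 / 2)\<bar>
       \<le> norm l ^ 3 * mom3 n (Y i) mu" if "i < K" for i
    proof -
      have "norm ((1 / real n) *\<^sub>R (\<Sum>j<n. ln (1 + l \<bullet> (Y i j - mu)) - l \<bullet> (Y i j - mu) + (l \<bullet> (Y i j - mu))\<^sup>2 / 2))
        \<le> (1 / real n) * (\<Sum>j<n. norm l ^ 3 * norm (Y i j - mu) ^ 3)"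
        using lz[OF that] by (intro sum_norm_scaled_le) auto
      then show ?thesis by (simp add: mom3_def sum_distrib_left[symmetric] mult_ac)
    qed
    then have "norm (w *\<^sub>R (\<Sum>i<K. (1 / real n) * (\<Sum>j<n. ln (1 + l \<bullet> (Y i j - mu)) - l \<bullet> (Y i j - mu) + (l \<bullet> (Y i j - mu))\<^sup>2 / 2)))
       \<le> w * (\<Sum>i<K. norm l ^ 3 * mom3 n (Y i) mu)"
      using w by (intro sum_norm_scaled_le) auto
    then show ?thesis by (simp add: Err_def err_def)
  qed
  also have "\<dots> = norm l ^ 3 * (w * (\<Sum>i<K. mom3 n (Y i) mu))" by (simp add: sum_distrib_left mult_ac)
  also have "\<dots> \<le> B ^ 3 * m"
    using m l B0 m0 w by (intro mult_mono power_mono) (auto simp: w_def sum_nonneg mom3_nonneg)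
  finally have Err: "\<bar>Err\<bar> \<le> B\<^sup>2 * (B * m)" by (simp add: power3_eq_cube power2_eq_square mult_ac)
  \<comment> \<open>Completing the square after splitting S into A and S - A; symmetry of
    \<open>A\<close> merges the mixed terms.\<close>
  have alg: "2 * (l \<bullet> (A *v x)) - l \<bullet> (S *v l)
     = x \<bullet> (A *v x) - (l - x) \<bullet> (A *v (l - x)) - l \<bullet> ((S - A) *v l)"
    using sym[of x l]
    by (simp add: matrix_vector_mult_diff_distrib matrix_vector_mult_diff_rdistrib inner_diff_left inner_diff_right)
  have quad: "\<bar>u \<bullet> (C *v u)\<bar> \<le> norm C * (norm u)\<^sup>2" for u and C :: "real^'d^'d"
    by (rule order_trans[OF Cauchy_Schwarz_ineq2])
       (use mult_left_mono[OF norm_matrix_vector_le norm_ge_zero] in \<open>simp add: power2_eq_square mult_ac\<close>)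
  have "\<bar>(l - x) \<bullet> (A *v (l - x))\<bar> \<le> norm A * (norm (l - x))\<^sup>2" by (rule quad)
  also have "\<dots> \<le> norm A * ((del + (eta + 10 * B * m) / c) * B)\<^sup>2"
    using lx by (intro mult_left_mono power_mono) auto
  finally have 1: "\<bar>(l - x) \<bullet> (A *v (l - x))\<bar> \<le> B\<^sup>2 * (norm A * (del + (eta + 10 * B * m) / c)\<^sup>2)"
    by (simp add: power_mult_distrib mult_ac)
  have "\<bar>l \<bullet> ((S - A) *v l)\<bar> \<le> norm (S - A) * (norm l)\<^sup>2" by (rule quad)
  also have "\<dots> \<le> eta * B\<^sup>2" using SA l eta0 by (intro mult_mono power_mono) auto
  finally have 2: "\<bar>l \<bullet> ((S - A) *v l)\<bar> \<le> B\<^sup>2 * eta" by (simp add: mult.commute)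
  have "\<bar>2 * (l \<bullet> (A *v x)) - l \<bullet> (S *v l) + 2 * Err - x \<bullet> (A *v x)\<bar>
     \<le> B\<^sup>2 * (norm A * (del + (eta + 10 * B * m) / c)\<^sup>2) + B\<^sup>2 * eta + 2 * (B\<^sup>2 * (B * m))"
    unfolding alg using 1 2 Err by linarith
  also have "\<dots> = B\<^sup>2 * (norm A * (del + (eta + 10 * B * m) / c)\<^sup>2 + eta + 2 * B * m)"
    by (simp add: algebra_simps)
  finally have "real (n * K) * \<bar>2 * (l \<bullet> (A *v x)) - l \<bullet> (S *v l) + 2 * Err - x \<bullet> (A *v x)\<bar>
     \<le> real (n * K) * (B\<^sup>2 * (norm A * (del + (eta + 10 * B * m) / c)\<^sup>2 + eta + 2 * B * m))"
    by (intro mult_left_mono) auto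
  moreover have "l_DEL K n Y mu l - real (n * K) * (x \<bullet> (A *v x))
      = real (n * K) * (2 * (l \<bullet> (A *v x)) - l \<bullet> (S *v l) + 2 * Err - x \<bullet> (A *v x))"
    unfolding l_eq by (simp add: algebra_simps)
  ultimately show ?thesis by (simp add: abs_mult mult.assoc)
qed

section \<open>Events of high probability\<close>

text \<open>The exceptional sets need not be measurable (the local minimisers are arbitrary functions),
  so they are only required to be covered by small events.\<close>

definition evt_prob :: "'a measure \<Rightarrow> real \<Rightarrow> (nat \<Rightarrow> 'a \<Rightarrow> bool) \<Rightarrow> bool" where
  "evt_prob M e P \<longleftrightarrow> (\<forall>\<^sub>F n in sequentially. \<exists>A\<in>sets M. {\<omega>\<in>space M. \<not> P n \<omega>} \<subseteq> A \<and> measure M A < e)"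

text \<open>Kept apart from \<open>evt_prob\<close> because a bound in probability has a constant
  that varies with \<open>e\<close>, whereas here one family of events serves every
  \<open>e\<close>.\<close>

definition whp :: "'a measure \<Rightarrow> (nat \<Rightarrow> 'a \<Rightarrow> bool) \<Rightarrow> bool" where
  "whp M P \<longleftrightarrow> (\<forall>e>0. evt_prob M e P)"

lemma evt_prob_conj:
  assumes "evt_prob M e P" "evt_prob M e' Q"
  shows "evt_prob M (e + e') (\<lambda>n \<omega>. P n \<omega> \<and> Q n \<omega>)"
  using assms unfolding evt_prob_def
proof eventually_elim
  case (elim n)
  then obtain A B where A: "A \<in> sets M" "{\<omega>\<in>space M. \<not> P n \<omega>} \<subseteq> A" "measure M A < e"
    and B: "B \<in> sets M" "{\<omega>\<in>space M. \<not> Q n \<omega>} \<subseteq> B" "measure M B < e'" by blast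
  have "measure M (A \<union> B) \<le> measure M A + measure M B" by (rule measure_Un_le[OF A(1) B(1)])
  then show ?case using A B by (intro bexI[of _ "A \<union> B"]) auto
qed

lemma evt_prob_mono:
  assumes "evt_prob M e P" "\<forall>\<^sub>F n in sequentially. \<forall>\<omega>\<in>space M. P n \<omega> \<longrightarrow> Q n \<omega>"
  shows "evt_prob M e Q"
  using assms unfolding evt_prob_def
proof eventually_elim
  case (elim n)
  then obtain A where A: "A \<in> sets M" "{\<omega>\<in>space M. \<not> P n \<omega>} \<subseteq> A" "measure M A < e" by blast
  moreover have "{\<omega>\<in>space M. \<not> Q n \<omega>} \<subseteq> A" using A elim by blast
  ultimately show ?case by blast
qed

lemma whp_mono:
  assumes "whp M P" "\<forall>\<^sub>F n in sequentially. \<forall>\<omega>\<in>space M. P n \<omega> \<longrightarrow> Q n \<omega>"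
  shows "whp M Q"
  using assms evt_prob_mono unfolding whp_def by blast

lemma whp_conj:
  assumes "whp M P" "whp M Q"
  shows "whp M (\<lambda>n \<omega>. P n \<omega> \<and> Q n \<omega>)"
  unfolding whp_def
proof (intro allI impI)
  fix e :: real assume "0 < e"
  then have "evt_prob M (e/2) P" "evt_prob M (e/2) Q" using assms by (auto simp: whp_def)
  from evt_prob_conj[OF this] show "evt_prob M e (\<lambda>n \<omega>. P n \<omega> \<and> Q n \<omega>)" by simp
qed

lemma whp_ball:
  assumes "finite I" "\<And>i. i \<in> I \<Longrightarrow> whp M (P i)"
  shows "whp M (\<lambda>n \<omega>. \<forall>i\<in>I. P i n \<omega>)"
  using assms
proof (induction I)
  case empty
  show ?case by (auto simp: whp_def evt_prob_def intro!: always_eventually exI[of _ "{}"] bexI[of _ "{}"])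
next
  case (insert i I)
  then have "whp M (\<lambda>n \<omega>. P i n \<omega> \<and> (\<forall>i\<in>I. P i n \<omega>))" by (intro whp_conj) auto
  then show ?case by simp
qed

lemma whp_of_measure_bound:
  assumes "\<forall>\<^sub>F n in sequentially. {\<omega>\<in>space M. \<not> P n \<omega>} \<in> sets M"
    "\<forall>\<^sub>F n in sequentially. measure M {\<omega>\<in>space M. \<not> P n \<omega>} \<le> b n" "b \<longlonglongrightarrow> 0"
  shows "whp M P"
  unfolding whp_def evt_prob_def
proof (intro allI impI)
  fix e :: real assume "0 < e"
  with assms(3) have "\<forall>\<^sub>F n in sequentially. b n < e" by (rule order_tendstoD)
  with assms(1,2) show "\<forall>\<^sub>F n in sequentially. \<exists>A\<in>sets M. {\<omega>\<in>space M. \<not> P n \<omega>} \<subseteq> A \<and> measure M A < e"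
  proof eventually_elim
    case (elim n) then show ?case by (intro bexI[of _ "{\<omega>\<in>space M. \<not> P n \<omega>}"]) auto
  qed
qed

lemma (in prob_space) markov_bound:
  fixes f :: "nat \<Rightarrow> 'a \<Rightarrow> real"
  assumes f: "\<forall>\<^sub>F n in sequentially. integrable M (f n)" "\<And>n \<omega>. \<omega> \<in> space M \<Longrightarrow> 0 \<le> f n \<omega>"
    and m: "\<forall>\<^sub>F n in sequentially. expectation (f n) \<le> m * r n"
    and r: "\<forall>\<^sub>F n in sequentially. 0 < r n" and e: "0 < e"
  shows "\<exists>C>0. evt_prob M e (\<lambda>n \<omega>. f n \<omega> \<le> C * r n)"
proof -
  \<comment> \<open>The 2 and the + 1 make C positive and m / C < e strict, whatever the sign of
    m.\<close>
  define C where "C = 2 * (\<bar>m\<bar> + 1) / e"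
  have C: "0 < C" using e by (auto simp: C_def)
  have "evt_prob M e (\<lambda>n \<omega>. f n \<omega> \<le> C * r n)"
    unfolding evt_prob_def using f(1) m r
  proof eventually_elim
    case (elim n)
    have meas[measurable]: "f n \<in> borel_measurable M" using elim by auto
    have "prob {\<omega>\<in>space M. C * r n \<le> f n \<omega>} \<le> expectation (f n) / (C * r n)"
      using elim f(2) C by (intro integral_Markov_inequality_measure[where A="{}"]) auto
    also have "\<dots> \<le> (m * r n) / (C * r n)" using elim C by (intro divide_right_mono) auto
    also have "\<dots> = m / C" using elim by simp
    also have "\<dots> < e"
    proof -
      have "m < 2 * (\<bar>m\<bar> + 1)" by simp
      also have "\<dots> = e * C" using e by (simp add: C_def)
      finally show ?thesis using C by (simp add: field_simps)
    qed
    finally have "prob {\<omega>\<in>space M. C * r n \<le> f n \<omega>} < e" .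
    then show ?case
      by (intro bexI[of _ "{\<omega>\<in>space M. C * r n \<le> f n \<omega>}"]) auto
  qed
  then show ?thesis using C by blast
qed

section \<open>Second moments and exponential tails of independent sums\<close>

lemma (in prob_space) indep_sum_square:
  fixes Y :: "'i \<Rightarrow> 'a \<Rightarrow> real"
  assumes "finite I" "indep_vars (\<lambda>_. borel) Y I"
    and "\<And>i. i \<in> I \<Longrightarrow> integrable M (\<lambda>\<omega>. (Y i \<omega>)\<^sup>2)"
    and "\<And>i. i \<in> I \<Longrightarrow> expectation (Y i) = 0"
    and "\<And>i. i \<in> I \<Longrightarrow> expectation (\<lambda>\<omega>. (Y i \<omega>)\<^sup>2) \<le> v"
  shows "integrable M (\<lambda>\<omega>. (\<Sum>i\<in>I. Y i \<omega>)\<^sup>2) \<and> expectation (\<lambda>\<omega>. (\<Sum>i\<in>I. Y i \<omega>)\<^sup>2) \<le> real (card I) * v"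
  using assms
proof (induction I)
  case (insert i I)
  let ?S = "\<lambda>\<omega>. \<Sum>i\<in>I. Y i \<omega>"
  have rv: "random_variable borel (Y j)" if "j \<in> insert i I" for j
    using insert.prems(1) that by (auto simp: indep_vars_def2)
  then have [measurable]: "random_variable borel (Y i)" "random_variable borel ?S" by auto
  have int: "integrable M (Y j)" if "j \<in> insert i I" for j
    using square_integrable_imp_integrable[OF rv[OF that] insert.prems(2)[OF that]] .
  have IH: "integrable M (\<lambda>\<omega>. (?S \<omega>)\<^sup>2)" "expectation (\<lambda>\<omega>. (?S \<omega>)\<^sup>2) \<le> real (card I) * v"
    using insert.IH insert.prems indep_vars_subset[OF insert.prems(1)] by auto
  have intS: "integrable M ?S" using int by auto
  have ind: "indep_var borel (Y i) borel ?S"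
    using insert by (intro indep_vars_sum) auto
  have cross: "integrable M (\<lambda>\<omega>. Y i \<omega> * ?S \<omega>)" "expectation (\<lambda>\<omega>. Y i \<omega> * ?S \<omega>) = 0"
    using indep_var_integrable[OF ind int intS] indep_var_lebesgue_integral[OF ind int intS] insert.prems(3)
    by auto
  have eq: "(\<Sum>i\<in>insert i I. Y i \<omega>)\<^sup>2 = (Y i \<omega>)\<^sup>2 + 2 * (Y i \<omega> * ?S \<omega>) + (?S \<omega>)\<^sup>2" for \<omega>
    using insert.hyps by (simp add: power2_sum)
  have "integrable M (\<lambda>\<omega>. (\<Sum>i\<in>insert i I. Y i \<omega>)\<^sup>2)"
    unfolding eq using cross IH insert.prems(2) by auto
  moreover have "expectation (\<lambda>\<omega>. (\<Sum>i\<in>insert i I. Y i \<omega>)\<^sup>2) \<le> real (card (insert i I)) * v"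
    unfolding eq using cross IH insert.prems(2) insert.prems(4)[of i] insert.hyps
    by (simp add: algebra_simps)
  ultimately show ?case by blast
qed auto

text \<open>Taylor's formula of second order, where the intermediate point of the remainder is at
  most t * b. The exponent keeps the second moment apart from \<open>b\<close>; this matters because
  the truncated variables have bounded second moments but a bound of order n.\<close>

lemma (in prob_space) bounded_mgf:
  fixes f :: "'a \<Rightarrow> real"
  assumes [measurable]: "f \<in> borel_measurable M" and b: "\<And>x. x \<in> space M \<Longrightarrow> \<bar>f x\<bar> \<le> b" and t: "0 \<le> t"
  shows "expectation (\<lambda>x. exp (t * f x)) \<le> exp (t * expectation f + t\<^sup>2 * expectation (\<lambda>x. (f x)\<^sup>2) * exp (t * b) / 2)"
proof -
  have int: "integrable M f" "integrable M (\<lambda>x. (f x)\<^sup>2)" "integrable M (\<lambda>x. exp (t * f x))"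
  proof -
    show "integrable M f" using b by (intro integrable_const_bound[of _ b]) auto
    show "integrable M (\<lambda>x. (f x)\<^sup>2)"
      using power_mono[OF b, of _ 2] by (intro integrable_const_bound[of _ "b\<^sup>2"]) auto
    show "integrable M (\<lambda>x. exp (t * f x))"
      using b t by (intro integrable_const_bound[of _ "exp (t * b)"])
        (auto intro!: AE_I2 mult_left_mono simp: abs_le_iff)
  qed
  have pt: "exp (t * f x) \<le> 1 + t * f x + t\<^sup>2 * exp (t * b) / 2 * (f x)\<^sup>2" if x: "x \<in> space M" for x
  proof -
    obtain s where s: "\<bar>s\<bar> \<le> \<bar>t * f x\<bar>" "exp (t * f x) = (\<Sum>m<2. (t * f x) ^ m / fact m) + exp s / fact 2 * (t * f x) ^ 2"
      using Maclaurin_exp_le[of "t * f x" 2] by auto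
    have "s \<le> t * b"
      using s(1) mult_left_mono[OF b[OF x] t] t by (auto simp: abs_mult)
    then have "exp s / 2 * (t * f x)\<^sup>2 \<le> exp (t * b) / 2 * (t * f x)\<^sup>2"
      by (intro mult_right_mono) auto
    then show ?thesis using s(2) by (simp add: numeral_2_eq_2 power_mult_distrib mult_ac)
  qed
  have "expectation (\<lambda>x. exp (t * f x)) \<le> expectation (\<lambda>x. 1 + t * f x + t\<^sup>2 * exp (t * b) / 2 * (f x)\<^sup>2)"
    using int pt by (intro integral_mono) auto
  also have "\<dots> = 1 + (t * expectation f + t\<^sup>2 * expectation (\<lambda>x. (f x)\<^sup>2) * exp (t * b) / 2)"
    using int by (simp add: prob_space mult_ac)
  also have "\<dots> \<le> exp (t * expectation f + t\<^sup>2 * expectation (\<lambda>x. (f x)\<^sup>2) * exp (t * b) / 2)"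
    by (rule exp_ge_add_one_self)
  finally show ?thesis .
qed

text \<open>Markov's inequality for the exponential of the sum, factorised by independence. The
  parameter \<open>t\<close> stays free; its later choice makes exp (t * b) equal to sqrt n.\<close>

lemma (in prob_space) bounded_sum_tail:
  fixes Y :: "'i \<Rightarrow> 'a \<Rightarrow> real"
  assumes I: "finite I" "indep_vars (\<lambda>_. borel) Y I"
    and b: "\<And>i x. i \<in> I \<Longrightarrow> x \<in> space M \<Longrightarrow> \<bar>Y i x\<bar> \<le> b" and t: "0 \<le> t"
    and m: "\<And>i. i \<in> I \<Longrightarrow> expectation (Y i) = m"
    and v: "\<And>i. i \<in> I \<Longrightarrow> expectation (\<lambda>x. (Y i x)\<^sup>2) \<le> v"
  shows "prob {\<omega>\<in>space M. real (card I) * (m + eps) \<le> (\<Sum>i\<in>I. Y i \<omega>)}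
         \<le> exp (real (card I) * (t\<^sup>2 * v * exp (t * b) / 2 - t * eps))"
proof -
  have rv[measurable]: "random_variable borel (Y j)" if "j \<in> I" for j
    using I that by (auto simp: indep_vars_def2)
  have ind: "indep_vars (\<lambda>_. borel) (\<lambda>i x. exp (t * Y i x)) I"
    by (rule indep_vars_compose2[OF I(2)]) auto
  have int: "integrable M (\<lambda>x. exp (t * Y i x))" if "i \<in> I" for i
    using b[OF that] t rv[OF that] by (intro integrable_const_bound[of _ "exp (t * b)"])
        (auto intro!: AE_I2 mult_left_mono simp: abs_le_iff)
  have exp_sum': "exp (t * (\<Sum>i\<in>I. Y i \<omega>)) = (\<Prod>i\<in>I. exp (t * Y i \<omega>))" for \<omega>
    using I by (simp add: sum_distrib_left exp_sum)
  have "expectation (\<lambda>\<omega>. exp (t * (\<Sum>i\<in>I. Y i \<omega>))) = (\<Prod>i\<in>I. expectation (\<lambda>x. exp (t * Y i x)))"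
    unfolding exp_sum' by (rule indep_vars_lebesgue_integral[OF I(1) ind int])
  also have "\<dots> \<le> (\<Prod>i\<in>I. exp (t * m + t\<^sup>2 * v * exp (t * b) / 2))"
  proof (intro prod_mono conjI)
    fix i assume i: "i \<in> I"
    have "expectation (\<lambda>x. exp (t * Y i x)) \<le> exp (t * expectation (Y i) + t\<^sup>2 * expectation (\<lambda>x. (Y i x)\<^sup>2) * exp (t * b) / 2)"
      using i by (intro bounded_mgf rv b t)
    also have "\<dots> \<le> exp (t * m + t\<^sup>2 * v * exp (t * b) / 2)"
      using v[OF i] m[OF i] by (auto intro!: mult_right_mono mult_left_mono)
    finally show "expectation (\<lambda>x. exp (t * Y i x)) \<le> exp (t * m + t\<^sup>2 * v * exp (t * b) / 2)" .
  qed simp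
  also have "\<dots> = exp (real (card I) * (t * m + t\<^sup>2 * v * exp (t * b) / 2))"
    by (simp add: exp_of_nat_mult)
  finally have E: "expectation (\<lambda>\<omega>. exp (t * (\<Sum>i\<in>I. Y i \<omega>))) \<le> \<dots>" .
  let ?c = "exp (t * (real (card I) * (m + eps)))"
  have "prob {\<omega>\<in>space M. real (card I) * (m + eps) \<le> (\<Sum>i\<in>I. Y i \<omega>)} \<le> prob {\<omega>\<in>space M. ?c \<le> exp (t * (\<Sum>i\<in>I. Y i \<omega>))}"
    using t by (intro finite_measure_mono) (auto intro: mult_left_mono)
  also have "\<dots> \<le> expectation (\<lambda>\<omega>. exp (t * (\<Sum>i\<in>I. Y i \<omega>))) / ?c"
    by (rule integral_Markov_inequality_measure[where A="{}"])
       (auto simp: exp_sum' intro!: indep_vars_integrable[OF I(1) ind int] prod_nonneg)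
  also have "\<dots> \<le> exp (real (card I) * (t * m + t\<^sup>2 * v * exp (t * b) / 2)) / ?c"
    by (intro divide_right_mono E) simp
  also have "\<dots> = exp (real (card I) * (t\<^sup>2 * v * exp (t * b) / 2 - t * eps))"
    by (simp add: exp_diff[symmetric] algebra_simps)
  finally show ?thesis .
qed

lemma norm_sq_cart:
  fixes x :: "'a::real_normed_vector^'n"
  shows "(norm x)\<^sup>2 = (\<Sum>k\<in>UNIV. (norm (x $ k))\<^sup>2)"
  by (simp add: norm_vec_def L2_set_def sum_nonneg)

lemma norm_matrix_le_sum:
  fixes A :: "real^'n^'m"
  shows "norm A \<le> (\<Sum>k\<in>UNIV. \<Sum>l\<in>UNIV. \<bar>A $ k $ l\<bar>)"
proof -
  have "norm A \<le> (\<Sum>k\<in>UNIV. norm (A $ k))" by (simp add: norm_vec_def[of A] L2_set_le_sum)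
  also have "\<dots> \<le> (\<Sum>k\<in>UNIV. \<Sum>l\<in>UNIV. \<bar>A $ k $ l\<bar>)" by (intro sum_mono norm_le_l1_cart)
  finally show ?thesis .
qed

section \<open>The i.i.d. array: moments and growth of the number of machines\<close>

locale iid_array = prob_space M for M :: "'a measure" +
  fixes Dist :: "(real^'d) measure"
    and X :: "nat \<Rightarrow> nat \<Rightarrow> nat \<Rightarrow> 'a \<Rightarrow> real^'d"
    and mu0 :: "real^'d"
    and beta :: real
    and K :: "nat \<Rightarrow> nat"
  assumes K_pos: "\<And>n. 1 \<le> K n"
    and X_rv[measurable]: "\<And>n i j. X n i j \<in> borel_measurable M"
    and X_indep: "\<And>n. indep_vars (\<lambda>_. borel) (\<lambda>(i, j). X n i j) ({..<K n} \<times> {..<n})"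
    and X_dist: "\<And>n i j. i < K n \<Longrightarrow> j < n \<Longrightarrow> distr M borel (X n i j) = Dist"
    and mean: "mu0 = (\<integral>x. x \<partial>Dist)"
    and beta: "4 \<le> beta"
    and moment: "integrable Dist (\<lambda>x. norm x powr beta)"
    and K_rate: "(\<lambda>n. real (K n)) \<in> O(\<lambda>n. real (n * K n) powr (1 - 2 / beta))"
begin

abbreviation S where "S n i \<omega> \<equiv> emp_cov n (\<lambda>j. X n i j \<omega>) mu0"
abbreviation A where "A \<equiv> cov_matrix Dist mu0"
abbreviation Y where "Y n \<omega> \<equiv> (\<lambda>i j. X n i j \<omega>)"
abbreviation mom where "mom k \<equiv> (\<integral>x. norm (x - mu0) ^ k \<partial>Dist)"

text \<open>Stage 1 has an observation because K 1 >= 1, so the common law is the distribution of an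
  actual random vector and inherits its sigma-algebra and total mass.\<close>

lemma Dist_eq: "Dist = distr M borel (X 1 0 0)"
  using X_dist[of 0 1 0] K_pos[of 1] by simp

lemma sets_Dist[measurable_cong, simp]: "sets Dist = sets borel"
  by (simp add: Dist_eq)

lemma space_Dist[simp]: "space Dist = UNIV"
  by (simp add: Dist_eq)

sublocale D: prob_space Dist
  unfolding Dist_eq by (rule prob_space_distr) simp

lemma expectation_X:
  fixes h :: "real^'d \<Rightarrow> 'b::{banach, second_countable_topology}"
  assumes "h \<in> borel_measurable borel" "i < K n" "j < n"
  shows "expectation (\<lambda>\<omega>. h (X n i j \<omega>)) = (\<integral>x. h x \<partial>Dist)"
    "integrable M (\<lambda>\<omega>. h (X n i j \<omega>)) \<longleftrightarrow> integrable Dist h"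
  using assms by (simp_all add: X_dist[symmetric, of i n j] integral_distr integrable_distr_eq)

lemma indep_X:
  assumes "h \<in> borel_measurable borel" "J \<subseteq> {..<K n} \<times> {..<n}"
  shows "indep_vars (\<lambda>_. borel) (\<lambda>a \<omega>. h (X n (fst a) (snd a) \<omega>)) J"
  using indep_vars_compose2[OF indep_vars_subset[OF X_indep[of n] assms(2)], of "\<lambda>_. h" "\<lambda>_. borel"] assms(1)
  by (simp add: case_prod_unfold)

lemma int_centred_powr: "integrable Dist (\<lambda>x. norm (x - mu0) powr beta)"
proof (rule Bochner_Integration.integrable_bound)
  show "integrable Dist (\<lambda>x. 2 powr beta * (norm x powr beta + norm mu0 powr beta))"
    using moment by simp
  show "AE x in Dist. norm (norm (x - mu0) powr beta) \<le> norm (2 powr beta * (norm x powr beta + norm mu0 powr beta))"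
  proof (intro AE_I2)
    fix x :: "real^'d"
    have "norm (x - mu0) \<le> 2 * max (norm x) (norm mu0)" using norm_triangle_ineq4[of x mu0] by auto
    then have "norm (x - mu0) powr beta \<le> (2 * max (norm x) (norm mu0)) powr beta"
      using beta by (intro powr_mono2) auto
    also have "\<dots> = 2 powr beta * max (norm x) (norm mu0) powr beta" by (simp add: powr_mult)
    also have "\<dots> \<le> 2 powr beta * (norm x powr beta + norm mu0 powr beta)"
      by (intro mult_left_mono) (auto simp: max_def)
    finally show "norm (norm (x - mu0) powr beta) \<le> norm (2 powr beta * (norm x powr beta + norm mu0 powr beta))"
      by simp
  qed
qed simp

lemma int_centred_pow:
  assumes "k \<le> 4" shows "integrable Dist (\<lambda>x. norm (x - mu0) ^ k)"
proof (rule Bochner_Integration.integrable_bound)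
  show "integrable Dist (\<lambda>x. 1 + norm (x - mu0) powr beta)" using int_centred_powr by simp
  show "AE x in Dist. norm (norm (x - mu0) ^ k) \<le> norm (1 + norm (x - mu0) powr beta)"
  proof (intro AE_I2)
    fix x :: "real^'d"
    let ?y = "norm (x - mu0)"
    have "?y ^ k \<le> 1 + ?y powr beta"
    proof (cases "?y \<le> 1")
      case True
      then have "?y ^ k \<le> 1" by (intro power_le_one) auto
      then show ?thesis by (simp add: add_increasing2)
    next
      case False
      then have "?y ^ k = ?y powr real k" by (subst powr_realpow) auto
      also have "\<dots> \<le> ?y powr beta" using False assms beta by (intro powr_mono) auto
      finally show ?thesis by simp
    qed
    then show "norm (?y ^ k) \<le> norm (1 + ?y powr beta)" by simp
  qed
qed simp

lemma int_centred: "integrable Dist (\<lambda>x. x - mu0)" "(\<integral>x. x - mu0 \<partial>Dist) = 0" "integrable Dist (\<lambda>x. x)"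
proof -
  have "integrable Dist (\<lambda>x. norm (x - mu0))" using int_centred_pow[of 1] by simp
  then show 1: "integrable Dist (\<lambda>x. x - mu0)" by (subst (asm) integrable_norm_iff) auto
  from Bochner_Integration.integrable_add[OF 1, of "\<lambda>_. mu0"] show 2: "integrable Dist (\<lambda>x. x)" by simp
  show "(\<integral>x. x - mu0 \<partial>Dist) = 0" using 2 mean D.prob_space by (simp add: measure_def)
qed

text \<open>The growth condition is implicit, as K occurs on both sides. Cancelling K powr (1 - 2 /
  beta) leaves K powr (2 / beta), and raising to the power beta / 2 makes the condition
  explicit.\<close>

lemma K_bound: "\<exists>C>0. \<forall>\<^sub>F n in sequentially. real (K n) \<le> C * real n powr (beta / 2 - 1)"
proof -
  obtain c where c: "c > 0" "\<forall>\<^sub>F n in sequentially. norm (real (K n)) \<le> c * norm (real (n * K n) powr (1 - 2 / beta))"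
    using landau_o.bigE[OF K_rate] by blast
  have "\<forall>\<^sub>F n in sequentially. real (K n) \<le> c powr (beta / 2) * real n powr (beta / 2 - 1)"
    using c(2) eventually_gt_at_top[of 0]
  proof eventually_elim
    case (elim n)
    define k where "k = real (K n)"
    have k: "1 \<le> k" using K_pos[of n] by (simp add: k_def)
    have n: "0 < real n" using elim by simp
    have "k \<le> c * (real n * k) powr (1 - 2 / beta)" using elim by (simp add: k_def)
    also have "\<dots> = c * real n powr (1 - 2 / beta) * k powr (1 - 2 / beta)" using k n by (simp add: powr_mult)
    finally have "k powr (2 / beta) * k powr (1 - 2 / beta) \<le> c * real n powr (1 - 2 / beta) * k powr (1 - 2 / beta)"
      using k by (simp add: powr_add[symmetric])
    then have "k powr (2 / beta) \<le> c * real n powr (1 - 2 / beta)"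
      using k by (simp add: mult_le_cancel_right)
    then have "(k powr (2 / beta)) powr (beta / 2) \<le> (c * real n powr (1 - 2 / beta)) powr (beta / 2)"
      using beta by (intro powr_mono2) auto
    moreover have "(k powr (2 / beta)) powr (beta / 2) = k" using beta k by (simp add: powr_powr)
    moreover have "(c * real n powr (1 - 2 / beta)) powr (beta / 2) = c powr (beta / 2) * real n powr (beta / 2 - 1)"
      using beta c by (simp add: powr_mult powr_powr algebra_simps)
    ultimately show ?case by (simp add: k_def)
  qed
  then show ?thesis using c by (intro exI[of _ "c powr (beta / 2)"]) auto
qed

section \<open>Bounds valid on all machines at once\<close>

lemma prob_union_bound:
  assumes [measurable]: "\<And>i. i < K n \<Longrightarrow> P i \<in> events" and "\<And>i. i < K n \<Longrightarrow> prob (P i) \<le> p"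
  shows "prob (\<Union>i<K n. P i) \<le> real (K n) * p"
proof -
  have "prob (\<Union>i<K n. P i) \<le> (\<Sum>i<K n. prob (P i))"
    by (rule finite_measure_subadditive_finite) auto
  also have "\<dots> \<le> (\<Sum>i<K n. p)" using assms by (intro sum_mono) auto
  finally show ?thesis by simp
qed

text \<open>There are n * K n observations, at most of order n powr (beta / 2), and Markov's
  inequality at the level eta * sqrt n gains exactly this power. What remains tends to 0 because the
  moment in Markov's inequality is restricted to the tail event (\<open>tau\<close>).\<close>

lemma max_small:
  assumes eta: "0 < eta"
  shows "whp M (\<lambda>n \<omega>. \<forall>i<K n. \<forall>j<n. norm (X n i j \<omega> - mu0) \<le> eta * sqrt (real n))"
proof -
  define B where "B n = {x::real^'d. eta * sqrt (real n) < norm (x - mu0)}" for n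
  have B[measurable]: "B n \<in> sets borel" for n unfolding B_def by measurable
  define tau where "tau n = (\<integral>x. norm (x - mu0) powr beta * indicator (B n) x \<partial>Dist)" for n
  have tau: "tau \<longlonglongrightarrow> 0"
  proof -
    have "(\<lambda>n. \<integral>x. norm (x - mu0) powr beta * indicator (B n) x \<partial>Dist) \<longlonglongrightarrow> (\<integral>x. 0 \<partial>Dist)"
    proof (rule integral_dominated_convergence[where w="\<lambda>x. norm (x - mu0) powr beta"])
      show "AE x in Dist. (\<lambda>n. norm (x - mu0) powr beta * indicator (B n) x) \<longlonglongrightarrow> 0"
      proof (intro AE_I2 tendsto_eventually)
        fix x :: "real^'d"
        have "filterlim (\<lambda>n. eta * sqrt (real n)) at_top sequentially" using eta by real_asymp
        then have "\<forall>\<^sub>F n in sequentially. norm (x - mu0) \<le> eta * sqrt (real n)"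
          by (simp add: filterlim_at_top)
        then show "\<forall>\<^sub>F n in sequentially. norm (x - mu0) powr beta * indicator (B n) x = 0"
          by eventually_elim (auto simp: B_def)
      qed
    qed (auto simp: int_centred_powr split: split_indicator)
    then show ?thesis by (simp add: tau_def[abs_def])
  qed
  have pB: "measure Dist (B n) \<le> tau n / (eta * sqrt (real n)) powr beta" if "0 < n" for n
  proof -
    have "measure Dist (B n) \<le> measure Dist {x\<in>space Dist. (eta * sqrt (real n)) powr beta \<le> norm (x - mu0) powr beta * indicator (B n) x}"
      using beta eta by (intro D.finite_measure_mono) (auto simp: B_def intro!: powr_mono2)
    also have "\<dots> \<le> tau n / (eta * sqrt (real n)) powr beta"
      unfolding tau_def using eta that
      by (intro integral_Markov_inequality_measure[where A="{}"])
         (auto intro!: Bochner_Integration.integrable_bound[OF int_centred_powr] split: split_indicator)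
    finally show ?thesis .
  qed
  obtain C where C: "C > 0" "\<forall>\<^sub>F n in sequentially. real (K n) \<le> C * real n powr (beta / 2 - 1)"
    using K_bound by blast
  have eq: "{\<omega>\<in>space M. \<not> (\<forall>i<K n. \<forall>j<n. norm (X n i j \<omega> - mu0) \<le> eta * sqrt (real n))}
     = (\<Union>i<K n. \<Union>j<n. {\<omega>\<in>space M. X n i j \<omega> \<in> B n})" for n
    by (auto simp: B_def not_le)
  show ?thesis
  proof (rule whp_of_measure_bound[where b="\<lambda>n. C / eta powr beta * tau n"])
    show "\<forall>\<^sub>F n in sequentially. {\<omega>\<in>space M. \<not> (\<forall>i<K n. \<forall>j<n. norm (X n i j \<omega> - mu0) \<le> eta * sqrt (real n))} \<in> events"
      unfolding eq by auto
    show "(\<lambda>n. C / eta powr beta * tau n) \<longlonglongrightarrow> 0" using tau by (rule tendsto_mult_right_zero)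
    show "\<forall>\<^sub>F n in sequentially. prob {\<omega>\<in>space M. \<not> (\<forall>i<K n. \<forall>j<n. norm (X n i j \<omega> - mu0) \<le> eta * sqrt (real n))} \<le> C / eta powr beta * tau n"
      using C(2) eventually_gt_at_top[of 0]
    proof eventually_elim
      case (elim n)
      define p where "p = tau n / (eta * sqrt (real n)) powr beta"
      have tau0: "0 \<le> tau n" by (simp add: tau_def)
      have "prob {\<omega>\<in>space M. X n i j \<omega> \<in> B n} \<le> p" if "i < K n" "j < n" for i j
      proof -
        have "prob {\<omega>\<in>space M. X n i j \<omega> \<in> B n} = measure (distr M borel (X n i j)) (B n)"
          by (subst measure_distr) (auto intro!: arg_cong[where f=prob])
        then show ?thesis using pB elim X_dist that by (simp add: p_def)
      qed
      then have "prob (\<Union>j<n. {\<omega>\<in>space M. X n i j \<omega> \<in> B n}) \<le> (\<Sum>j<n. p)" if "i < K n" for i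
        using that by (intro order_trans[OF finite_measure_subadditive_finite] sum_mono) auto
      then have "prob (\<Union>i<K n. \<Union>j<n. {\<omega>\<in>space M. X n i j \<omega> \<in> B n}) \<le> real (K n) * (real n * p)"
        by (intro prob_union_bound) auto
      also have "\<dots> \<le> C * real n powr (beta / 2 - 1) * (real n * p)"
        using elim tau0 by (intro mult_right_mono) (auto simp: p_def)
      also have "\<dots> = C / eta powr beta * tau n"
      proof -
        have "(eta * sqrt (real n)) powr beta = eta powr beta * real n powr (beta / 2)"
          using eta by (simp add: powr_mult powr_half_sqrt[symmetric] powr_powr)
        moreover have "real n powr (beta / 2 - 1) * real n = real n powr (beta / 2)"
          using elim powr_mult_base[of "real n" "beta / 2 - 1"] by (simp add: mult.commute)
        ultimately have "C * real n powr (beta / 2 - 1) * (real n * p) = C * real n powr (beta / 2) * p"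
          by (simp add: mult.assoc[symmetric])
        moreover have "0 < real n powr (beta / 2)" using elim by simp
        ultimately show ?thesis unfolding p_def
          using \<open>(eta * sqrt (real n)) powr beta = eta powr beta * real n powr (beta / 2)\<close> by simp
      qed
      finally show ?case unfolding eq .
    qed
  qed
qed

text \<open>After truncation at the scale of \<open>max_small\<close>, the row averages have tails of arbitrary polynomial
  order, which beats the union bound over the machines.\<close>

lemma uniform_row_upper:
  fixes h :: "real^'d \<Rightarrow> real"
  assumes [measurable]: "h \<in> borel_measurable borel" and h: "\<And>x. \<bar>h x\<bar> \<le> norm (x - mu0) ^ 2"
    and eps: "0 < eps"
  shows "whp M (\<lambda>n \<omega>. \<forall>i<K n. (\<Sum>j<n. h (X n i j \<omega>)) \<le> real n * ((\<integral>x. h x \<partial>Dist) + 2 * eps))"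
proof -
  \<comment> \<open>The constants fit the choice t = m * ln n / n below. Then n * t * eps = beta / 2
    * ln n, so the deviation contributes n powr (- beta / 2); and m * del^2 = 1/2 gives exp (t *
    del^2 * n) = sqrt n, so the second-moment term is a multiple of (ln n)^2 / sqrt n and
    vanishes.\<close>
  define m where "m = beta / (2 * eps)"
  define del where "del = sqrt (1 / (2 * m))"
  have m: "0 < m" using beta eps by (simp add: m_def)
  have del: "0 < del" "m * del\<^sup>2 = 1/2" using m by (auto simp: del_def real_sqrt_pow2)
  define f where "f n x = (if norm (x - mu0) \<le> del * sqrt (real n) then h x else 0)" for n x
  have [measurable]: "f n \<in> borel_measurable borel" for n unfolding f_def[abs_def] by measurable
  have fb: "\<bar>f n x\<bar> \<le> del\<^sup>2 * real n" for n x
  proof (cases "norm (x - mu0) \<le> del * sqrt (real n)")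
    case True
    then have "norm (x - mu0) ^ 2 \<le> (del * sqrt (real n)) ^ 2" by (intro power_mono) auto
    then show ?thesis using h[of x] True by (simp add: f_def power_mult_distrib)
  qed (simp add: f_def)
  have h4: "(h x)\<^sup>2 \<le> norm (x - mu0) ^ 4" for x
    using power_mono[OF h[of x], of 2] by simp
  have int_h: "integrable Dist h"
    by (rule Bochner_Integration.integrable_bound[OF int_centred_pow[of 2]]) (use h in auto)
  have int_f: "integrable Dist (f n)" for n
    by (rule Bochner_Integration.integrable_bound[OF int_h]) (auto simp: f_def)
  have int_f2: "integrable Dist (\<lambda>x. (f n x)\<^sup>2)" for n
    by (rule Bochner_Integration.integrable_bound[OF int_centred_pow[of 4]]) (use h4 in \<open>auto simp: f_def\<close>)
  have f2: "(\<integral>x. (f n x)\<^sup>2 \<partial>Dist) \<le> mom 4" for n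
    using h4 by (intro integral_mono int_f2 int_centred_pow) (auto simp: f_def)
  have bias: "(\<integral>x. f n x \<partial>Dist) \<le> (\<integral>x. h x \<partial>Dist) + mom 4 / (del\<^sup>2 * real n)" if n: "0 < n" for n
  proof -
    \<comment> \<open>Where the truncation acts, the squared norm exceeds del^2 * n, so a bound by
      the second power can be traded for the fourth power over del^2 * n.\<close>
    have "f n x - h x \<le> norm (x - mu0) ^ 4 / (del\<^sup>2 * real n)" for x
    proof (cases "norm (x - mu0) \<le> del * sqrt (real n)")
      case False
      then have "(del * sqrt (real n)) ^ 2 \<le> norm (x - mu0) ^ 2" using del by (intro power_mono) auto
      then have "norm (x - mu0) ^ 2 * (del\<^sup>2 * real n) \<le> norm (x - mu0) ^ 2 * norm (x - mu0) ^ 2"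
        by (intro mult_left_mono) (auto simp: power_mult_distrib)
      then have "norm (x - mu0) ^ 2 \<le> norm (x - mu0) ^ 4 / (del\<^sup>2 * real n)"
        using del n by (simp add: pos_le_divide_eq power_add[symmetric])
      then show ?thesis using False h[of x] by (simp add: f_def)
    qed (simp add: f_def)
    then have "(\<integral>x. f n x - h x \<partial>Dist) \<le> (\<integral>x. norm (x - mu0) ^ 4 / (del\<^sup>2 * real n) \<partial>Dist)"
      using int_f int_h int_centred_pow[of 4] by (intro integral_mono) auto
    then show ?thesis using int_f int_h by simp
  qed
  obtain C where C: "C > 0" "\<forall>\<^sub>F n in sequentially. real (K n) \<le> C * real n powr (beta / 2 - 1)"
    using K_bound by blast
  let ?b = "\<lambda>n::nat. C * (1 / real n * exp (m\<^sup>2 * mom 4 * (ln (real n))\<^sup>2 / (2 * sqrt (real n))))"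
  let ?bad = "\<lambda>n i. {\<omega>\<in>space M. real n * ((\<integral>x. f n x \<partial>Dist) + eps) \<le> (\<Sum>j<n. f n (X n i j \<omega>))}"
  have eq: "{\<omega>\<in>space M. \<not> (\<forall>i<K n. (\<Sum>j<n. f n (X n i j \<omega>)) < real n * ((\<integral>x. f n x \<partial>Dist) + eps))} = (\<Union>i<K n. ?bad n i)" for n
    by (auto simp: not_less)
  have "whp M (\<lambda>n \<omega>. \<forall>i<K n. (\<Sum>j<n. f n (X n i j \<omega>)) < real n * ((\<integral>x. f n x \<partial>Dist) + eps))"
  proof (rule whp_of_measure_bound[where b="?b"])
    show "\<forall>\<^sub>F n in sequentially. {\<omega>\<in>space M. \<not> (\<forall>i<K n. (\<Sum>j<n. f n (X n i j \<omega>)) < real n * ((\<integral>x. f n x \<partial>Dist) + eps))} \<in> events"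
      unfolding eq by auto
    show "?b \<longlonglongrightarrow> 0"
    proof -
      have "(\<lambda>n::nat. 1 / real n * exp (c * (ln (real n))\<^sup>2 / (2 * sqrt (real n)))) \<longlonglongrightarrow> 0" for c :: real
        by real_asymp
      from tendsto_mult_right_zero[OF this] show ?thesis .
    qed
    show "\<forall>\<^sub>F n in sequentially. prob {\<omega>\<in>space M. \<not> (\<forall>i<K n. (\<Sum>j<n. f n (X n i j \<omega>)) < real n * ((\<integral>x. f n x \<partial>Dist) + eps))} \<le> ?b n"
      using C(2) eventually_gt_at_top[of 0]
    proof eventually_elim
      case (elim n)
      define t where "t = m * ln (real n) / real n"
      have t: "0 \<le> t" using m elim by (simp add: t_def)
      have tb: "exp (t * (del\<^sup>2 * real n)) = sqrt (real n)"
      proof -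
        have "t * (del\<^sup>2 * real n) = (m * del\<^sup>2) * ln (real n)" using elim by (simp add: t_def)
        then show ?thesis using del elim powr_def[of "real n" "1/2"] by (simp add: powr_half_sqrt)
      qed
      have "real n * (t\<^sup>2 * mom 4 * sqrt (real n) / 2) = m\<^sup>2 * mom 4 * (ln (real n))\<^sup>2 / (2 * sqrt (real n))"
        using elim real_sqrt_mult_self[of "real n"]
        by (simp add: t_def power2_eq_square field_simps del: real_sqrt_mult_self)
      moreover have "real n * (t * eps) = beta / 2 * ln (real n)" using elim eps by (simp add: t_def m_def)
      ultimately have "exp (real n * (t\<^sup>2 * mom 4 * exp (t * (del\<^sup>2 * real n)) / 2 - t * eps))
          = exp (m\<^sup>2 * mom 4 * (ln (real n))\<^sup>2 / (2 * sqrt (real n)) - beta / 2 * ln (real n))"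
        unfolding tb right_diff_distrib by simp
      also have "\<dots> = real n powr (- beta / 2) * exp (m\<^sup>2 * mom 4 * (ln (real n))\<^sup>2 / (2 * sqrt (real n)))"
        using elim by (simp add: powr_def mult_exp_exp)
      finally have ex: "exp (real n * (t\<^sup>2 * mom 4 * exp (t * (del\<^sup>2 * real n)) / 2 - t * eps)) = \<dots>" .
      have row: "prob (?bad n i) \<le> real n powr (- beta / 2) * exp (m\<^sup>2 * mom 4 * (ln (real n))\<^sup>2 / (2 * sqrt (real n)))"
        if i: "i < K n" for i
      proof -
        let ?I = "{i} \<times> {..<n}"
        have "prob {\<omega>\<in>space M. real (card ?I) * ((\<integral>x. f n x \<partial>Dist) + eps) \<le> (\<Sum>a\<in>?I. f n (X n (fst a) (snd a) \<omega>))}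
          \<le> exp (real (card ?I) * (t\<^sup>2 * mom 4 * exp (t * (del\<^sup>2 * real n)) / 2 - t * eps))"
        proof (rule bounded_sum_tail)
          show "indep_vars (\<lambda>_. borel) (\<lambda>a \<omega>. f n (X n (fst a) (snd a) \<omega>)) ?I"
            using i by (intro indep_X) auto
          show "\<bar>f n (X n (fst a) (snd a) x)\<bar> \<le> del\<^sup>2 * real n" for a x by (rule fb)
          show "expectation (\<lambda>x. f n (X n (fst a) (snd a) x)) = (\<integral>x. f n x \<partial>Dist)" if "a \<in> ?I" for a
            using that i by (auto simp: expectation_X)
          show "expectation (\<lambda>x. (f n (X n (fst a) (snd a) x))\<^sup>2) \<le> mom 4" if "a \<in> ?I" for a
            using that i f2[of n] expectation_X(1)[of "\<lambda>x. (f n x)\<^sup>2" "fst a" n "snd a"] by auto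
        qed (use t in auto)
        then show ?thesis unfolding ex[symmetric] by (simp add: sum.cartesian_product' card_cartesian_product)
      qed
      have "prob (\<Union>i<K n. ?bad n i) \<le> real (K n) * (real n powr (- beta / 2) * exp (m\<^sup>2 * mom 4 * (ln (real n))\<^sup>2 / (2 * sqrt (real n))))"
        by (rule prob_union_bound, measurable, rule row)
      also have "\<dots> \<le> C * real n powr (beta / 2 - 1) * (real n powr (- beta / 2) * exp (m\<^sup>2 * mom 4 * (ln (real n))\<^sup>2 / (2 * sqrt (real n))))"
        using elim by (intro mult_right_mono) auto
      also have "\<dots> = ?b n"
      proof -
        \<comment> \<open>The union over the machines costs n powr (beta / 2 - 1), which leaves the
          factor 1 / n.\<close>
        have "real n powr (beta / 2 - 1) * real n powr (- beta / 2) = 1 / real n"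
          using elim by (simp add: powr_diff powr_minus_divide)
        then show ?thesis by (simp add: mult.assoc[symmetric]) (simp add: mult.assoc)
      qed
      finally show ?case unfolding eq .
    qed
  qed
  \<comment> \<open>On the event of \<open>max_small\<close> the truncation changes no summand. One
    \<open>eps\<close> pays for the deviation, the other for the bias.\<close>
  from whp_conj[OF this max_small[OF del(1)]] show ?thesis
  proof (rule whp_mono)
    have "(\<lambda>n. c / (del\<^sup>2 * real n)) \<longlonglongrightarrow> 0" for c :: real using del(1) by real_asymp
    then have "(\<lambda>n. mom 4 / (del\<^sup>2 * real n)) \<longlonglongrightarrow> 0" .
    then have "\<forall>\<^sub>F n in sequentially. mom 4 / (del\<^sup>2 * real n) < eps" using eps by (rule order_tendstoD)
    then show "\<forall>\<^sub>F n in sequentially. \<forall>\<omega>\<in>space M.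
        (\<forall>i<K n. (\<Sum>j<n. f n (X n i j \<omega>)) < real n * ((\<integral>x. f n x \<partial>Dist) + eps))
        \<and> (\<forall>i<K n. \<forall>j<n. norm (X n i j \<omega> - mu0) \<le> del * sqrt (real n))
      \<longrightarrow> (\<forall>i<K n. (\<Sum>j<n. h (X n i j \<omega>)) \<le> real n * ((\<integral>x. h x \<partial>Dist) + 2 * eps))"
      using eventually_gt_at_top[of 0]
    proof (eventually_elim, intro ballI impI allI, elim conjE)
      fix n \<omega> i
      assume n: "mom 4 / (del\<^sup>2 * real n) < eps" "0 < n" and i: "i < K n"
        and 1: "\<forall>i<K n. (\<Sum>j<n. f n (X n i j \<omega>)) < real n * ((\<integral>x. f n x \<partial>Dist) + eps)"
        and 2: "\<forall>i<K n. \<forall>j<n. norm (X n i j \<omega> - mu0) \<le> del * sqrt (real n)"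
      have "(\<Sum>j<n. h (X n i j \<omega>)) = (\<Sum>j<n. f n (X n i j \<omega>))"
        using 2 i by (intro sum.cong) (auto simp: f_def)
      also have "\<dots> \<le> real n * ((\<integral>x. f n x \<partial>Dist) + eps)" using 1 i by (auto intro: less_imp_le)
      also have "\<dots> \<le> real n * ((\<integral>x. h x \<partial>Dist) + 2 * eps)"
        using bias[OF n(2)] n by (intro mult_left_mono) auto
      finally show "(\<Sum>j<n. h (X n i j \<omega>)) \<le> real n * ((\<integral>x. h x \<partial>Dist) + 2 * eps)" .
    qed
  qed
qed

definition centred_prod :: "'d \<Rightarrow> 'd \<Rightarrow> real^'d \<Rightarrow> real" where
  "centred_prod k l x = (x $ k - mu0 $ k) * (x $ l - mu0 $ l)"

lemma centred_prod_measurable[measurable]: "centred_prod k l \<in> borel_measurable borel"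
  unfolding centred_prod_def[abs_def] by measurable

lemma centred_prod_le: "\<bar>centred_prod k l x\<bar> \<le> norm (x - mu0) ^ 2"
proof -
  have "\<bar>x $ i - mu0 $ i\<bar> \<le> norm (x - mu0)" for i
    using component_le_norm_cart[of "x - mu0" i] by simp
  then show ?thesis by (auto simp: centred_prod_def abs_mult power2_eq_square intro: mult_mono)
qed

lemma integral_centred_prod: "(\<integral>x. centred_prod k l x \<partial>Dist) = A $ k $ l"
  by (simp add: centred_prod_def cov_matrix_def)

lemma emp_cov_entry: "S n i \<omega> $ k $ l = (1 / real n) * (\<Sum>j<n. centred_prod k l (X n i j \<omega>))"
  by (simp add: emp_cov_def centred_prod_def)

lemma cov_close:
  assumes eta: "0 < eta"
  shows "whp M (\<lambda>n \<omega>. \<forall>i<K n. norm (S n i \<omega> - A) \<le> eta)"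
proof -
  define d where "d = real CARD('d)"
  have d: "0 < d" by (simp add: d_def)
  \<comment> \<open>Each of the d * d entries will be off by at most 2 * eps; the two sides come
    from \<open>uniform_row_upper\<close> for \<open>centred_prod\<close> and for its
    negative.\<close>
  define eps where "eps = eta / (2 * (d * d))"
  have eps: "0 < eps" using eta d by (simp add: eps_def)
  let ?U = "\<lambda>(k, l) n \<omega>. \<forall>i<K n. (\<Sum>j<n. centred_prod k l (X n i j \<omega>)) \<le> real n * ((\<integral>x. centred_prod k l x \<partial>Dist) + 2 * eps)"
  let ?L = "\<lambda>(k, l) n \<omega>. \<forall>i<K n. (\<Sum>j<n. - centred_prod k l (X n i j \<omega>)) \<le> real n * ((\<integral>x. - centred_prod k l x \<partial>Dist) + 2 * eps)"
  have U: "whp M (\<lambda>n \<omega>. \<forall>p\<in>UNIV. ?U p n \<omega>)"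
    by (rule whp_ball, simp, simp only: case_prod_unfold, rule uniform_row_upper) (auto simp: centred_prod_le eps)
  have L: "whp M (\<lambda>n \<omega>. \<forall>p\<in>UNIV. ?L p n \<omega>)"
    by (rule whp_ball, simp, simp only: case_prod_unfold, rule uniform_row_upper) (auto simp: centred_prod_le eps)
  show ?thesis
  proof (rule whp_mono[OF whp_conj[OF U L]])
    show "\<forall>\<^sub>F n in sequentially. \<forall>\<omega>\<in>space M. (\<forall>p\<in>UNIV. ?U p n \<omega>) \<and> (\<forall>p\<in>UNIV. ?L p n \<omega>)
       \<longrightarrow> (\<forall>i<K n. norm (S n i \<omega> - A) \<le> eta)"
      using eventually_gt_at_top[of 0]
    proof (eventually_elim, intro ballI impI allI, elim conjE)
      fix n \<omega> i
      assume n: "0 < n" and i: "i < K n" and u: "\<forall>p\<in>UNIV. ?U p n \<omega>" and l: "\<forall>p\<in>UNIV. ?L p n \<omega>"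
      have e: "\<bar>(S n i \<omega> - A) $ k $ l\<bar> \<le> 2 * eps" for k l
      proof -
        let ?s = "\<Sum>j<n. centred_prod k l (X n i j \<omega>)"
        have "?s \<le> real n * (A $ k $ l + 2 * eps)" "- ?s \<le> real n * (- (A $ k $ l) + 2 * eps)"
          using u[rule_format, of "(k, l)"] l[rule_format, of "(k, l)"] i
          by (simp_all add: integral_centred_prod sum_negf)
        moreover have "real n * (S n i \<omega> - A) $ k $ l = ?s - real n * A $ k $ l"
          using n by (simp add: emp_cov_entry right_diff_distrib)
        ultimately have "real n * (S n i \<omega> - A) $ k $ l \<le> real n * (2 * eps)"
          "real n * - ((S n i \<omega> - A) $ k $ l) \<le> real n * (2 * eps)"
          unfolding mult_minus_right by (simp_all add: algebra_simps)
        then have "(S n i \<omega> - A) $ k $ l \<le> 2 * eps" "- ((S n i \<omega> - A) $ k $ l) \<le> 2 * eps"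
          using n by (simp_all only: mult_le_cancel_left_pos of_nat_0_less_iff)
        then show ?thesis by (simp only: abs_le_iff)
      qed
      have "norm (S n i \<omega> - A) \<le> (\<Sum>k\<in>UNIV. \<Sum>l\<in>UNIV. \<bar>(S n i \<omega> - A) $ k $ l\<bar>)"
        by (rule norm_matrix_le_sum)
      also have "\<dots> \<le> (\<Sum>k\<in>(UNIV::'d set). \<Sum>l\<in>(UNIV::'d set). 2 * eps)" by (intro sum_mono e)
      also have "\<dots> = eta" using d by (simp add: eps_def d_def field_simps)
      finally show "norm (S n i \<omega> - A) \<le> eta" .
    qed
  qed
qed

section \<open>Mean-square bounds and averages over the machines\<close>

lemma centred_sum_square:
  fixes h :: "real^'d \<Rightarrow> real"
  assumes [measurable]: "h \<in> borel_measurable borel" and J: "J \<subseteq> {..<K n} \<times> {..<n}"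
    and h: "integrable Dist (\<lambda>x. (h x)\<^sup>2)" "(\<integral>x. h x \<partial>Dist) = 0" "(\<integral>x. (h x)\<^sup>2 \<partial>Dist) \<le> v"
  shows "integrable M (\<lambda>\<omega>. (\<Sum>a\<in>J. h (X n (fst a) (snd a) \<omega>))\<^sup>2)"
    "expectation (\<lambda>\<omega>. (\<Sum>a\<in>J. h (X n (fst a) (snd a) \<omega>))\<^sup>2) \<le> real (card J) * v"
proof -
  have "finite J" using J by (rule finite_subset) auto
  moreover have "fst a < K n" "snd a < n" if "a \<in> J" for a using J that by auto
  ultimately show "integrable M (\<lambda>\<omega>. (\<Sum>a\<in>J. h (X n (fst a) (snd a) \<omega>))\<^sup>2)"
    "expectation (\<lambda>\<omega>. (\<Sum>a\<in>J. h (X n (fst a) (snd a) \<omega>))\<^sup>2) \<le> real (card J) * v"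
    using indep_sum_square[of J "\<lambda>a \<omega>. h (X n (fst a) (snd a) \<omega>)" v] indep_X[OF assms(1) J]
      expectation_X[of "\<lambda>x. (h x)\<^sup>2"] expectation_X[of h] h by simp_all
qed

text \<open>Independence within a row makes the variance of each entry at most a fourth moment over
  n. Unlike \<open>cov_close\<close> this has a rate, and averaging over the machines preserves it,
  since expectations need no union bound.\<close>

lemma cov_mean_square:
  assumes i: "i < K n" and n: "0 < n"
  shows "integrable M (\<lambda>\<omega>. (norm (S n i \<omega> - A))\<^sup>2)"
    "expectation (\<lambda>\<omega>. (norm (S n i \<omega> - A))\<^sup>2) \<le> (real CARD('d))\<^sup>2 * mom 4 * (1 / real n)"
proof -
  define h where "h k l x = centred_prod k l x - A $ k $ l" for k l x
  have [measurable]: "h k l \<in> borel_measurable borel" for k l unfolding h_def[abs_def] by measurable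
  have p2: "(centred_prod k l x)\<^sup>2 \<le> norm (x - mu0) ^ 4" for k l x
    using power_mono[OF centred_prod_le[of k l x], of 2] by simp
  have ip: "integrable Dist (centred_prod k l)" for k l
    by (rule Bochner_Integration.integrable_bound[OF int_centred_pow[of 2]]) (use centred_prod_le in auto)
  have ip2: "integrable Dist (\<lambda>x. (centred_prod k l x)\<^sup>2)" for k l
    by (rule Bochner_Integration.integrable_bound[OF int_centred_pow[of 4]]) (use p2 in auto)
  have h: "integrable Dist (\<lambda>x. (h k l x)\<^sup>2)" "(\<integral>x. h k l x \<partial>Dist) = 0" "(\<integral>x. (h k l x)\<^sup>2 \<partial>Dist) \<le> mom 4" for k l
  proof -
    show "integrable Dist (\<lambda>x. (h k l x)\<^sup>2)" using ip ip2 by (simp add: h_def power2_diff)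
    show "(\<integral>x. h k l x \<partial>Dist) = 0" using ip by (simp add: h_def integral_centred_prod D.prob_space[simplified])
    have "(\<integral>x. (h k l x)\<^sup>2 \<partial>Dist) = (\<integral>x. (centred_prod k l x)\<^sup>2 \<partial>Dist) - (A $ k $ l)\<^sup>2"
      using D.variance_eq[OF ip ip2, of k l] by (simp add: h_def integral_centred_prod)
    also have "\<dots> \<le> (\<integral>x. (centred_prod k l x)\<^sup>2 \<partial>Dist)" by simp
    also have "\<dots> \<le> mom 4" using ip2 int_centred_pow[of 4] p2 by (intro integral_mono) auto
    finally show "(\<integral>x. (h k l x)\<^sup>2 \<partial>Dist) \<le> mom 4" .
  qed
  let ?J = "{i} \<times> {..<n}"
  let ?s = "\<lambda>k l \<omega>. \<Sum>a\<in>?J. h k l (X n (fst a) (snd a) \<omega>)"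
  have J: "?J \<subseteq> {..<K n} \<times> {..<n}" using i by auto
  have s: "integrable M (\<lambda>\<omega>. (?s k l \<omega>)\<^sup>2)" "expectation (\<lambda>\<omega>. (?s k l \<omega>)\<^sup>2) \<le> real n * mom 4" for k l
    using centred_sum_square[OF _ J h(1,2,3)] by (auto simp: card_cartesian_product)
  have eq: "(norm (S n i \<omega> - A))\<^sup>2 = (1 / real n)\<^sup>2 * (\<Sum>k\<in>UNIV. \<Sum>l\<in>UNIV. (?s k l \<omega>)\<^sup>2)" for \<omega>
  proof -
    have "(S n i \<omega> - A) $ k $ l = (1 / real n) * ?s k l \<omega>" for k l
      using n by (simp add: emp_cov_entry h_def sum.cartesian_product' sum_subtractf field_simps)
    then have "((S n i \<omega> - A) $ k $ l)\<^sup>2 = (1 / real n)\<^sup>2 * (?s k l \<omega>)\<^sup>2" for k l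
      by (simp only: power_mult_distrib)
    then show ?thesis
      by (simp only: norm_sq_cart real_norm_def power2_abs sum_distrib_left)
  qed
  show "integrable M (\<lambda>\<omega>. (norm (S n i \<omega> - A))\<^sup>2)" unfolding eq using s by auto
  have "expectation (\<lambda>\<omega>. (norm (S n i \<omega> - A))\<^sup>2)
      = (1 / real n)\<^sup>2 * (\<Sum>k\<in>UNIV. \<Sum>l\<in>UNIV. expectation (\<lambda>\<omega>. (?s k l \<omega>)\<^sup>2))"
    unfolding eq using s by simp
  also have "\<dots> \<le> (1 / real n)\<^sup>2 * (\<Sum>k\<in>(UNIV::'d set). \<Sum>l\<in>(UNIV::'d set). real n * mom 4)"
    using s by (intro mult_left_mono sum_mono) auto
  also have "\<dots> = (real CARD('d))\<^sup>2 * mom 4 * (1 / real n)"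
    using n by (simp add: power2_eq_square field_simps)
  finally show "expectation (\<lambda>\<omega>. (norm (S n i \<omega> - A))\<^sup>2) \<le> (real CARD('d))\<^sup>2 * mom 4 * (1 / real n)" .
qed

lemma avg_cov_square:
  assumes "0 < e"
  shows "\<exists>C>0. evt_prob M e (\<lambda>n \<omega>. (1 / real (K n)) * (\<Sum>i<K n. (norm (S n i \<omega> - A))\<^sup>2) \<le> C * (1 / real n))"
proof (rule markov_bound[where m="(real CARD('d))\<^sup>2 * mom 4"])
  show "\<forall>\<^sub>F n in sequentially. integrable M (\<lambda>\<omega>. (1 / real (K n)) * (\<Sum>i<K n. (norm (S n i \<omega> - A))\<^sup>2))"
    using eventually_gt_at_top[of 0]
    by eventually_elim (intro integrable_mult_right Bochner_Integration.integrable_sum cov_mean_square; simp)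
  show "\<forall>\<^sub>F n in sequentially. expectation (\<lambda>\<omega>. (1 / real (K n)) * (\<Sum>i<K n. (norm (S n i \<omega> - A))\<^sup>2))
      \<le> (real CARD('d))\<^sup>2 * mom 4 * (1 / real n)"
    using eventually_gt_at_top[of 0]
  proof eventually_elim
    case (elim n)
    have "expectation (\<lambda>\<omega>. (1 / real (K n)) * (\<Sum>i<K n. (norm (S n i \<omega> - A))\<^sup>2))
       = (1 / real (K n)) * (\<Sum>i<K n. expectation (\<lambda>\<omega>. (norm (S n i \<omega> - A))\<^sup>2))"
      using elim by (simp add: cov_mean_square)
    also have "\<dots> \<le> (1 / real (K n)) * (\<Sum>i<K n. (real CARD('d))\<^sup>2 * mom 4 * (1 / real n))"
      using elim by (intro mult_left_mono sum_mono cov_mean_square) auto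
    also have "\<dots> = (real CARD('d))\<^sup>2 * mom 4 * (1 / real n)" using K_pos[of n] by simp
    finally show ?case .
  qed
  show "\<forall>\<^sub>F n in sequentially. 0 < 1 / real n"
    using eventually_gt_at_top[of 0] by eventually_elim simp
qed (use assms in \<open>auto intro!: sum_nonneg divide_nonneg_nonneg\<close>)

lemma avg_mom3:
  assumes "0 < e"
  shows "\<exists>C>0. evt_prob M e (\<lambda>n \<omega>. (1 / real (K n)) * (\<Sum>i<K n. mom3 n (Y n \<omega> i) mu0) \<le> C)"
proof -
  have m: "integrable M (\<lambda>\<omega>. norm (X n i j \<omega> - mu0) ^ 3)" "expectation (\<lambda>\<omega>. norm (X n i j \<omega> - mu0) ^ 3) = mom 3"
    if "i < K n" "j < n" for n i j
    using expectation_X[of "\<lambda>x. norm (x - mu0) ^ 3", OF _ that] int_centred_pow[of 3] by auto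
  have m3: "integrable M (\<lambda>\<omega>. mom3 n (Y n \<omega> i) mu0)" "expectation (\<lambda>\<omega>. mom3 n (Y n \<omega> i) mu0) = mom 3"
    if i: "i < K n" and n: "0 < n" for n i
  proof -
    show "integrable M (\<lambda>\<omega>. mom3 n (Y n \<omega> i) mu0)"
      unfolding mom3_def by (intro integrable_mult_right Bochner_Integration.integrable_sum m i) auto
    have "expectation (\<lambda>\<omega>. \<Sum>j<n. norm (X n i j \<omega> - mu0) ^ 3) = (\<Sum>j<n. mom 3)"
      using m i by (subst Bochner_Integration.integral_sum) auto
    then show "expectation (\<lambda>\<omega>. mom3 n (Y n \<omega> i) mu0) = mom 3" using n by (simp add: mom3_def)
  qed
  have "\<exists>C>0. evt_prob M e (\<lambda>n \<omega>. (1 / real (K n)) * (\<Sum>i<K n. mom3 n (Y n \<omega> i) mu0) \<le> C * 1)"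
  proof (rule markov_bound[where m="mom 3"])
    show "\<forall>\<^sub>F n in sequentially. integrable M (\<lambda>\<omega>. (1 / real (K n)) * (\<Sum>i<K n. mom3 n (Y n \<omega> i) mu0))"
      unfolding mom3_def
      by (intro always_eventually allI integrable_mult_right Bochner_Integration.integrable_sum m) auto
    show "\<forall>\<^sub>F n in sequentially. expectation (\<lambda>\<omega>. (1 / real (K n)) * (\<Sum>i<K n. mom3 n (Y n \<omega> i) mu0)) \<le> mom 3 * 1"
      using eventually_gt_at_top[of 0]
    proof eventually_elim
      case (elim n)
      have "expectation (\<lambda>\<omega>. (1 / real (K n)) * (\<Sum>i<K n. mom3 n (Y n \<omega> i) mu0)) = mom 3"
        using m3 elim K_pos[of n] by simp
      then show ?case by simp
    qed
  qed (use assms in \<open>auto intro!: sum_nonneg divide_nonneg_nonneg mom3_nonneg\<close>)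
  then show ?thesis by simp
qed

text \<open>The gradient at 0 is minus the mean of all centred observations, so its squared norm has
  expectation of order 1 / (n * K n); Markov's inequality is applied to the square.\<close>

lemma grad_zero_bound:
  assumes "0 < e"
  shows "\<exists>C>0. evt_prob M e (\<lambda>n \<omega>. norm (grad_g (K n) n (Y n \<omega>) mu0 0) \<le> C / sqrt (real (n * K n)))"
proof -
  define N where "N n = real (n * K n)" for n
  let ?J = "\<lambda>n. {..<K n} \<times> {..<n}"
  let ?s = "\<lambda>k n \<omega>. \<Sum>a\<in>?J n. (X n (fst a) (snd a) \<omega> $ k - mu0 $ k)"
  have eq: "(norm (grad_g (K n) n (Y n \<omega>) mu0 0))\<^sup>2 = (1 / N n)\<^sup>2 * (\<Sum>k\<in>UNIV. (?s k n \<omega>)\<^sup>2)" for n \<omega>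
  proof -
    have "grad_g (K n) n (Y n \<omega>) mu0 0 $ k = - (1 / N n) * ?s k n \<omega>" for k
      by (simp add: grad_g_def grad_gi_def N_def sum.cartesian_product' sum_negf sum_divide_distrib mult.commute)
    then have "(norm (grad_g (K n) n (Y n \<omega>) mu0 0 $ k))\<^sup>2 = (1 / N n)\<^sup>2 * (?s k n \<omega>)\<^sup>2" for k
      by (simp add: power_divide)
    then show ?thesis by (simp add: norm_sq_cart sum_distrib_left)
  qed
  have s: "integrable M (\<lambda>\<omega>. (?s k n \<omega>)\<^sup>2)" "expectation (\<lambda>\<omega>. (?s k n \<omega>)\<^sup>2) \<le> N n * mom 2" for k n
  proof -
    have c: "(x $ k - mu0 $ k)\<^sup>2 \<le> norm (x - mu0) ^ 2" for x
      using centred_prod_le[of k k x] by (simp add: centred_prod_def power2_eq_square)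
    have 1: "integrable Dist (\<lambda>x. (x $ k - mu0 $ k)\<^sup>2)"
      by (rule Bochner_Integration.integrable_bound[OF int_centred_pow[of 2]]) (use c in auto)
    have 2: "(\<integral>x. x $ k - mu0 $ k \<partial>Dist) = 0"
      using integral_bounded_linear[OF bounded_linear_vec_nth int_centred(1), of k] int_centred(2) by simp
    have 3: "(\<integral>x. (x $ k - mu0 $ k)\<^sup>2 \<partial>Dist) \<le> mom 2"
      using 1 c int_centred_pow[of 2] by (intro integral_mono) auto
    show "integrable M (\<lambda>\<omega>. (?s k n \<omega>)\<^sup>2)" "expectation (\<lambda>\<omega>. (?s k n \<omega>)\<^sup>2) \<le> N n * mom 2"
      using centred_sum_square[where J="?J n", OF _ _ 1 2 3]
      by (auto simp: card_cartesian_product N_def mult.commute)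
  qed
  have "\<exists>C>0. evt_prob M e (\<lambda>n \<omega>. (norm (grad_g (K n) n (Y n \<omega>) mu0 0))\<^sup>2 \<le> C * (1 / N n))"
  proof (rule markov_bound[where m="real CARD('d) * mom 2"])
    show "\<forall>\<^sub>F n in sequentially. integrable M (\<lambda>\<omega>. (norm (grad_g (K n) n (Y n \<omega>) mu0 0))\<^sup>2)"
      unfolding eq using s by auto
    show "\<forall>\<^sub>F n in sequentially. expectation (\<lambda>\<omega>. (norm (grad_g (K n) n (Y n \<omega>) mu0 0))\<^sup>2) \<le> real CARD('d) * mom 2 * (1 / N n)"
      using eventually_gt_at_top[of 0]
    proof eventually_elim
      case (elim n)
      have N: "0 < N n" using elim K_pos[of n] by (simp add: N_def)
      have "expectation (\<lambda>\<omega>. (norm (grad_g (K n) n (Y n \<omega>) mu0 0))\<^sup>2) = (1 / N n)\<^sup>2 * (\<Sum>k\<in>UNIV. expectation (\<lambda>\<omega>. (?s k n \<omega>)\<^sup>2))"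
        unfolding eq using s by simp
      also have "\<dots> \<le> (1 / N n)\<^sup>2 * (\<Sum>k\<in>(UNIV::'d set). N n * mom 2)"
        using s by (intro mult_left_mono sum_mono) auto
      also have "\<dots> = real CARD('d) * mom 2 * (1 / N n)" using N by (simp add: power2_eq_square)
      finally show ?case .
    qed
    show "\<forall>\<^sub>F n in sequentially. 0 < 1 / N n"
      using eventually_gt_at_top[of 0]
    proof eventually_elim
      case (elim n) then show ?case using K_pos[of n] by (simp add: N_def)
    qed
  qed (use assms in auto)
  then obtain C where C: "C > 0" "evt_prob M e (\<lambda>n \<omega>. (norm (grad_g (K n) n (Y n \<omega>) mu0 0))\<^sup>2 \<le> C * (1 / N n))" by blast
  have "evt_prob M e (\<lambda>n \<omega>. norm (grad_g (K n) n (Y n \<omega>) mu0 0) \<le> sqrt C / sqrt (real (n * K n)))"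
  proof (rule evt_prob_mono[OF C(2)], intro always_eventually allI ballI impI)
    fix n \<omega> assume "(norm (grad_g (K n) n (Y n \<omega>) mu0 0))\<^sup>2 \<le> C * (1 / N n)"
    then have "norm (grad_g (K n) n (Y n \<omega>) mu0 0) \<le> sqrt (C * (1 / N n))" by (rule real_le_rsqrt)
    then show "norm (grad_g (K n) n (Y n \<omega>) mu0 0) \<le> sqrt C / sqrt (real (n * K n))"
      by (simp add: N_def real_sqrt_divide)
  qed
  then show ?thesis using C by (intro exI[of _ "sqrt C"]) auto
qed

end

section \<open>Quadratic forms\<close>

text \<open>The minimum \<open>m\<close> of the quadratic form on the unit sphere is an eigenvalue:
  otherwise moving from the minimiser \<open>v0\<close> against the residual A v0 - m v0 would lower
  the Rayleigh quotient below \<open>m\<close>.\<close>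

lemma symmetric_coercive:
  fixes A :: "real^'d^'d"
  assumes sym: "\<And>u v. u \<bullet> (A *v v) = v \<bullet> (A *v u)"
    and eig: "\<And>e. is_eigenvalue A e \<Longrightarrow> c \<le> e"
  shows "c * (norm v)\<^sup>2 \<le> v \<bullet> (A *v v)"
proof -
  have "continuous_on (sphere 0 1) (\<lambda>v. v \<bullet> (A *v v))"
    by (intro continuous_intros linear_continuous_on linear_conv_bounded_linear[THEN iffD1] matrix_vector_mul_linear)
  moreover have "sphere 0 1 \<noteq> ({} :: (real^'d) set)" by simp
  ultimately obtain v0 :: "real^'d" where v0: "norm v0 = 1"
    and min: "\<And>v. norm v = 1 \<Longrightarrow> v0 \<bullet> (A *v v0) \<le> v \<bullet> (A *v v)"
    using continuous_attains_inf[OF compact_sphere, of 0 1 "\<lambda>v. v \<bullet> (A *v v)"] by auto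
  define m where "m = v0 \<bullet> (A *v v0)"
  have ray: "m * (norm v)\<^sup>2 \<le> v \<bullet> (A *v v)" for v
  proof (cases "v = 0")
    case False
    have "m \<le> (v /\<^sub>R norm v) \<bullet> (A *v (v /\<^sub>R norm v))"
      unfolding m_def using False by (intro min) simp
    also have "\<dots> = (v \<bullet> (A *v v)) / (norm v)\<^sup>2"
      by (simp add: matrix_vector_mult_scaleR power2_eq_square divide_inverse)
    finally show ?thesis using False by (simp add: field_simps)
  qed simp
  define r where "r = A *v v0 - m *\<^sub>R v0"
  define s where "s = r \<bullet> (A *v r) - m * (norm r)\<^sup>2"
  have s0: "0 \<le> s" using ray[of r] by (simp add: s_def)
  have q: "0 \<le> 2 * t * (norm r)\<^sup>2 + t\<^sup>2 * s" for t
  proof -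
    let ?v = "v0 + t *\<^sub>R r"
    have e1: "?v \<bullet> (A *v ?v) = m + 2 * t * (r \<bullet> (A *v v0)) + t\<^sup>2 * (r \<bullet> (A *v r))"
      using sym[of v0 r] by (simp add: m_def matrix_vector_right_distrib matrix_vector_mult_scaleR inner_simps power2_eq_square algebra_simps)
    have e2: "(norm ?v)\<^sup>2 = 1 + 2 * t * (r \<bullet> v0) + t\<^sup>2 * (norm r)\<^sup>2"
      using v0 by (simp add: power2_norm_eq_inner inner_simps inner_commute[of v0 r] power2_eq_square[of t] norm_eq_1 algebra_simps)
    have e3: "(norm r)\<^sup>2 = r \<bullet> (A *v v0) - m * (r \<bullet> v0)"
      unfolding power2_norm_eq_inner by (subst (2) r_def) (simp add: inner_simps)
    show ?thesis using ray[of ?v] unfolding e1 e2 s_def e3 by (simp add: algebra_simps)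
  qed
  have "r = 0"
  proof (rule ccontr)
    assume "r \<noteq> 0"
    then have R: "0 < (norm r)\<^sup>2" by simp
    \<comment> \<open>The minimiser of the quadratic in \<open>q\<close> would be - norm r ^ 2 / s;
      the + 1 avoids a division by 0 and still leaves the value negative.\<close>
    define t where "t = - ((norm r)\<^sup>2 / (s + 1))"
    have "t\<^sup>2 * s = (norm r)\<^sup>2 * (norm r)\<^sup>2 / (s + 1) * (s / (s + 1))"
      by (simp add: t_def power2_eq_square)
    also have "\<dots> \<le> (norm r)\<^sup>2 * (norm r)\<^sup>2 / (s + 1) * 1"
      using s0 by (intro mult_left_mono) (auto simp: field_simps)
    finally have "t\<^sup>2 * s \<le> (norm r)\<^sup>2 * (norm r)\<^sup>2 / (s + 1)" by simp
    moreover have "2 * t * (norm r)\<^sup>2 = - 2 * ((norm r)\<^sup>2 * (norm r)\<^sup>2 / (s + 1))" by (simp add: t_def)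
    moreover have "0 < (norm r)\<^sup>2 * (norm r)\<^sup>2 / (s + 1)" using R s0 by (intro divide_pos_pos mult_pos_pos) auto
    ultimately show False using q[of t] by linarith
  qed
  then have "is_eigenvalue A m" using v0 by (auto simp: is_eigenvalue_def r_def intro!: exI[of _ v0])
  then have "c \<le> m" by (rule eig)
  then have "c * (norm v)\<^sup>2 \<le> m * (norm v)\<^sup>2" by (intro mult_right_mono) auto
  then show ?thesis using ray[of v] by linarith
qed

text \<open>Gram-Schmidt by dimension count: the k vectors A b_i span a proper subspace, so some
  nonzero vector is orthogonal to all of them, and positivity of the form allows normalising it. No
  square root of \<open>A\<close> is formed.\<close>

lemma orthonormal_for_form:
  fixes A :: "real^'d^'d"
  assumes sym: "\<And>u v. u \<bullet> (A *v v) = v \<bullet> (A *v u)"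
    and pos: "\<And>v. v \<noteq> 0 \<Longrightarrow> 0 < v \<bullet> (A *v v)"
    and k: "k \<le> CARD('d)"
  shows "\<exists>b::nat \<Rightarrow> real^'d. \<forall>i<k. \<forall>j<k. b i \<bullet> (A *v b j) = (if i = j then 1 else 0)"
  using k
proof (induction k)
  case (Suc k)
  then obtain b :: "nat \<Rightarrow> real^'d" where b: "\<And>i j. i < k \<Longrightarrow> j < k \<Longrightarrow> b i \<bullet> (A *v b j) = (if i = j then 1 else 0)"
    by auto
  let ?S = "(\<lambda>i. A *v b i) ` {..<k}"
  have "dim ?S \<le> card ?S" by (intro dim_le_card span_superset) auto
  also have "\<dots> \<le> k" using card_image_le[of "{..<k}" "\<lambda>i. A *v b i"] by simp
  finally have "dim ?S < DIM(real^'d)" using Suc.prems by simp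
  then obtain x :: "real^'d" where x: "x \<noteq> 0" "\<And>y. y \<in> span ?S \<Longrightarrow> orthogonal x y"
    using orthogonal_to_subspace_exists by blast
  define v where "v = x /\<^sub>R sqrt (x \<bullet> (A *v x))"
  have px: "0 < x \<bullet> (A *v x)" by (rule pos[OF x(1)])
  have vv: "v \<bullet> (A *v v) = 1"
    using px by (simp add: v_def matrix_vector_mult_scaleR field_simps)
  have vb: "v \<bullet> (A *v b i) = 0" "b i \<bullet> (A *v v) = 0" if "i < k" for i
  proof -
    have "orthogonal x (A *v b i)" using that by (intro x span_base) auto
    then show "v \<bullet> (A *v b i) = 0" by (simp add: v_def orthogonal_def)
    then show "b i \<bullet> (A *v v) = 0" using sym[of "b i" v] by simp
  qed
  have "\<forall>i<Suc k. \<forall>j<Suc k. (b(k := v)) i \<bullet> (A *v (b(k := v)) j) = (if i = j then 1 else 0)"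
    using b vv vb by (auto simp: less_Suc_eq)
  then show ?case by blast
qed simp

text \<open>Pairing the residual of the second claim with any b_j gives 0, and the b_j span the
  space. The claim says that the sum of the projections b_i b_i^T is the inverse of
  \<open>A\<close>; so if A x = w, then x . A x is the sum of the squares (b_i . w)^2.\<close>

lemma form_basis:
  fixes A :: "real^'d^'d"
  assumes sym: "\<And>u v. u \<bullet> (A *v v) = v \<bullet> (A *v u)"
    and pos: "\<And>v. v \<noteq> 0 \<Longrightarrow> 0 < v \<bullet> (A *v v)"
  obtains b :: "nat \<Rightarrow> real^'d"
  where "\<And>i j. i < CARD('d) \<Longrightarrow> j < CARD('d) \<Longrightarrow> b i \<bullet> (A *v b j) = (if i = j then 1 else 0)"
    and "\<And>w. A *v (\<Sum>i<CARD('d). (b i \<bullet> w) *\<^sub>R b i) = w"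
proof -
  let ?I = "{..<CARD('d)}"
  obtain b :: "nat \<Rightarrow> real^'d" where b: "\<And>i j. i \<in> ?I \<Longrightarrow> j \<in> ?I \<Longrightarrow> b i \<bullet> (A *v b j) = (if i = j then 1 else 0)"
    using orthonormal_for_form[OF sym pos order_refl] by auto
  have dot: "b j \<bullet> (A *v (\<Sum>i\<in>?I. c i *\<^sub>R b i)) = c j" if "j \<in> ?I" for j c
  proof -
    have "A *v (\<Sum>i\<in>?I. c i *\<^sub>R b i) = (\<Sum>i\<in>?I. c i *\<^sub>R (A *v b i))"
      by (simp add: linear_sum[OF matrix_vector_mul_linear] matrix_vector_mult_scaleR)
    then have "b j \<bullet> (A *v (\<Sum>i\<in>?I. c i *\<^sub>R b i)) = (\<Sum>i\<in>?I. c i * (b j \<bullet> (A *v b i)))"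
      by (simp add: inner_sum_right)
    also have "\<dots> = (\<Sum>i\<in>?I. if i = j then c j else 0)"
      using b that by (intro sum.cong) auto
    also have "\<dots> = c j" using that by simp
    finally show ?thesis .
  qed
  have inj: "inj_on b ?I"
  proof (rule inj_onI)
    fix i j assume "i \<in> ?I" "j \<in> ?I" "b i = b j"
    then show "i = j" using b[of i j] b[of i i] by (auto split: if_splits)
  qed
  have ind: "independent (b ` ?I)"
  proof (rule independent_if_scalars_zero)
    fix f x assume s: "(\<Sum>x\<in>b ` ?I. f x *\<^sub>R x) = 0" and "x \<in> b ` ?I"
    then obtain j where j: "j \<in> ?I" "x = b j" by auto
    have "(\<Sum>i\<in>?I. f (b i) *\<^sub>R b i) = 0" using s by (simp add: sum.reindex[OF inj])
    then show "f x = 0" using dot[OF j(1), of "\<lambda>i. f (b i)"] j by simp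
  qed simp
  have span: "UNIV \<subseteq> span (b ` ?I)"
    by (rule card_ge_dim_independent[OF _ ind]) (auto simp: card_image[OF inj] dim_UNIV)
  have "A *v (\<Sum>i<CARD('d). (b i \<bullet> w) *\<^sub>R b i) = w" for w
  proof -
    define r where "r = A *v (\<Sum>i\<in>?I. (b i \<bullet> w) *\<^sub>R b i) - w"
    have "orthogonal r r"
    proof (rule orthogonal_to_span)
      show "r \<in> span (b ` ?I)" using span by auto
      fix y assume "y \<in> b ` ?I"
      then obtain j where j: "j \<in> ?I" "y = b j" by auto
      then have "b j \<bullet> r = 0" using dot[OF j(1)] by (simp add: r_def inner_diff_right)
      then show "orthogonal r y" by (simp add: orthogonal_def j inner_commute)
    qed
    then show ?thesis by (simp add: orthogonal_def r_def)
  qed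
  then show ?thesis using b that by auto
qed

section \<open>The chi-squared limit\<close>

text \<open>Stated for powers of a single characteristic function, rather than for a sequence of variables,
  so that it applies to the rows of a triangular array.\<close>

lemma (in real_distribution) char_power_limit:
  assumes int1: "integrable M (\<lambda>x. x)" and mean0: "expectation (\<lambda>x. x) = 0"
    and int2: "integrable M (\<lambda>x. x\<^sup>2)"
  shows "(\<lambda>n. char M (1 / sqrt (real n)) ^ n) \<longlonglongrightarrow> complex_of_real (exp (- expectation (\<lambda>x. x\<^sup>2) / 2))"
proof -
  define v where "v = expectation (\<lambda>x. x\<^sup>2)"
  have v0: "0 \<le> v" by (simp add: v_def)
  let ?u = "\<lambda>n::nat. 1 / sqrt (real n)"
  \<comment> \<open>The remainder of \<open>char_approx3\<close>. The minimum tends to 0 pointwise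
    through its cubic part and is dominated through its quadratic part, so second moments
    suffice.\<close>
  let ?E = "\<lambda>n. expectation (\<lambda>x. min (6 * x\<^sup>2) (\<bar>?u n\<bar> * \<bar>x\<bar> ^ 3))"
  have bound: "\<forall>\<^sub>F n in sequentially. cmod (char M (?u n) ^ n - complex_of_real ((1 + (- v / 2) / real n) ^ n)) \<le> 1 / 6 * ?E n"
    using eventually_ge_at_top[of "nat \<lceil>v\<rceil>"] eventually_gt_at_top[of 0]
  proof eventually_elim
    case (elim n)
    have nv: "v \<le> real n" using elim by linarith
    have u2: "(?u n)\<^sup>2 = 1 / real n" by (simp add: power_divide)
    have "cmod (char M (?u n) - (1 - (?u n)\<^sup>2 * v / 2)) \<le> (?u n)\<^sup>2 / 6 * ?E n"
      using char_approx3[OF int1 mean0 int2, of v "?u n"] mean0 by (simp add: v_def)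
    then have 1: "cmod (char M (?u n) - complex_of_real (1 + (- v / 2) / real n)) \<le> (1 / real n) / 6 * ?E n"
      unfolding u2 by (simp add: mult.commute)
    \<comment> \<open>The estimate of a difference of n-th powers by n times the difference needs
      both bases in the unit disc; hence n >= v.\<close>
    have "\<bar>1 + (- v / 2) / real n\<bar> \<le> 1" using nv elim v0 by (auto simp: abs_le_iff field_simps)
    then have "cmod (char M (?u n) ^ n - complex_of_real (1 + (- v / 2) / real n) ^ n)
        \<le> real n * cmod (char M (?u n) - complex_of_real (1 + (- v / 2) / real n))"
      by (intro norm_power_diff cmod_char_le_1) (simp only: norm_of_real)
    also have "\<dots> \<le> real n * ((1 / real n) / 6 * ?E n)" by (intro mult_left_mono 1) simp
    also have "\<dots> = 1 / 6 * ?E n" using elim by simp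
    finally show ?case by simp
  qed
  have "?E \<longlonglongrightarrow> expectation (\<lambda>x. 0)"
  proof (rule integral_dominated_convergence[where w="\<lambda>x. 6 * x\<^sup>2"])
    show "AE x in M. (\<lambda>n. min (6 * x\<^sup>2) (\<bar>?u n\<bar> * \<bar>x\<bar> ^ 3)) \<longlonglongrightarrow> 0"
    proof (intro AE_I2)
      fix x :: real
      have "(\<lambda>n. \<bar>1 / sqrt (real n)\<bar> * c) \<longlonglongrightarrow> 0" for c :: real by real_asymp
      then have "(\<lambda>n. min (6 * x\<^sup>2) (\<bar>?u n\<bar> * \<bar>x\<bar> ^ 3)) \<longlonglongrightarrow> min (6 * x\<^sup>2) 0"
        by (intro tendsto_min tendsto_const)
      then show "(\<lambda>n. min (6 * x\<^sup>2) (\<bar>?u n\<bar> * \<bar>x\<bar> ^ 3)) \<longlonglongrightarrow> 0" by simp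
    qed
  qed (use int2 in auto)
  then have "(\<lambda>n. 1 / 6 * ?E n) \<longlonglongrightarrow> 0" by (intro tendsto_mult_right_zero) simp
  then have "(\<lambda>n. char M (?u n) ^ n - complex_of_real ((1 + (- v / 2) / real n) ^ n)) \<longlonglongrightarrow> 0"
    by (rule Lim_null_comparison[OF bound])
  moreover have "(\<lambda>n. complex_of_real ((1 + (- v / 2) / real n) ^ n)) \<longlonglongrightarrow> complex_of_real (exp (- v / 2))"
    by (intro tendsto_of_real tendsto_exp_limit_sequentially)
  ultimately show ?thesis unfolding v_def by (rule Lim_transform[rotated])
qed

text \<open>Laplace transforms at the integers determine weak convergence on the half line: by Weierstrass,
  test functions are uniformly approximated by polynomials in \<open>exp (- x)\<close>.\<close>

lemma laplace_imp_weak_conv: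
  fixes \<mu> :: "nat \<Rightarrow> real measure" and \<nu> :: "real measure"
  assumes \<mu>: "\<And>n. real_distribution (\<mu> n)" "\<And>n. AE x in \<mu> n. 0 \<le> x"
    and \<nu>: "real_distribution \<nu>" "AE x in \<nu>. 0 \<le> x"
    and lap: "\<And>k::nat. (\<lambda>n. \<integral>x. exp (- x) ^ k \<partial>\<mu> n) \<longlonglongrightarrow> (\<integral>x. exp (- x) ^ k \<partial>\<nu>)"
  shows "weak_conv_m \<mu> \<nu>"
proof (rule integral_cts_step_conv_imp_weak_conv[OF \<mu>(1) \<nu>(1)])
  fix x y :: real assume xy: "x < y"
  let ?f = "cts_step x y"
  have f01: "0 \<le> ?f t" "?f t \<le> 1" for t using xy by (auto simp: cts_step_def)
  \<comment> \<open>The test function in the variable p = exp (- t). The endpoint p = 0 stands for t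
    at infinity; \<open>cts_step\<close> vanishes beyond y, so \<open>h\<close> vanishes below exp
    (- y) and extends continuously by 0.\<close>
  define h where "h p = (if p \<le> 0 then 0 else ?f (- ln p))" for p :: real
  have fcont: "isCont ?f t" for t
    by (intro continuous_on_interior[OF uniformly_continuous_imp_continuous[OF cts_step_uniformly_continuous]]) (auto simp: xy)
  have hcont: "continuous_on {0..1} h"
  proof (rule continuous_at_imp_continuous_on, rule ballI)
    fix p :: real assume "p \<in> {0..1}"
    show "isCont h p"
    proof (cases "p = 0")
      case True
      have "\<forall>\<^sub>F q in nhds p. q < exp (- y)"
        using True by (intro order_tendstoD(2)[OF filterlim_ident]) simp
      then have "\<forall>\<^sub>F q in nhds p. h q = 0"
      proof eventually_elim
        case (elim q)
        have "y \<le> - ln q" if "0 < q" using elim that by (metis less_eq_real_def ln_exp ln_less_cancel_iff minus_le_iff exp_gt_zero le_minus_iff)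
        then show ?case using xy by (cases "q \<le> 0") (auto simp: h_def cts_step_def)
      qed
      then have "isCont h p \<longleftrightarrow> isCont (\<lambda>_. 0 :: real) p" by (intro isCont_cong) auto
      then show ?thesis by simp
    next
      case False
      then have p: "0 < p" using \<open>p \<in> {0..1}\<close> by auto
      have "\<forall>\<^sub>F q in nhds p. 0 < q" using p by (intro order_tendstoD(1)[OF filterlim_ident])
      then have "\<forall>\<^sub>F q in nhds p. h q = ?f (- ln q)" by eventually_elim (simp add: h_def)
      then have "isCont h p \<longleftrightarrow> isCont (\<lambda>q. ?f (- ln q)) p" by (rule isCont_cong)
      moreover have "isCont (\<lambda>q. ?f (- ln q)) p"
      proof (rule isCont_o2[OF _ fcont])
        show "isCont (\<lambda>q. - ln q) p" using p by (intro continuous_intros) auto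
      qed
      ultimately show ?thesis by simp
    qed
  qed
  have hf: "h (exp (- t)) = ?f t" for t by (simp add: h_def)
  have poly: "(\<lambda>n. \<integral>t. (\<Sum>i\<le>N. a i * exp (- t) ^ i) \<partial>\<mu> n) \<longlonglongrightarrow> (\<integral>t. (\<Sum>i\<le>N. a i * exp (- t) ^ i) \<partial>\<nu>)"
    and poly_int: "integrable (\<mu> n) (\<lambda>t. \<Sum>i\<le>N. a i * exp (- t) ^ i)" "integrable \<nu> (\<lambda>t. \<Sum>i\<le>N. a i * exp (- t) ^ i)"
    for a :: "nat \<Rightarrow> real" and N n
  proof -
    have int: "integrable \<kappa> (\<lambda>t. exp (- t) ^ i)" if "real_distribution \<kappa>" "AE t in \<kappa>. 0 \<le> t" for \<kappa> :: "real measure" and i :: nat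
    proof -
      interpret \<kappa>: real_distribution \<kappa> by (rule that)
      show ?thesis using that(2)
        by (intro \<kappa>.integrable_const_bound[of _ 1]) (auto intro!: power_le_one elim!: eventually_mono)
    qed
    show "integrable (\<mu> n) (\<lambda>t. \<Sum>i\<le>N. a i * exp (- t) ^ i)" "integrable \<nu> (\<lambda>t. \<Sum>i\<le>N. a i * exp (- t) ^ i)"
      using int \<mu> \<nu> by auto
    show "(\<lambda>n. \<integral>t. (\<Sum>i\<le>N. a i * exp (- t) ^ i) \<partial>\<mu> n) \<longlonglongrightarrow> (\<integral>t. (\<Sum>i\<le>N. a i * exp (- t) ^ i) \<partial>\<nu>)"
      using int \<mu> \<nu> by (simp add: lap tendsto_sum tendsto_mult_left)
  qed
  show "(\<lambda>n. integral\<^sup>L (\<mu> n) ?f) \<longlonglongrightarrow> integral\<^sup>L \<nu> ?f"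
  proof (rule LIMSEQ_I)
    fix e :: real assume e: "0 < e"
    obtain g where g: "real_polynomial_function g" "\<And>p. p \<in> {0..1} \<Longrightarrow> \<bar>h p - g p\<bar> < e / 4"
      using Stone_Weierstrass_real_polynomial_function[OF _ hcont, of "e/4"] e by auto
    obtain a N where gN: "g = (\<lambda>p. \<Sum>i\<le>N. a i * p ^ i)"
      using g(1) real_polynomial_function_iff_sum by blast
    let ?g = "\<lambda>t. \<Sum>i\<le>N. a i * exp (- t) ^ i"
    have close: "\<bar>integral\<^sup>L \<kappa> ?f - integral\<^sup>L \<kappa> ?g\<bar> \<le> e / 4"
      if "real_distribution \<kappa>" "AE t in \<kappa>. 0 \<le> t" "integrable \<kappa> ?g" for \<kappa> :: "real measure"
    proof -
      interpret \<kappa>: real_distribution \<kappa> by (rule that)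
      have intf: "integrable \<kappa> ?f" by (rule \<kappa>.integrable_cts_step[OF xy])
      have "\<bar>integral\<^sup>L \<kappa> ?f - integral\<^sup>L \<kappa> ?g\<bar> = norm (\<integral>t. ?f t - ?g t \<partial>\<kappa>)"
        using intf that by simp
      also have "\<dots> \<le> (\<integral>t. norm (?f t - ?g t) \<partial>\<kappa>)" by (rule integral_norm_bound)
      also have "\<dots> \<le> (\<integral>t. e / 4 \<partial>\<kappa>)"
      proof (rule integral_mono_AE)
        \<comment> \<open>The polynomial is close to \<open>h\<close> only on the unit interval,
          that is for t >= 0, which holds almost everywhere.\<close>
        show "AE t in \<kappa>. norm (?f t - ?g t) \<le> e / 4"
          using that(2)
        proof eventually_elim
          case (elim t)
          then have "\<bar>h (exp (- t)) - g (exp (- t))\<bar> < e / 4" by (intro g(2)) auto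
          then show ?case unfolding hf gN by simp
        qed
      qed (use intf that in auto)
      also have "\<dots> = e / 4" using \<kappa>.prob_space by simp
      finally show ?thesis .
    qed
    have "\<exists>n0. \<forall>n\<ge>n0. norm (integral\<^sup>L (\<mu> n) ?g - integral\<^sup>L \<nu> ?g) < e / 4"
      using LIMSEQ_D[OF poly, of "e/4"] e by auto
    then obtain n0 where n0: "\<And>n. n0 \<le> n \<Longrightarrow> \<bar>integral\<^sup>L (\<mu> n) ?g - integral\<^sup>L \<nu> ?g\<bar> < e / 4" by auto
    show "\<exists>no. \<forall>n\<ge>no. norm (integral\<^sup>L (\<mu> n) ?f - integral\<^sup>L \<nu> ?f) < e"
    proof (intro exI[of _ n0] allI impI)
      fix n assume "n0 \<le> n"
      from n0[OF this] close[OF \<mu>(1)[of n] \<mu>(2)[of n] poly_int(1)[where n=n and N=N and a=a]] close[OF \<nu> poly_int(2)[where N=N and a=a]]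
      show "norm (integral\<^sup>L (\<mu> n) ?f - integral\<^sup>L \<nu> ?f) < e"
        using e unfolding real_norm_def by linarith
    qed
  qed
qed

text \<open>Slutsky's argument. Test functions \<open>cts_step\<close> are uniformly continuous with
  values in the unit interval, so their expectations at L n and Q n differ by at most e / 4 plus the
  probability of an event covering the points where L n and Q n are far apart.\<close>

lemma (in prob_space) weak_conv_perturb:
  fixes Q L :: "nat \<Rightarrow> 'a \<Rightarrow> real" and \<nu> :: "real measure"
  assumes [measurable]: "\<And>n. Q n \<in> borel_measurable M" "\<And>n. L n \<in> borel_measurable M"
    and \<nu>: "real_distribution \<nu>"
    and conv: "weak_conv_m (\<lambda>n. distr M borel (Q n)) \<nu>"
    and close: "\<And>e. 0 < e \<Longrightarrow> whp M (\<lambda>n \<omega>. \<bar>L n \<omega> - Q n \<omega>\<bar> \<le> e)"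
  shows "weak_conv_m (\<lambda>n. distr M borel (L n)) \<nu>"
proof (rule integral_cts_step_conv_imp_weak_conv[OF real_distribution_distr \<nu>])
  fix x y :: real assume xy: "x < y"
  let ?f = "cts_step x y"
  have f01: "0 \<le> ?f t" "?f t \<le> 1" for t using xy by (auto simp: cts_step_def)
  have fuc: "uniformly_continuous_on UNIV ?f" by (rule cts_step_uniformly_continuous[OF xy])
  have fcont: "isCont ?f t" for t
    by (intro continuous_on_interior[OF uniformly_continuous_imp_continuous[OF fuc]]) auto
  have [measurable]: "?f \<in> borel_measurable borel"
    by (intro borel_measurable_continuous_onI uniformly_continuous_imp_continuous fuc)
  have "(\<lambda>n. integral\<^sup>L (distr M borel (Q n)) ?f) \<longlonglongrightarrow> integral\<^sup>L \<nu> ?f"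
    using f01 by (intro weak_conv_imp_integral_bdd_continuous_conv[OF _ \<nu> conv, where B=1] fcont) auto
  moreover have "(\<lambda>n. integral\<^sup>L (distr M borel (L n)) ?f - integral\<^sup>L (distr M borel (Q n)) ?f) \<longlonglongrightarrow> 0"
  proof (rule tendstoI)
    fix e :: real assume e: "0 < e"
    obtain d where d: "0 < d" "\<And>s t. dist s t < d \<Longrightarrow> dist (?f s) (?f t) < e / 4"
      using fuc e unfolding uniformly_continuous_on_def
      by (metis UNIV_I zero_less_divide_iff zero_less_numeral)
    have "evt_prob M (e / 4) (\<lambda>n \<omega>. \<bar>L n \<omega> - Q n \<omega>\<bar> \<le> d / 2)"
      using close[of "d/2"] d e by (auto simp: whp_def)
    then show "\<forall>\<^sub>F n in sequentially. dist (integral\<^sup>L (distr M borel (L n)) ?f - integral\<^sup>L (distr M borel (Q n)) ?f) 0 < e"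
      unfolding evt_prob_def
    proof eventually_elim
      case (elim n)
      then obtain B where B[measurable]: "B \<in> events" and sub: "{\<omega>\<in>space M. \<not> \<bar>L n \<omega> - Q n \<omega>\<bar> \<le> d / 2} \<subseteq> B" and p: "prob B < e / 4"
        by blast
      have int: "integrable M (\<lambda>\<omega>. ?f (L n \<omega>))" "integrable M (\<lambda>\<omega>. ?f (Q n \<omega>))"
        using f01 by (intro integrable_const_bound[of _ 1]; simp)+
      have "\<bar>integral\<^sup>L (distr M borel (L n)) ?f - integral\<^sup>L (distr M borel (Q n)) ?f\<bar> = norm (expectation (\<lambda>\<omega>. ?f (L n \<omega>) - ?f (Q n \<omega>)))"
        using int by (simp add: integral_distr)
      also have "\<dots> \<le> expectation (\<lambda>\<omega>. norm (?f (L n \<omega>) - ?f (Q n \<omega>)))" by (rule integral_norm_bound)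
      also have "\<dots> \<le> expectation (\<lambda>\<omega>. e / 4 + indicator B \<omega>)"
      proof (rule integral_mono)
        fix \<omega> assume \<omega>: "\<omega> \<in> space M"
        show "norm (?f (L n \<omega>) - ?f (Q n \<omega>)) \<le> e / 4 + indicator B \<omega>"
        proof (cases "\<omega> \<in> B")
          case True
          then show ?thesis using f01[of "L n \<omega>"] f01[of "Q n \<omega>"] e by auto
        next
          case False
          then have "dist (L n \<omega>) (Q n \<omega>) < d" using sub \<omega> d by (auto simp: dist_real_def)
          from d(2)[OF this] show ?thesis using False by (simp add: dist_real_def)
        qed
      qed (use int in \<open>auto simp: emeasure_eq_measure\<close>)
      also have "\<dots> = e / 4 + prob B" by (simp add: prob_space emeasure_eq_measure)
      also have "\<dots> < e" using p e by linarith
      finally show ?case by (simp add: dist_real_def)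
    qed
  qed
  ultimately show "(\<lambda>n. integral\<^sup>L (distr M borel (L n)) ?f) \<longlonglongrightarrow> integral\<^sup>L \<nu> ?f"
    by (rule Lim_transform)
qed simp

text \<open>The standard normal characteristic function at sqrt (2 * r) * w is exp (- r * w^2); the
  factor 2 cancels the 1/2 in its exponent. Independent coordinates turn the product into the sum of
  squares.\<close>

lemma gauss_laplace:
  fixes w :: "nat \<Rightarrow> real"
  assumes "0 \<le> r"
  shows "(\<integral>z. iexp (\<Sum>k<d. sqrt (2 * r) * w k * z k) \<partial>(PiM {..<d} (\<lambda>_. std_normal_distribution)))
     = complex_of_real (exp (- r * (\<Sum>k<d. (w k)\<^sup>2)))"
proof -
  interpret N: real_distribution std_normal_distribution by (rule real_dist_normal_dist)
  interpret product_prob_space "\<lambda>_::nat. std_normal_distribution" ..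
  have "(\<integral>z. iexp (\<Sum>k<d. sqrt (2 * r) * w k * z k) \<partial>(PiM {..<d} (\<lambda>_. std_normal_distribution)))
     = (\<integral>z. (\<Prod>k<d. iexp (sqrt (2 * r) * w k * z k)) \<partial>(PiM {..<d} (\<lambda>_. std_normal_distribution)))"
    by (simp add: exp_sum sum_distrib_left)
  also have "\<dots> = (\<Prod>k<d. (\<integral>x. iexp (sqrt (2 * r) * w k * x) \<partial>std_normal_distribution))"
    by (rule product_integral_prod) (auto intro!: N.integrable_iexp)
  also have "\<dots> = (\<Prod>k<d. complex_of_real (exp (- (r * (w k)\<^sup>2))))"
  proof (rule prod.cong[OF refl])
    fix k
    have "(\<integral>x. iexp (sqrt (2 * r) * w k * x) \<partial>std_normal_distribution) = char std_normal_distribution (sqrt (2 * r) * w k)"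
      by (simp add: char_def)
    also have "\<dots> = complex_of_real (exp (- (r * (w k)\<^sup>2)))"
      using assms by (simp add: char_std_normal_distribution power_mult_distrib)
    finally show "(\<integral>x. iexp (sqrt (2 * r) * w k * x) \<partial>std_normal_distribution) = complex_of_real (exp (- (r * (w k)\<^sup>2)))" .
  qed
  also have "\<dots> = complex_of_real (exp (- r * (\<Sum>k<d. (w k)\<^sup>2)))"
    by (simp add: exp_sum[symmetric] sum_distrib_left sum_negf flip: of_real_prod)
  finally show ?thesis .
qed

section \<open>Limit law of the quadratic statistic\<close>

context iid_array
begin

lemma int_centred_prod: "integrable Dist (centred_prod k l)"
  by (rule Bochner_Integration.integrable_bound[OF int_centred_pow[of 2]]) (use centred_prod_le in auto)

lemma cov_sym: "u \<bullet> (A *v v) = v \<bullet> (A *v u)"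
proof -
  have "A $ k $ l = A $ l $ k" for k l by (simp add: cov_matrix_def mult.commute)
  then have "(\<Sum>k\<in>UNIV. \<Sum>l\<in>UNIV. u $ k * (A $ k $ l * v $ l)) = (\<Sum>l\<in>UNIV. \<Sum>k\<in>UNIV. v $ l * (A $ l $ k * u $ k))"
    by (subst sum.swap) (simp add: mult_ac)
  then show ?thesis by (simp add: inner_vec_def matrix_vector_mult_def sum_distrib_left)
qed

lemma cov_quadratic:
  "integrable Dist (\<lambda>x. (v \<bullet> (x - mu0))\<^sup>2)" "(\<integral>x. (v \<bullet> (x - mu0))\<^sup>2 \<partial>Dist) = v \<bullet> (A *v v)"
proof -
  have eq: "(v \<bullet> (x - mu0))\<^sup>2 = (\<Sum>k\<in>UNIV. \<Sum>l\<in>UNIV. v $ k * v $ l * centred_prod k l x)" for x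
    by (simp add: inner_vec_def power2_eq_square sum_product centred_prod_def mult_ac)
  show "integrable Dist (\<lambda>x. (v \<bullet> (x - mu0))\<^sup>2)" unfolding eq using int_centred_prod by auto
  have "(\<integral>x. (v \<bullet> (x - mu0))\<^sup>2 \<partial>Dist) = (\<Sum>k\<in>UNIV. \<Sum>l\<in>UNIV. v $ k * v $ l * A $ k $ l)"
    unfolding eq using int_centred_prod by (simp add: integral_centred_prod)
  also have "\<dots> = v \<bullet> (A *v v)"
    by (simp add: inner_vec_def matrix_vector_mult_def sum_distrib_left mult_ac)
  finally show "(\<integral>x. (v \<bullet> (x - mu0))\<^sup>2 \<partial>Dist) = v \<bullet> (A *v v)" .
qed

definition scaled_sum :: "nat \<Rightarrow> real^'d \<Rightarrow> 'a \<Rightarrow> real" where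
  "scaled_sum n v \<omega> = (\<Sum>a\<in>{..<K n} \<times> {..<n}. v \<bullet> (X n (fst a) (snd a) \<omega> - mu0)) / sqrt (real (n * K n))"

lemma scaled_sum_measurable[measurable]: "scaled_sum n v \<in> borel_measurable M"
  unfolding scaled_sum_def[abs_def] by measurable

lemma scaled_sum_linear: "scaled_sum n (\<Sum>k\<in>I. c k *\<^sub>R b k) \<omega> = (\<Sum>k\<in>I. c k * scaled_sum n (b k) \<omega>)"
proof -
  have "(\<Sum>a\<in>{..<K n} \<times> {..<n}. (\<Sum>k\<in>I. c k *\<^sub>R b k) \<bullet> (X n (fst a) (snd a) \<omega> - mu0))
    = (\<Sum>k\<in>I. c k * (\<Sum>a\<in>{..<K n} \<times> {..<n}. b k \<bullet> (X n (fst a) (snd a) \<omega> - mu0)))"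
    unfolding inner_sum_left sum_distrib_left by (subst sum.swap) simp
  then show ?thesis by (simp only: scaled_sum_def sum_divide_distrib[where A=I] times_divide_eq_right)
qed

lemma N_at_top: "filterlim (\<lambda>n. n * K n) at_top sequentially"
proof (rule filterlim_at_top_mono[OF filterlim_ident])
  show "\<forall>\<^sub>F n in sequentially. n \<le> n * K n" using K_pos by simp
qed

text \<open>Stage n enters only through m = n * K n: the expectation is the m-th power of one fixed
  characteristic function at 1 / sqrt m. As m tends to infinity, \<open>char_power_limit\<close>
  applies by composition, however K depends on n.\<close>

lemma scaled_sum_char_limit:
  "(\<lambda>n. expectation (\<lambda>\<omega>. iexp (scaled_sum n v \<omega>))) \<longlonglongrightarrow> complex_of_real (exp (- (v \<bullet> (A *v v)) / 2))"
proof -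
  define \<mu> where "\<mu> = distr Dist borel (\<lambda>x. v \<bullet> (x - mu0))"
  interpret \<mu>: real_distribution \<mu> unfolding \<mu>_def by (rule D.real_distribution_distr) simp
  have int: "integrable Dist (\<lambda>x. v \<bullet> (x - mu0))" "(\<integral>x. v \<bullet> (x - mu0) \<partial>Dist) = 0"
    using int_centred(1) by simp (use int_centred in \<open>simp only: integral_inner_right, simp\<close>)
  have eq: "expectation (\<lambda>\<omega>. iexp (scaled_sum n v \<omega>)) = char \<mu> (1 / sqrt (real (n * K n))) ^ (n * K n)" for n
  proof -
    let ?J = "{..<K n} \<times> {..<n}"
    let ?t = "1 / sqrt (real (n * K n))"
    have "expectation (\<lambda>\<omega>. iexp (scaled_sum n v \<omega>)) = char (distr M borel (\<lambda>\<omega>. \<Sum>a\<in>?J. v \<bullet> (X n (fst a) (snd a) \<omega> - mu0))) ?t"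
      unfolding char_def by (subst integral_distr) (simp_all add: scaled_sum_def)
    also have "\<dots> = (\<Prod>a\<in>?J. char (distr M borel (\<lambda>\<omega>. v \<bullet> (X n (fst a) (snd a) \<omega> - mu0))) ?t)"
      by (intro char_distr_sum indep_X) auto
    also have "\<dots> = (\<Prod>a\<in>?J. char \<mu> ?t)"
    proof (rule prod.cong[OF refl])
      fix a assume "a \<in> ?J"
      then have "distr M borel (X n (fst a) (snd a)) = Dist" by (intro X_dist) auto
      then have "\<mu> = distr (distr M borel (X n (fst a) (snd a))) borel (\<lambda>x. v \<bullet> (x - mu0))"
        by (simp add: \<mu>_def)
      also have "\<dots> = distr M borel (\<lambda>\<omega>. v \<bullet> (X n (fst a) (snd a) \<omega> - mu0))"
        by (subst distr_distr) (auto simp: comp_def)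
      finally have "\<mu> = distr M borel (\<lambda>\<omega>. v \<bullet> (X n (fst a) (snd a) \<omega> - mu0))" .
      then show "char (distr M borel (\<lambda>\<omega>. v \<bullet> (X n (fst a) (snd a) \<omega> - mu0))) ?t = char \<mu> ?t" by simp
    qed
    also have "\<dots> = char \<mu> ?t ^ (n * K n)" by (simp add: card_cartesian_product mult.commute)
    finally show ?thesis .
  qed
  have "(\<lambda>m. char \<mu> (1 / sqrt (real m)) ^ m) \<longlonglongrightarrow> complex_of_real (exp (- \<mu>.expectation (\<lambda>x. x\<^sup>2) / 2))"
    by (rule \<mu>.char_power_limit) (use int cov_quadratic in \<open>auto simp: \<mu>_def integrable_distr_eq integral_distr\<close>)
  also have "\<mu>.expectation (\<lambda>x. x\<^sup>2) = v \<bullet> (A *v v)"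
    by (simp add: \<mu>_def integral_distr cov_quadratic)
  finally have "(\<lambda>n. char \<mu> (1 / sqrt (real (n * K n))) ^ (n * K n)) \<longlonglongrightarrow> complex_of_real (exp (- (v \<bullet> (A *v v)) / 2))"
    by (rule filterlim_compose[OF _ N_at_top])
  then show ?thesis unfolding eq .
qed

text \<open>Writing \<open>exp (- r q)\<close> for a sum of squares \<open>q\<close> as a Gaussian average of
  characters reduces the multivariate limit to the one-dimensional one.\<close>

lemma quadratic_laplace_limit:
  fixes b :: "nat \<Rightarrow> real^'d"
  assumes b: "\<And>i j. i < d \<Longrightarrow> j < d \<Longrightarrow> b i \<bullet> (A *v b j) = (if i = j then 1 else 0)"
    and r: "0 \<le> r"
  shows "(\<lambda>n. expectation (\<lambda>\<omega>. exp (- r * (\<Sum>k<d. (scaled_sum n (b k) \<omega>)\<^sup>2))))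
     \<longlonglongrightarrow> (\<integral>z. exp (- r * (\<Sum>k<d. (z k)\<^sup>2)) \<partial>(PiM {..<d} (\<lambda>_. std_normal_distribution)))"
proof -
  define G where "G = PiM {..<d} (\<lambda>_::nat. std_normal_distribution)"
  interpret N: real_distribution std_normal_distribution by (rule real_dist_normal_dist)
  interpret PP: product_prob_space "\<lambda>_::nat. std_normal_distribution" ..
  interpret G: prob_space G unfolding G_def by (rule prob_space_PiM) (rule N.prob_space_axioms)
  interpret P: pair_prob_space M G ..
  have comp: "(\<lambda>z. z k) \<in> borel_measurable G" if "k < d" for k
    unfolding G_def using measurable_component_singleton[of k "{..<d}" "\<lambda>_. std_normal_distribution"] that by simp
  define f where "f n \<omega> z = iexp (\<Sum>k<d. sqrt (2 * r) * scaled_sum n (b k) \<omega> * z k)" for n \<omega> and z :: "nat \<Rightarrow> real"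
  have f_meas[measurable]: "case_prod (f n) \<in> borel_measurable (M \<Otimes>\<^sub>M G)" for n
  proof -
    have c: "(\<lambda>p. snd p k) \<in> borel_measurable (M \<Otimes>\<^sub>M G)" if "k < d" for k
      using measurable_compose[OF measurable_snd comp[OF that], of M] by simp
    have "(\<lambda>p. \<Sum>k<d. sqrt (2 * r) * scaled_sum n (b k) (fst p) * snd p k) \<in> borel_measurable (M \<Otimes>\<^sub>M G)"
      using c by (intro borel_measurable_sum borel_measurable_times) auto
    then show ?thesis unfolding f_def[abs_def] case_prod_unfold by measurable
  qed
  have norm_f: "norm (f n \<omega> z) = 1" for n \<omega> z by (simp add: f_def)
  have int_f: "integrable (M \<Otimes>\<^sub>M G) (case_prod (f n))" for n
    by (rule P.P.integrable_const_bound[of _ 1]) (auto simp: norm_f case_prod_unfold)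
  have lhs: "complex_of_real (expectation (\<lambda>\<omega>. exp (- r * (\<Sum>k<d. (scaled_sum n (b k) \<omega>)\<^sup>2)))) = (\<integral>z. expectation (\<lambda>\<omega>. f n \<omega> z) \<partial>G)" for n
  proof -
    have "complex_of_real (expectation (\<lambda>\<omega>. exp (- r * (\<Sum>k<d. (scaled_sum n (b k) \<omega>)\<^sup>2))))
       = expectation (\<lambda>\<omega>. complex_of_real (exp (- r * (\<Sum>k<d. (scaled_sum n (b k) \<omega>)\<^sup>2))))"
      by (rule integral_complex_of_real[symmetric])
    also have "\<dots> = expectation (\<lambda>\<omega>. \<integral>z. f n \<omega> z \<partial>G)"
      unfolding f_def G_def gauss_laplace[OF r] ..
    also have "\<dots> = (\<integral>z. expectation (\<lambda>\<omega>. f n \<omega> z) \<partial>G)"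
      by (rule P.Fubini_integral[OF int_f, symmetric])
    finally show ?thesis .
  qed
  have "(\<lambda>n. \<integral>z. expectation (\<lambda>\<omega>. f n \<omega> z) \<partial>G) \<longlonglongrightarrow> (\<integral>z. complex_of_real (exp (- r * (\<Sum>k<d. (z k)\<^sup>2))) \<partial>G)"
  proof (rule integral_dominated_convergence[where w="\<lambda>_. 1"])
    have "(\<lambda>z. \<Sum>k<d. (z k)\<^sup>2) \<in> borel_measurable G"
      using comp by (intro borel_measurable_sum borel_measurable_power) auto
    then show "(\<lambda>z. complex_of_real (exp (- r * (\<Sum>k<d. (z k)\<^sup>2)))) \<in> borel_measurable G" by measurable
    have "case_prod (\<lambda>z \<omega>. f n \<omega> z) \<in> borel_measurable (G \<Otimes>\<^sub>M M)" for n
      using measurable_compose[OF measurable_pair_swap' f_meas[of n]] by (simp add: case_prod_unfold)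
    then show "(\<lambda>z. expectation (\<lambda>\<omega>. f n \<omega> z)) \<in> borel_measurable G" for n
      by (rule borel_measurable_lebesgue_integral)
    show "AE z in G. norm (expectation (\<lambda>\<omega>. f n \<omega> z)) \<le> 1" for n
    proof (intro AE_I2)
      fix z
      have "norm (expectation (\<lambda>\<omega>. f n \<omega> z)) \<le> expectation (\<lambda>\<omega>. norm (f n \<omega> z))" by (rule integral_norm_bound)
      then show "norm (expectation (\<lambda>\<omega>. f n \<omega> z)) \<le> 1" by (simp add: norm_f prob_space)
    qed
    show "AE z in G. (\<lambda>n. expectation (\<lambda>\<omega>. f n \<omega> z)) \<longlonglongrightarrow> complex_of_real (exp (- r * (\<Sum>k<d. (z k)\<^sup>2)))"
    proof (intro AE_I2)
      fix z :: "nat \<Rightarrow> real"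
      \<comment> \<open>For fixed \<open>z\<close> the exponent is the scaled sum in the direction
        \<open>v\<close>. Orthonormality of \<open>b\<close> gives it the limiting variance 2 * r
        times the squared length of \<open>z\<close>, so the limit again has the form exp (- r * sum
        of squares), now in the Gaussian variable.\<close>
      define v where "v = (\<Sum>k<d. (sqrt (2 * r) * z k) *\<^sub>R b k)"
      have "f n \<omega> z = iexp (scaled_sum n v \<omega>)" for n \<omega> by (simp add: f_def v_def scaled_sum_linear mult_ac)
      moreover have "v \<bullet> (A *v v) = 2 * r * (\<Sum>k<d. (z k)\<^sup>2)"
      proof -
        have "A *v v = (\<Sum>k<d. (sqrt (2 * r) * z k) *\<^sub>R (A *v b k))"
          by (simp add: v_def linear_sum[OF matrix_vector_mul_linear] matrix_vector_mult_scaleR)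
        moreover have "b i \<bullet> (\<Sum>k<d. (sqrt (2 * r) * z k) *\<^sub>R (A *v b k)) = sqrt (2 * r) * z i" if "i < d" for i
        proof -
          have "b i \<bullet> (\<Sum>k<d. (sqrt (2 * r) * z k) *\<^sub>R (A *v b k)) = (\<Sum>k<d. if k = i then sqrt (2 * r) * z i else 0)"
            unfolding inner_sum_right using b that by (intro sum.cong) auto
          then show ?thesis using that by simp
        qed
        ultimately have "v \<bullet> (A *v v) = (\<Sum>i<d. (sqrt (2 * r) * z i) * (sqrt (2 * r) * z i))"
          by (subst v_def) (simp add: inner_sum_left)
        also have "\<dots> = (\<Sum>i<d. 2 * r * (z i)\<^sup>2)"
          using r by (intro sum.cong) (auto simp: power2_eq_square)
        finally show ?thesis by (simp add: sum_distrib_left)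
      qed
      ultimately show "(\<lambda>n. expectation (\<lambda>\<omega>. f n \<omega> z)) \<longlonglongrightarrow> complex_of_real (exp (- r * (\<Sum>k<d. (z k)\<^sup>2)))"
        using scaled_sum_char_limit[of v] by simp
    qed
  qed simp
  then have "(\<lambda>n. complex_of_real (expectation (\<lambda>\<omega>. exp (- r * (\<Sum>k<d. (scaled_sum n (b k) \<omega>)\<^sup>2)))))
      \<longlonglongrightarrow> complex_of_real (\<integral>z. exp (- r * (\<Sum>k<d. (z k)\<^sup>2)) \<partial>G)"
    unfolding lhs by (simp only: integral_complex_of_real)
  then show ?thesis unfolding tendsto_of_real_iff G_def .
qed

lemma quadratic_weak_conv:
  fixes b :: "nat \<Rightarrow> real^'d"
  assumes b: "\<And>i j. i < d \<Longrightarrow> j < d \<Longrightarrow> b i \<bullet> (A *v b j) = (if i = j then 1 else 0)"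
  shows "real_distribution (chi_squared d)"
    "weak_conv_m (\<lambda>n. distr M borel (\<lambda>\<omega>. \<Sum>k<d. (scaled_sum n (b k) \<omega>)\<^sup>2)) (chi_squared d)"
proof -
  define G where "G = PiM {..<d} (\<lambda>_::nat. std_normal_distribution)"
  interpret N: real_distribution std_normal_distribution by (rule real_dist_normal_dist)
  interpret G: prob_space G unfolding G_def by (rule prob_space_PiM) (rule N.prob_space_axioms)
  have "(\<lambda>z. z k) \<in> borel_measurable G" if "k < d" for k
    unfolding G_def using measurable_component_singleton[of k "{..<d}" "\<lambda>_. std_normal_distribution"] that by simp
  then have [measurable]: "(\<lambda>z. \<Sum>k<d. (z k)\<^sup>2) \<in> borel_measurable G"
    by (intro borel_measurable_sum borel_measurable_power) auto
  have chi: "chi_squared d = distr G borel (\<lambda>z. \<Sum>k<d. (z k)\<^sup>2)" by (simp add: chi_squared_def G_def)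
  show rd: "real_distribution (chi_squared d)" unfolding chi by (rule G.real_distribution_distr) simp
  have pw: "exp (- x) ^ k = exp (- real k * x)" for x :: real and k by (simp add: exp_of_nat_mult[symmetric])
  show "weak_conv_m (\<lambda>n. distr M borel (\<lambda>\<omega>. \<Sum>k<d. (scaled_sum n (b k) \<omega>)\<^sup>2)) (chi_squared d)"
  proof (rule laplace_imp_weak_conv[OF _ _ rd])
    show "real_distribution (distr M borel (\<lambda>\<omega>. \<Sum>k<d. (scaled_sum n (b k) \<omega>)\<^sup>2))" for n
      by (rule real_distribution_distr) simp
    show "AE x in distr M borel (\<lambda>\<omega>. \<Sum>k<d. (scaled_sum n (b k) \<omega>)\<^sup>2). 0 \<le> x" for n
      by (subst AE_distr_iff) (auto intro!: sum_nonneg)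
    show "AE x in chi_squared d. 0 \<le> x"
      unfolding chi by (subst AE_distr_iff) (auto intro!: sum_nonneg)
    show "(\<lambda>n. \<integral>x. exp (- x) ^ k \<partial>distr M borel (\<lambda>\<omega>. \<Sum>k<d. (scaled_sum n (b k) \<omega>)\<^sup>2)) \<longlonglongrightarrow> (\<integral>x. exp (- x) ^ k \<partial>chi_squared d)" for k
      using quadratic_laplace_limit[OF b, of d "real k"]
      unfolding pw chi by (simp add: integral_distr G_def[symmetric])
  qed
qed

end

section \<open>The distributed estimator\<close>

text \<open>One factor of the cube is bounded by \<open>b\<close>, and the mean of the remaining
  squares is the trace of the empirical covariance. Third moments are thereby controlled on every
  machine by bounds already uniform over the machines.\<close>

lemma mom3_le_emp_cov:
  fixes x :: "nat \<Rightarrow> real^'d"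
  assumes b: "\<And>j. j < n \<Longrightarrow> norm (x j - mu) \<le> b"
  shows "mom3 n x mu \<le> b * (real CARD('d) * norm (emp_cov n x mu))"
proof (cases "n = 0")
  case False
  then have b0: "0 \<le> b" using b[of 0] norm_ge_zero[of "x 0 - mu"] by linarith
  have "mom3 n x mu \<le> (1 / real n) * (\<Sum>j<n. b * (norm (x j - mu))\<^sup>2)"
    unfolding mom3_def power3_eq_cube power2_eq_square mult.assoc using b
    by (intro mult_left_mono sum_mono mult_right_mono) auto
  also have "\<dots> = b * (\<Sum>k\<in>UNIV. emp_cov n x mu $ k $ k)"
  proof -
    have "(\<Sum>k\<in>UNIV. emp_cov n x mu $ k $ k) = (1 / real n) * (\<Sum>k\<in>UNIV. \<Sum>j<n. (x j $ k - mu $ k)\<^sup>2)"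
      by (simp add: emp_cov_def sum_distrib_left power2_eq_square)
    also have "(\<Sum>k\<in>UNIV. \<Sum>j<n. (x j $ k - mu $ k)\<^sup>2) = (\<Sum>j<n. (norm (x j - mu))\<^sup>2)"
      by (subst sum.swap) (simp add: norm_sq_cart)
    finally show ?thesis by (simp add: sum_distrib_left[symmetric])
  qed
  also have "\<dots> \<le> b * (\<Sum>k\<in>(UNIV::'d set). norm (emp_cov n x mu))"
  proof (intro mult_left_mono sum_mono b0)
    fix k
    have "emp_cov n x mu $ k $ k \<le> norm (emp_cov n x mu $ k)" using component_le_norm_cart[of "emp_cov n x mu $ k" k] by simp
    also have "\<dots> \<le> norm (emp_cov n x mu)" by (rule Finite_Cartesian_Product.norm_nth_le)
    finally show "emp_cov n x mu $ k $ k \<le> norm (emp_cov n x mu)" .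
  qed
  finally show ?thesis by simp
next
  case True
  then have "emp_cov n x mu = 0" by (simp add: emp_cov_def vec_eq_iff)
  then show ?thesis using True by (simp add: mom3_def)
qed

lemma powr_minus_half:
  fixes x :: real
  assumes "0 \<le> x" shows "x powr - (1 / 2) = 1 / sqrt x"
  using assms by (simp add: powr_minus_divide powr_half_sqrt)

text \<open>Since floor x + 1 exceeds x, the hypothesis gives ln K <= T * ln n, that is K <= n ^ T.
  The bound 1 <= T matters when K < n: the gain over the initial rate comes from a round.\<close>

lemma rounds_suffice:
  assumes n: "2 \<le> n" and K: "1 \<le> K" and T: "of_int \<lfloor>ln (real K) / ln (real n)\<rfloor> + 1 \<le> real T"
  shows "1 \<le> T" "(1 / sqrt (real n)) ^ T \<le> 1 / sqrt (real K)"
proof -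
  have l: "0 < ln (real n)" "0 \<le> ln (real K)" using n K by auto
  then have "0 \<le> ln (real K) / ln (real n)" by simp
  then have "0 \<le> \<lfloor>ln (real K) / ln (real n)\<rfloor>" by simp
  then show "1 \<le> T" using T by linarith
  have "ln (real K) / ln (real n) \<le> real T" using T by linarith
  then have "ln (real K) \<le> real T * ln (real n)" using l by (simp add: field_simps)
  also have "\<dots> = ln (real n ^ T)" using n by (simp add: ln_realpow)
  finally have "real K \<le> real n ^ T" using n K by simp
  then have "sqrt (real K) \<le> sqrt (real n) ^ T" by (metis real_sqrt_le_mono real_sqrt_power)
  then show "(1 / sqrt (real n)) ^ T \<le> 1 / sqrt (real K)"
    using n K by (simp add: power_divide frac_le)
qed

section \<open>From bounds on one event to the rate of the estimator\<close>

locale distributed_el = iid_array M Dist X mu0 beta K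
  for M :: "'a measure" and Dist :: "(real^'d) measure" and X mu0 beta K +
  fixes c :: real and T :: "nat \<Rightarrow> nat"
    and lamstar :: "nat \<Rightarrow> 'a \<Rightarrow> real^'d"
    and lam :: "nat \<Rightarrow> nat \<Rightarrow> 'a \<Rightarrow> real^'d"
    and loc :: "nat \<Rightarrow> nat \<Rightarrow> nat \<Rightarrow> 'a \<Rightarrow> real^'d"
  assumes c: "0 < c" and coer: "\<And>v. c * (norm v)\<^sup>2 \<le> v \<bullet> (A *v v)"
    and lamstar_rv[measurable]: "\<And>n. lamstar n \<in> borel_measurable M"
    and lamstar_def: "\<And>n \<omega>. \<omega> \<in> space M \<Longrightarrow>
        is_argmin (g_glob (K n) n (Y n \<omega>) mu0) (dom_g (K n) n (Y n \<omega>) mu0) (lamstar n \<omega>)"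
    and lam_rv[measurable]: "\<And>n t. lam n t \<in> borel_measurable M"
    and loc_def: "\<And>n t i \<omega>. \<omega> \<in> space M \<Longrightarrow> t < T n \<Longrightarrow> i < K n \<Longrightarrow>
        is_argmin (surrogate (K n) n (Y n \<omega>) mu0 i (lam n t \<omega>))
                  (dom_gi n (\<lambda>j. X n i j \<omega>) mu0) (loc n (Suc t) i \<omega>)"
    and lam_step: "\<And>n t \<omega>. \<omega> \<in> space M \<Longrightarrow> t < T n \<Longrightarrow>
        lam n (Suc t) \<omega> = (1 / real (K n)) *\<^sub>R (\<Sum>i<K n. loc n (Suc t) i \<omega>)"
    and init: "bigO_p M (\<lambda>n \<omega>. norm (lam n 0 \<omega> - lamstar n \<omega>)) (\<lambda>n. real n powr (-1/2))"
    and T_ge: "\<And>n. real (T n) \<ge> of_int \<lfloor>ln (real (K n)) / ln (real n)\<rfloor> + 1"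
begin

definition good :: "real \<Rightarrow> real \<Rightarrow> nat \<Rightarrow> 'a \<Rightarrow> bool" where
  "good C eta n \<omega> \<longleftrightarrow> norm (lam n 0 \<omega> - lamstar n \<omega>) \<le> C / sqrt (real n)
     \<and> norm (grad_g (K n) n (Y n \<omega>) mu0 0) \<le> C / sqrt (real (n * K n))
     \<and> (1 / real (K n)) * (\<Sum>i<K n. (norm (S n i \<omega> - A))\<^sup>2) \<le> C / real n
     \<and> (1 / real (K n)) * (\<Sum>i<K n. mom3 n (Y n \<omega> i) mu0) \<le> C
     \<and> (\<forall>i<K n. norm (S n i \<omega> - A) \<le> eta)
     \<and> (\<forall>i<K n. \<forall>j<n. norm (X n i j \<omega> - mu0) \<le> eta * sqrt (real n))"

lemma init_bound:
  assumes "0 < e"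
  shows "\<exists>C>0. evt_prob M e (\<lambda>n \<omega>. norm (lam n 0 \<omega> - lamstar n \<omega>) \<le> C / sqrt (real n))"
proof -
  obtain C where C: "\<forall>\<^sub>F n in sequentially. prob {\<omega>\<in>space M. C * real n powr (-1/2) < \<bar>norm (lam n 0 \<omega> - lamstar n \<omega>)\<bar>} < e"
    using init assms unfolding bigO_p_def by blast
  \<comment> \<open>The constant in \<open>bigO_p\<close> may be negative; the absolute value plus 1
    is a larger, positive one.\<close>
  have "evt_prob M e (\<lambda>n \<omega>. norm (lam n 0 \<omega> - lamstar n \<omega>) \<le> (\<bar>C\<bar> + 1) / sqrt (real n))"
    unfolding evt_prob_def using C eventually_gt_at_top[of 0]
  proof eventually_elim
    case (elim n)
    show ?case
    proof (intro bexI[of _ "{\<omega>\<in>space M. C * real n powr (-1/2) < \<bar>norm (lam n 0 \<omega> - lamstar n \<omega>)\<bar>}"] conjI subsetI)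
      fix \<omega> assume "\<omega> \<in> {\<omega>\<in>space M. \<not> norm (lam n 0 \<omega> - lamstar n \<omega>) \<le> (\<bar>C\<bar> + 1) / sqrt (real n)}"
      then have \<omega>: "\<omega> \<in> space M" "(\<bar>C\<bar> + 1) / sqrt (real n) < norm (lam n 0 \<omega> - lamstar n \<omega>)" by auto
      have "C / sqrt (real n) \<le> (\<bar>C\<bar> + 1) / sqrt (real n)" by (intro divide_right_mono) auto
      then show "\<omega> \<in> {\<omega>\<in>space M. C * real n powr (-1/2) < \<bar>norm (lam n 0 \<omega> - lamstar n \<omega>)\<bar>}"
        using \<omega> by (simp add: powr_minus_half)
    qed (use elim in auto)
  qed
  then show ?thesis by (intro exI[of _ "\<bar>C\<bar> + 1"]) auto
qed

lemma good_prob: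
  assumes e: "0 < e"
  shows "\<exists>C>0. \<forall>eta>0. evt_prob M e (good C eta)"
proof -
  let ?e = "e / 6"
  have e6: "0 < ?e" using e by simp
  obtain C1 where C1: "C1 > 0" "evt_prob M ?e (\<lambda>n \<omega>. norm (lam n 0 \<omega> - lamstar n \<omega>) \<le> C1 / sqrt (real n))"
    using init_bound[OF e6] by blast
  obtain C2 where C2: "C2 > 0" "evt_prob M ?e (\<lambda>n \<omega>. norm (grad_g (K n) n (Y n \<omega>) mu0 0) \<le> C2 / sqrt (real (n * K n)))"
    using grad_zero_bound[OF e6] by blast
  obtain C3 where C3: "C3 > 0" "evt_prob M ?e (\<lambda>n \<omega>. (1 / real (K n)) * (\<Sum>i<K n. (norm (S n i \<omega> - A))\<^sup>2) \<le> C3 * (1 / real n))"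
    using avg_cov_square[OF e6] by blast
  obtain C4 where C4: "C4 > 0" "evt_prob M ?e (\<lambda>n \<omega>. (1 / real (K n)) * (\<Sum>i<K n. mom3 n (Y n \<omega> i) mu0) \<le> C4)"
    using avg_mom3[OF e6] by blast
  define C where "C = C1 + C2 + C3 + C4"
  have C: "0 < C" "C1 \<le> C" "C2 \<le> C" "C3 \<le> C" "C4 \<le> C" using C1 C2 C3 C4 by (auto simp: C_def)
  have "evt_prob M e (good C eta)" if "0 < eta" for eta
  proof -
    have C5: "evt_prob M ?e (\<lambda>n \<omega>. \<forall>i<K n. norm (S n i \<omega> - A) \<le> eta)"
      using cov_close[OF that] e6 unfolding whp_def by blast
    have C6: "evt_prob M ?e (\<lambda>n \<omega>. \<forall>i<K n. \<forall>j<n. norm (X n i j \<omega> - mu0) \<le> eta * sqrt (real n))"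
      using max_small[OF that] e6 unfolding whp_def by blast
    have le: "a / s \<le> C / s" if "a \<le> C" "0 \<le> s" for a s :: real
      using that by (rule divide_right_mono)
    have sum_e: "?e + (?e + (?e + (?e + (?e + ?e)))) = e" by simp
    note conj = evt_prob_conj[OF C1(2) evt_prob_conj[OF C2(2) evt_prob_conj[OF C3(2) evt_prob_conj[OF C4(2) evt_prob_conj[OF C5 C6]]]]]
    show ?thesis
      unfolding good_def
    proof (rule evt_prob_mono[OF conj[unfolded sum_e]], intro always_eventually allI ballI impI, elim conjE, intro conjI)
      fix n \<omega>
      show "norm (lam n 0 \<omega> - lamstar n \<omega>) \<le> C / sqrt (real n)"
        if "norm (lam n 0 \<omega> - lamstar n \<omega>) \<le> C1 / sqrt (real n)"
        using that le[OF C(2), of "sqrt (real n)"] by simp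
      show "norm (grad_g (K n) n (Y n \<omega>) mu0 0) \<le> C / sqrt (real (n * K n))"
        if "norm (grad_g (K n) n (Y n \<omega>) mu0 0) \<le> C2 / sqrt (real (n * K n))"
        using that le[OF C(3), of "sqrt (real (n * K n))"] by simp
      show "(1 / real (K n)) * (\<Sum>i<K n. (norm (S n i \<omega> - A))\<^sup>2) \<le> C / real n"
        if "(1 / real (K n)) * (\<Sum>i<K n. (norm (S n i \<omega> - A))\<^sup>2) \<le> C3 * (1 / real n)"
        using that le[OF C(4), of "real n"] by simp
      show "(1 / real (K n)) * (\<Sum>i<K n. mom3 n (Y n \<omega> i) mu0) \<le> C"
        if "(1 / real (K n)) * (\<Sum>i<K n. mom3 n (Y n \<omega> i) mu0) \<le> C4"
        using that C(5) by linarith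
    qed
  qed
  then show ?thesis using C by blast
qed

text \<open>\<open>E\<close> and \<open>eta0\<close> depend on \<open>C\<close> but not on
  \<open>eta\<close>, so the factor \<open>eta\<close> in the last bound can be made small
  afterwards. It survives because each round contracts by a multiple of eta / sqrt n and at least
  one round is run.\<close>

lemma good_imp:
  assumes C: "0 < C"
  shows "\<exists>E>0. \<exists>eta0>0. \<forall>eta. 0 < eta \<longrightarrow> eta \<le> eta0 \<longrightarrow>
     (\<forall>\<^sub>F n in sequentially. \<forall>\<omega>\<in>space M. good C eta n \<omega> \<longrightarrow>
        norm (lamstar n \<omega>) \<le> E / sqrt (real (n * K n)) \<and> grad_g (K n) n (Y n \<omega>) mu0 (lamstar n \<omega>) = 0
        \<and> norm (lam n (T n) \<omega> - lamstar n \<omega>) \<le> E * eta / sqrt (real (n * K n)))"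
proof -
  \<comment> \<open>\<open>R\<close> / sqrt N is the radius for \<open>lamstar\<close>, where 19 >
    18 meets \<open>global_argmin\<close>; \<open>H\<close> / sqrt n bounds both
    \<open>lamstar\<close> and the initial error; \<open>D\<close> bounds the trace factor in
    \<open>mom3_le_emp_cov\<close>; E1 * eta bounds every q i; E2 * eta / sqrt n is the contraction
    factor. In \<open>eta0\<close>, 1 / (16 * H) keeps B * norm z <= 1/8 for B = 2 * H / sqrt n, and
    the other entries give norm S <= norm A + 1, the c / 2 of \<open>global_argmin\<close>, q i <= c
    / 40 and rho <= 1.\<close>
  define R where "R = 19 * C / c"
  define H where "H = C + R"
  define D where "D = real CARD('d) * (norm A + 1)"
  define E1 where "E1 = 1 + 20 * H * D"
  define E2 where "E2 = 4 / c\<^sup>2 * (2 + 40 * E1 * H * C)"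
  define E where "E = R + E2 * C"
  define eta0 where "eta0 = min 1 (min (c / 2) (min (1 / (16 * H)) (min (c / (40 * E1)) (1 / E2))))"
  have R: "0 < R" using C c by (simp add: R_def)
  have H: "0 < H" "C \<le> H" "R \<le> H" using C R by (auto simp: H_def)
  have D: "0 < D" by (simp add: D_def add_nonneg_pos)
  have E1: "0 < E1" using H D by (simp add: E1_def add_pos_nonneg)
  have E2: "0 < E2" using E1 H C c by (simp add: E2_def add_pos_nonneg)
  have E: "0 < E" "R \<le> E" "E2 * C \<le> E" using R E2 C by (auto simp: E_def add_pos_nonneg)
  have eta0: "0 < eta0" using c H E1 E2 by (simp add: eta0_def)
  have main: "norm (lamstar n \<omega>) \<le> E / sqrt (real (n * K n)) \<and> grad_g (K n) n (Y n \<omega>) mu0 (lamstar n \<omega>) = 0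
        \<and> norm (lam n (T n) \<omega> - lamstar n \<omega>) \<le> E * eta / sqrt (real (n * K n))"
    if eta: "0 < eta" "eta \<le> eta0" and n: "2 \<le> n" "C \<le> eta * sqrt (real n)"
      and \<omega>: "\<omega> \<in> space M" and g: "good C eta n \<omega>" for eta n \<omega>
  proof -
    have eta_le: "eta \<le> 1" "eta \<le> c / 2" "eta * (16 * H) \<le> 1" "E1 * eta \<le> c / 40" "E2 * eta \<le> 1"
      using eta H E1 E2 by (auto simp: eta0_def field_simps)
    define s where "s = sqrt (real n)"
    define N where "N = real (n * K n)"
    have s: "0 < s" "s * s = real n" using n by (auto simp: s_def)
    have K0: "0 < K n" using K_pos[of n] by simp
    have n0: "0 < n" using n by simp
    have "n * 1 \<le> n * K n" using K0 by (intro mult_le_mono) auto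
    then have nN: "real n \<le> N" by (simp only: N_def of_nat_le_iff)
    then have sN: "s \<le> sqrt N" "0 < sqrt N" "sqrt N = s * sqrt (real (K n))"
      using n by (auto simp: s_def N_def real_sqrt_mult)
    have g1: "norm (lam n 0 \<omega> - lamstar n \<omega>) \<le> C / s"
      and g2: "norm (grad_g (K n) n (Y n \<omega>) mu0 0) \<le> C / sqrt N"
      and g3: "(1 / real (K n)) * (\<Sum>i<K n. (norm (S n i \<omega> - A))\<^sup>2) \<le> C / real n"
      and g4: "(1 / real (K n)) * (\<Sum>i<K n. mom3 n (Y n \<omega> i) mu0) \<le> C"
      and g5: "\<And>i. i < K n \<Longrightarrow> norm (S n i \<omega> - A) \<le> eta"
      and g6: "\<And>i j. i < K n \<Longrightarrow> j < n \<Longrightarrow> norm (X n i j \<omega> - mu0) \<le> eta * s"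
      using g by (auto simp: good_def s_def N_def)
    have Hs: "H / s * norm (X n i j \<omega> - mu0) \<le> 1 / 16" if "i < K n" "j < n" for i j
    proof -
      have "H / s * norm (X n i j \<omega> - mu0) \<le> H / s * (eta * s)" using g6[OF that] H s by (intro mult_left_mono) auto
      also have "\<dots> = H * eta" using s by simp
      also have "\<dots> \<le> 1 / 16" using eta_le(3) by (simp add: mult_ac)
      finally show ?thesis .
    qed
    have RN: "R / sqrt N \<le> H / s" using R H sN s by (intro frac_le) auto
    have ls: "norm (lamstar n \<omega>) < R / sqrt N" "grad_g (K n) n (Y n \<omega>) mu0 (lamstar n \<omega>) = 0"
    proof -
      have "R / sqrt N * norm (X n i j \<omega> - mu0) \<le> 1 / 8" if "i < K n" "j < n" for i j
      proof -
        have "R / sqrt N * norm (X n i j \<omega> - mu0) \<le> H / s * norm (X n i j \<omega> - mu0)"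
          using RN by (intro mult_right_mono) auto
        then show ?thesis using Hs[OF that] by linarith
      qed
      moreover have "18 * norm (grad_g (K n) n (Y n \<omega>) mu0 0) < c * (R / sqrt N)"
      proof -
        have "18 * norm (grad_g (K n) n (Y n \<omega>) mu0 0) \<le> 18 * (C / sqrt N)" using g2 by linarith
        also have "\<dots> < 19 * C / sqrt N" using C sN by (simp add: divide_strict_right_mono)
        also have "\<dots> = c * (R / sqrt N)" using c by (simp add: R_def)
        finally show ?thesis .
      qed
      moreover have "norm (S n i \<omega> - A) \<le> c / 2" if "i < K n" for i using g5[OF that] eta_le by simp
      moreover have "0 < R / sqrt N" using R sN by simp
      ultimately show "norm (lamstar n \<omega>) < R / sqrt N" "grad_g (K n) n (Y n \<omega>) mu0 (lamstar n \<omega>) = 0"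
        using global_argmin[OF K0 n0 c coer, of "R / sqrt N" "Y n \<omega>" mu0 "lamstar n \<omega>"] lamstar_def[OF \<omega>]
        by blast+
    qed
    define B where "B = 2 * H / s"
    have B: "0 < B" "B / 2 = H / s" using H s by (auto simp: B_def)
    define q where "q i = norm (S n i \<omega> - A) + 10 * B * mom3 n (Y n \<omega> i) mu0" for i
    define rr where "rr i = 10 * B * mom3 n (Y n \<omega> i) mu0" for i
    have rr0: "0 \<le> rr i" for i
      unfolding rr_def using B(1) by (intro mult_nonneg_nonneg mom3_nonneg) auto
    \<comment> \<open>The bound eta * s on the observations cancels the 1 / s in \<open>B\<close>,
      so the nonlinear part of q i is of order eta on every machine.\<close>
    have rr: "rr i \<le> 20 * H * D * eta" if i: "i < K n" for i
    proof -
      have "norm (S n i \<omega>) \<le> norm A + 1"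
        using norm_triangle_ineq[of "S n i \<omega> - A" A] g5[OF i] eta_le by simp
      then have "real CARD('d) * norm (S n i \<omega>) \<le> D" unfolding D_def by (intro mult_left_mono) auto
      then have "eta * s * (real CARD('d) * norm (S n i \<omega>)) \<le> eta * s * D"
        using eta s by (intro mult_left_mono) auto
      with mom3_le_emp_cov[of n "Y n \<omega> i" mu0 "eta * s"] g6[OF i]
      have "mom3 n (Y n \<omega> i) mu0 \<le> eta * s * D" by fastforce
      then have "rr i \<le> 10 * B * (eta * s * D)" unfolding rr_def using B by (intro mult_left_mono) auto
      also have "\<dots> = 20 * H * D * eta" using s by (simp add: B_def)
      finally show ?thesis .
    qed
    have q_le: "q i \<le> c / 40" if "i < K n" for i
      using g5[OF that] rr[OF that] eta_le by (simp add: q_def rr_def E1_def algebra_simps)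
    have avg: "(1 / real (K n)) * (\<Sum>i<K n. (q i)\<^sup>2) \<le> (2 + 40 * E1 * H * C) * (eta / s)"
    proof -
      have "(q i)\<^sup>2 \<le> 2 * (norm (S n i \<omega> - A))\<^sup>2 + 20 * E1 * eta * B * mom3 n (Y n \<omega> i) mu0" if i: "i < K n" for i
      proof -
        have "(q i)\<^sup>2 \<le> 2 * (norm (S n i \<omega> - A))\<^sup>2 + 2 * (rr i)\<^sup>2"
          using sum_squares_bound[of "norm (S n i \<omega> - A)" "rr i"]
          by (simp add: q_def rr_def[symmetric] power2_sum)
        \<comment> \<open>One factor is bounded uniformly by a multiple of eta; the other keeps its
          1 / s and the third moment, which is bounded on average. This yields eta / s instead of
          eta^2.\<close>
        also have "(rr i)\<^sup>2 \<le> (E1 * eta) * rr i"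
          unfolding power2_eq_square using rr[OF i] rr0[of i] eta
          by (intro mult_right_mono) (auto simp: E1_def algebra_simps)
        finally show ?thesis by (simp add: rr_def mult_ac)
      qed
      then have "(1 / real (K n)) * (\<Sum>i<K n. (q i)\<^sup>2)
        \<le> (1 / real (K n)) * (\<Sum>i<K n. 2 * (norm (S n i \<omega> - A))\<^sup>2 + 20 * E1 * eta * B * mom3 n (Y n \<omega> i) mu0)"
        by (intro mult_left_mono sum_mono) auto
      also have "\<dots> = 2 * ((1 / real (K n)) * (\<Sum>i<K n. (norm (S n i \<omega> - A))\<^sup>2))
          + 20 * E1 * eta * B * ((1 / real (K n)) * (\<Sum>i<K n. mom3 n (Y n \<omega> i) mu0))"
        by (simp add: sum.distrib sum_distrib_left[symmetric] add_divide_distrib)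
      also have "\<dots> \<le> 2 * (C / real n) + 20 * E1 * eta * B * C"
        using E1 eta(1) B(1) by (intro add_mono mult_left_mono g3 g4 mult_nonneg_nonneg) auto
      \<comment> \<open>The mean-square rate 1 / n is better than required: C <= eta * sqrt n turns
        it into eta / s.\<close>
      also have "C / real n \<le> eta / s"
      proof -
        have "C / real n = C / s / s" using s by (simp add: field_simps)
        also have "\<dots> \<le> eta / s" using n s by (intro divide_right_mono) (auto simp: s_def field_simps)
        finally show ?thesis .
      qed
      finally show ?thesis by (simp add: B_def algebra_simps)
    qed
    define rho where "rho = E2 * (eta / s)"
    have s1: "1 \<le> s" using n by (simp add: s_def)
    have rho: "0 \<le> rho" "rho \<le> 1" "4 / c\<^sup>2 * ((1 / real (K n)) * (\<Sum>i<K n. (q i)\<^sup>2)) \<le> rho"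
    proof -
      show "0 \<le> rho" using E2 eta s by (simp add: rho_def)
      have "rho \<le> E2 * (eta / 1)" unfolding rho_def using E2 eta s1 by (intro mult_left_mono frac_le) auto
      then show "rho \<le> 1" using eta_le by simp
      have "4 / c\<^sup>2 * ((1 / real (K n)) * (\<Sum>i<K n. (q i)\<^sup>2)) \<le> 4 / c\<^sup>2 * ((2 + 40 * E1 * H * C) * (eta / s))"
        by (intro mult_left_mono avg) auto
      also have "\<dots> = rho" by (simp add: rho_def E2_def)
      finally show "4 / c\<^sup>2 * ((1 / real (K n)) * (\<Sum>i<K n. (q i)\<^sup>2)) \<le> rho" .
    qed
    have ls2: "norm (lamstar n \<omega>) \<le> B / 2" using ls(1) RN B(2) by linarith
    have l0: "norm (lam n 0 \<omega> - lamstar n \<omega>) \<le> B / 2"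
      using g1 divide_right_mono[OF H(2), of s] s(1) B(2) by linarith
    have Bz: "B * norm (X n i j \<omega> - mu0) \<le> 1 / 8" if "i < K n" "j < n" for i j
    proof -
      have "B * norm (X n i j \<omega> - mu0) = 2 * (H / s * norm (X n i j \<omega> - mu0))" by (simp add: B_def)
      then show ?thesis using Hs[OF that] by linarith
    qed
    have "norm (lam n (T n) \<omega> - lamstar n \<omega>) \<le> rho ^ T n * norm (lam n 0 \<omega> - lamstar n \<omega>)"
      by (rule iterated_contraction[where Y="Y n \<omega>" and l="\<lambda>t. lam n t \<omega>" and q=q
            and loc="\<lambda>t i. loc n t i \<omega>",
            OF K0 n0 c coer B(1) Bz ls2 l0 ls(2) q_def q_le rho(3) rho(2)
              loc_def[OF \<omega>] lam_step[OF \<omega>]])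
    also have "\<dots> \<le> (E2 * eta / sqrt (real (K n))) * (C / s)"
    proof (intro mult_mono g1)
      note r = rounds_suffice[OF n(1) K_pos T_ge]
      have "rho ^ T n = (E2 * eta) ^ T n * (1 / s) ^ T n" by (simp add: rho_def power_mult_distrib[symmetric])
      also have "\<dots> \<le> (E2 * eta) * (1 / sqrt (real (K n)))"
      proof (intro mult_mono)
        \<comment> \<open>As E2 * eta <= 1, all but one of its powers may be dropped; the powers of
          1 / s are kept, because they compensate for sqrt K.\<close>
        have "(E2 * eta) ^ T n \<le> (E2 * eta) ^ 1" using r(1) E2 eta eta_le by (intro power_decreasing) auto
        then show "(E2 * eta) ^ T n \<le> E2 * eta" by simp
        show "(1 / s) ^ T n \<le> 1 / sqrt (real (K n))" using r(2) by (simp add: s_def)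
      qed (use E2 eta s in auto)
      finally show "rho ^ T n \<le> E2 * eta / sqrt (real (K n))" by simp
    qed (use E2 eta in auto)
    also have "\<dots> = E2 * C * (eta / sqrt N)" by (simp add: sN(3) mult_ac)
    also have "\<dots> \<le> E * (eta / sqrt N)" using E eta sN by (intro mult_right_mono) auto
    finally have fin: "norm (lam n (T n) \<omega> - lamstar n \<omega>) \<le> E * eta / sqrt N" by simp
    have "norm (lamstar n \<omega>) \<le> E / sqrt N" using ls(1) divide_right_mono[OF E(2), of "sqrt N"] sN(2) by linarith
    then show ?thesis using ls fin by (simp add: N_def)
  qed
  have ev: "\<forall>\<^sub>F n in sequentially. 2 \<le> n \<and> C \<le> eta * sqrt (real n)" if "0 < eta" for eta
  proof -
    have "filterlim (\<lambda>n. eta * sqrt (real n)) at_top sequentially" using that by real_asymp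
    then have "\<forall>\<^sub>F n in sequentially. C \<le> eta * sqrt (real n)" by (simp add: filterlim_at_top)
    then show ?thesis using eventually_ge_at_top[of 2] by eventually_elim simp
  qed
  show ?thesis
  proof (rule exI[of _ E], rule conjI[OF E(1)], rule exI[of _ eta0], rule conjI[OF eta0], intro allI impI)
    fix eta assume eta: "0 < eta" "eta \<le> eta0"
    from ev[OF eta(1)] show "\<forall>\<^sub>F n in sequentially. \<forall>\<omega>\<in>space M. good C eta n \<omega> \<longrightarrow>
        norm (lamstar n \<omega>) \<le> E / sqrt (real (n * K n)) \<and> grad_g (K n) n (Y n \<omega>) mu0 (lamstar n \<omega>) = 0
        \<and> norm (lam n (T n) \<omega> - lamstar n \<omega>) \<le> E * eta / sqrt (real (n * K n))"
      by (rule eventually_mono) (use main[OF eta] in blast)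
  qed
qed

lemma error_whp:
  assumes d: "0 < d"
  shows "whp M (\<lambda>n \<omega>. norm (lam n (T n) \<omega> - lamstar n \<omega>) \<le> d / sqrt (real (n * K n)))"
  unfolding whp_def
proof (intro allI impI)
  fix e :: real assume "0 < e"
  then obtain C where C: "C > 0" "\<And>eta. 0 < eta \<Longrightarrow> evt_prob M e (good C eta)" using good_prob by blast
  obtain E eta0 where E: "0 < E" "0 < eta0" and imp: "\<And>eta. 0 < eta \<Longrightarrow> eta \<le> eta0 \<Longrightarrow>
     (\<forall>\<^sub>F n in sequentially. \<forall>\<omega>\<in>space M. good C eta n \<omega> \<longrightarrow>
        norm (lamstar n \<omega>) \<le> E / sqrt (real (n * K n)) \<and> grad_g (K n) n (Y n \<omega>) mu0 (lamstar n \<omega>) = 0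
        \<and> norm (lam n (T n) \<omega> - lamstar n \<omega>) \<le> E * eta / sqrt (real (n * K n)))"
    using good_imp[OF C(1)] by blast
  define eta where "eta = min eta0 (d / E)"
  have eta: "0 < eta" "eta \<le> eta0" "E * eta \<le> d" using E d by (auto simp: eta_def min_def field_simps)
  have le: "E * eta / sqrt (real (n * K n)) \<le> d / sqrt (real (n * K n))" for n
    using eta by (intro divide_right_mono) auto
  show "evt_prob M e (\<lambda>n \<omega>. norm (lam n (T n) \<omega> - lamstar n \<omega>) \<le> d / sqrt (real (n * K n)))"
    by (rule evt_prob_mono[OF C(2)[OF eta(1)]], rule eventually_mono[OF imp[OF eta(1,2)]])
       (use order_trans[OF _ le] in blast)
qed

lemma estimator_rate:
  "smallo_p M (\<lambda>n \<omega>. norm (lam n (T n) \<omega> - lamstar n \<omega>)) (\<lambda>n. real (n * K n) powr (-1/2))"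
  unfolding smallo_p_def
proof (intro allI impI, rule tendstoI)
  fix d e :: real assume d: "0 < d" and e: "0 < e"
  have "evt_prob M e (\<lambda>n \<omega>. norm (lam n (T n) \<omega> - lamstar n \<omega>) \<le> d / sqrt (real (n * K n)))"
    using error_whp[OF d] e unfolding whp_def by blast
  then show "\<forall>\<^sub>F n in sequentially. dist (prob {\<omega>\<in>space M. d * real (n * K n) powr (-1/2) < \<bar>norm (lam n (T n) \<omega> - lamstar n \<omega>)\<bar>}) 0 < e"
    unfolding evt_prob_def
  proof eventually_elim
    case (elim n)
    then obtain B where B: "B \<in> events" "{\<omega>\<in>space M. \<not> norm (lam n (T n) \<omega> - lamstar n \<omega>) \<le> d / sqrt (real (n * K n))} \<subseteq> B" "prob B < e"
      by blast
    have "prob {\<omega>\<in>space M. d * real (n * K n) powr (-1/2) < \<bar>norm (lam n (T n) \<omega> - lamstar n \<omega>)\<bar>} \<le> prob B"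
      using B by (intro finite_measure_mono) (auto simp: powr_minus_half not_le)
    then show ?case using B by simp
  qed
qed

lemma quadratic_form_eq:
  assumes b: "\<And>w. A *v (\<Sum>i<CARD('d). (b i \<bullet> w) *\<^sub>R b i) = w"
  obtains x where "A *v x = - grad_g (K n) n (Y n \<omega>) mu0 0"
    "real (n * K n) * (x \<bullet> (A *v x)) = (\<Sum>k<CARD('d). (scaled_sum n (b k) \<omega>)\<^sup>2)"
proof -
  define w where "w = - grad_g (K n) n (Y n \<omega>) mu0 0"
  define x where "x = (\<Sum>i<CARD('d). (b i \<bullet> w) *\<^sub>R b i)"
  have x: "A *v x = w" by (simp add: x_def b)
  have bw: "b k \<bullet> w = scaled_sum n (b k) \<omega> / sqrt (real (n * K n))" for k
    by (simp add: w_def grad_g_def grad_gi_def scaled_sum_def sum.cartesian_product' inner_sum_right sum_negf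
        sum_divide_distrib[symmetric] mult.commute)
  have "x \<bullet> (A *v x) = (\<Sum>k<CARD('d). (b k \<bullet> w)\<^sup>2)"
    unfolding x by (simp add: x_def inner_sum_left power2_eq_square)
  also have "\<dots> = (\<Sum>k<CARD('d). (scaled_sum n (b k) \<omega>)\<^sup>2) / real (n * K n)"
    by (simp add: bw power_divide sum_divide_distrib)
  finally have "real (n * K n) * (x \<bullet> (A *v x)) = (\<Sum>k<CARD('d). (scaled_sum n (b k) \<omega>)\<^sup>2)"
    \<comment> \<open>When n = 0 the sums are empty and both sides are 0.\<close>
    by (cases "n * K n = 0") (auto simp: scaled_sum_def)
  then show ?thesis using that x w_def by blast
qed

lemma l_DEL_close:
  assumes b: "\<And>w. A *v (\<Sum>i<CARD('d). (b i \<bullet> w) *\<^sub>R b i) = w" and d: "0 < d"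
  shows "whp M (\<lambda>n \<omega>. \<bar>l_DEL (K n) n (Y n \<omega>) mu0 (lam n (T n) \<omega>) - (\<Sum>k<CARD('d). (scaled_sum n (b k) \<omega>)\<^sup>2)\<bar> \<le> d)"
  unfolding whp_def
proof (intro allI impI)
  fix e :: real assume "0 < e"
  then obtain C where C: "C > 0" "\<And>eta. 0 < eta \<Longrightarrow> evt_prob M e (good C eta)" using good_prob by blast
  obtain E eta0 where E: "0 < E" "0 < eta0" and imp: "\<And>eta. 0 < eta \<Longrightarrow> eta \<le> eta0 \<Longrightarrow>
     (\<forall>\<^sub>F n in sequentially. \<forall>\<omega>\<in>space M. good C eta n \<omega> \<longrightarrow>
        norm (lamstar n \<omega>) \<le> E / sqrt (real (n * K n)) \<and> grad_g (K n) n (Y n \<omega>) mu0 (lamstar n \<omega>) = 0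
        \<and> norm (lam n (T n) \<omega> - lamstar n \<omega>) \<le> E * eta / sqrt (real (n * K n)))"
    using good_imp[OF C(1)] by blast
  \<comment> \<open>The bound of \<open>l_DEL_expansion\<close> with N * B^2 = (E + 1)^2, once B <=
    eta <= 1 has been used to extract one factor eta.\<close>
  define F where "F = (E + 1)\<^sup>2 * (norm A * (1 + (1 + 10 * C) / c)\<^sup>2 + 1 + 2 * C)"
  have F: "0 < F" 
  proof -
    have "0 \<le> norm A * (1 + (1 + 10 * C) / c)\<^sup>2" by simp
    then have "0 < norm A * (1 + (1 + 10 * C) / c)\<^sup>2 + 1 + 2 * C" using C by linarith
    then show ?thesis unfolding F_def using E by (intro mult_pos_pos) auto
  qed
  define eta where "eta = min (min eta0 1) (min (1 / (2 * (E + 1))) (d / F))"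
  have "0 < eta" "eta \<le> eta0" "eta \<le> 1" "eta \<le> 1 / (2 * (E + 1))" "eta \<le> d / F"
    using E d F by (simp_all add: eta_def)
  then have eta: "0 < eta" "eta \<le> eta0" "eta \<le> 1" "(E + 1) * eta \<le> 1/2" "eta * F \<le> d"
    using E F by (simp_all add: field_simps)
  have "filterlim (\<lambda>n. eta * sqrt (real n)) at_top sequentially" using eta(1) by real_asymp
  then have ev: "\<forall>\<^sub>F n in sequentially. E + 1 \<le> eta * sqrt (real n)" by (simp add: filterlim_at_top)
  show "evt_prob M e (\<lambda>n \<omega>. \<bar>l_DEL (K n) n (Y n \<omega>) mu0 (lam n (T n) \<omega>) - (\<Sum>k<CARD('d). (scaled_sum n (b k) \<omega>)\<^sup>2)\<bar> \<le> d)"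
  proof (rule evt_prob_mono[OF C(2)[OF eta(1)]])
    from imp[OF eta(1,2)] ev eventually_gt_at_top[of 0]
    show "\<forall>\<^sub>F n in sequentially. \<forall>\<omega>\<in>space M. good C eta n \<omega> \<longrightarrow>
       \<bar>l_DEL (K n) n (Y n \<omega>) mu0 (lam n (T n) \<omega>) - (\<Sum>k<CARD('d). (scaled_sum n (b k) \<omega>)\<^sup>2)\<bar> \<le> d"
    proof (eventually_elim, intro ballI impI)
      fix n \<omega>
      assume hyp: "\<forall>\<omega>\<in>space M. good C eta n \<omega> \<longrightarrow>
        norm (lamstar n \<omega>) \<le> E / sqrt (real (n * K n)) \<and> grad_g (K n) n (Y n \<omega>) mu0 (lamstar n \<omega>) = 0
        \<and> norm (lam n (T n) \<omega> - lamstar n \<omega>) \<le> E * eta / sqrt (real (n * K n))"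
        and big: "E + 1 \<le> eta * sqrt (real n)" and n: "0 < n" and \<omega>: "\<omega> \<in> space M" and g: "good C eta n \<omega>"
      have K0: "0 < K n" using K_pos[of n] by simp
      define N where "N = real (n * K n)"
      define B where "B = (E + 1) / sqrt N"
      have nN: "sqrt (real n) \<le> sqrt N" "0 < sqrt N" "0 < sqrt (real n)" using K0 n by (auto simp: N_def)
      have h: "norm (lamstar n \<omega>) \<le> E / sqrt N" "grad_g (K n) n (Y n \<omega>) mu0 (lamstar n \<omega>) = 0"
        "norm (lam n (T n) \<omega> - lamstar n \<omega>) \<le> E * eta / sqrt N"
        using hyp \<omega> g by (auto simp: N_def)
      have B0: "0 < B" using E nN by (simp add: B_def)
      have NB: "N * B\<^sup>2 = (E + 1)\<^sup>2" using nN by (simp add: B_def power_divide N_def)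
      have Beta: "B \<le> eta"
      proof -
        have "B \<le> eta * sqrt (real n) / sqrt (real n)"
          unfolding B_def using big nN E by (intro frac_le) auto
        then show ?thesis using nN by simp
      qed
      have Bz: "B * norm (X n i j \<omega> - mu0) \<le> 1/2" if "i < K n" "j < n" for i j
      proof -
        have "norm (X n i j \<omega> - mu0) \<le> eta * sqrt (real n)" using g that by (auto simp: good_def)
        also have "\<dots> \<le> eta * sqrt N" using nN eta by (intro mult_left_mono) auto
        finally have "B * norm (X n i j \<omega> - mu0) \<le> B * (eta * sqrt N)" using B0 by (intro mult_left_mono) auto
        also have "\<dots> = (E + 1) * eta" using nN by (simp add: B_def)
        finally show ?thesis using eta by simp
      qed
      have del: "norm (lam n (T n) \<omega> - lamstar n \<omega>) \<le> eta * B"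
      proof -
        have "E * eta / sqrt N \<le> (E + 1) * eta / sqrt N" using eta nN by (intro divide_right_mono mult_right_mono) auto
        then show ?thesis using h by (simp add: B_def mult.commute)
      qed
      have lsB: "norm (lamstar n \<omega>) \<le> B"
        using h(1) divide_right_mono[of E "E + 1" "sqrt N"] nN by (simp add: B_def)
      have lB: "norm (lam n (T n) \<omega>) \<le> B"
      proof -
        have "norm (lam n (T n) \<omega>) \<le> E / sqrt N + E * eta / sqrt N"
          using norm_triangle_ineq[of "lam n (T n) \<omega> - lamstar n \<omega>" "lamstar n \<omega>"] h by simp
        also have "\<dots> \<le> E / sqrt N + 1 / sqrt N"
          using nN eta E by (intro add_mono divide_right_mono) (auto simp: algebra_simps)
        finally show ?thesis by (simp add: B_def add_divide_distrib)
      qed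
      obtain x where x: "A *v x = - grad_g (K n) n (Y n \<omega>) mu0 0"
        "real (n * K n) * (x \<bullet> (A *v x)) = (\<Sum>k<CARD('d). (scaled_sum n (b k) \<omega>)\<^sup>2)"
        using quadratic_form_eq[OF b] by blast
      have "\<bar>l_DEL (K n) n (Y n \<omega>) mu0 (lam n (T n) \<omega>) - N * (x \<bullet> (A *v x))\<bar>
         \<le> N * B\<^sup>2 * (norm A * (eta + (eta + 10 * B * C) / c)\<^sup>2 + eta + 2 * B * C)"
        unfolding N_def
        by (rule l_DEL_expansion[OF K0 n c coer cov_sym Bz lsB lB del _ h(2) x(1)])
           (use g in \<open>auto simp: good_def\<close>)
      also have "\<dots> \<le> (E + 1)\<^sup>2 * (eta * (norm A * (1 + (1 + 10 * C) / c)\<^sup>2 + 1 + 2 * C))"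
        unfolding NB
      proof (rule mult_left_mono)
        have "(eta + (eta + 10 * B * C) / c) \<le> (eta + (eta + 10 * eta * C) / c)"
          using Beta C c by (intro add_left_mono divide_right_mono add_left_mono mult_right_mono mult_left_mono) auto
        also have "\<dots> = eta * (1 + (1 + 10 * C) / c)" by (simp add: algebra_simps add_divide_distrib)
        finally have "(eta + (eta + 10 * B * C) / c)\<^sup>2 \<le> (eta * (1 + (1 + 10 * C) / c))\<^sup>2"
          using eta B0 C c by (intro power_mono) auto
        also have "\<dots> = eta * (eta * (1 + (1 + 10 * C) / c)\<^sup>2)" by (simp add: power_mult_distrib power2_eq_square)
        also have "\<dots> \<le> eta * (1 * (1 + (1 + 10 * C) / c)\<^sup>2)"
          using eta by (intro mult_left_mono mult_right_mono) auto
        finally have "norm A * (eta + (eta + 10 * B * C) / c)\<^sup>2 \<le> norm A * (eta * (1 + (1 + 10 * C) / c)\<^sup>2)"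
          by (intro mult_left_mono) auto
        moreover have "B * C \<le> eta * C" using Beta C by (intro mult_right_mono) auto
        ultimately show "norm A * (eta + (eta + 10 * B * C) / c)\<^sup>2 + eta + 2 * B * C
            \<le> eta * (norm A * (1 + (1 + 10 * C) / c)\<^sup>2 + 1 + 2 * C)"
          by (simp add: distrib_left mult_ac)
      qed simp
      also have "\<dots> = eta * F" by (simp add: F_def)
      also have "\<dots> \<le> d" by (rule eta)
      finally show "\<bar>l_DEL (K n) n (Y n \<omega>) mu0 (lam n (T n) \<omega>) - (\<Sum>k<CARD('d). (scaled_sum n (b k) \<omega>)\<^sup>2)\<bar> \<le> d"
        by (simp only: N_def x(2))
    qed
  qed
qed

lemma l_DEL_measurable: "(\<lambda>\<omega>. l_DEL (K n) n (Y n \<omega>) mu0 (lam n (T n) \<omega>)) \<in> borel_measurable M"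
  unfolding l_DEL_def by measurable

lemma wilks:
  "weak_conv_m (\<lambda>n. distr M borel (\<lambda>\<omega>. l_DEL (K n) n (Y n \<omega>) mu0 (lam n (T n) \<omega>))) (chi_squared CARD('d))"
proof -
  have "0 < v \<bullet> (A *v v)" if "v \<noteq> 0" for v
    using coer[of v] c that by (smt (verit) mult_pos_pos zero_less_norm_iff zero_less_power)
  from form_basis[OF cov_sym this] obtain b :: "nat \<Rightarrow> real^'d"
    where b: "\<And>i j. i < CARD('d) \<Longrightarrow> j < CARD('d) \<Longrightarrow> b i \<bullet> (A *v b j) = (if i = j then 1 else 0)"
      "\<And>w. A *v (\<Sum>i<CARD('d). (b i \<bullet> w) *\<^sub>R b i) = w" by blast
  show ?thesis
    by (rule weak_conv_perturb[OF _ l_DEL_measurable quadratic_weak_conv[OF b(1)] l_DEL_close[OF b(2)]]) auto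
qed

end

theorem theorem1:
  fixes M :: "'a measure"
    and Dist :: "(real^'d) measure"
    and X :: "nat \<Rightarrow> nat \<Rightarrow> nat \<Rightarrow> 'a \<Rightarrow> real^'d"
    and mu0 :: "real^'d"
    and beta :: real
    and K T :: "nat \<Rightarrow> nat"
    and lamstar :: "nat \<Rightarrow> 'a \<Rightarrow> real^'d"
    and lam :: "nat \<Rightarrow> nat \<Rightarrow> 'a \<Rightarrow> real^'d"
    and loc :: "nat \<Rightarrow> nat \<Rightarrow> nat \<Rightarrow> 'a \<Rightarrow> real^'d"
  assumes "prob_space M"
    \<comment> \<open>data: for each n, X n i j (i < K n, j < n) i.i.d. with law Dist\<close>
    and K_pos: "\<And>n. 1 \<le> K n"
    and X_rv: "\<And>n i j. X n i j \<in> borel_measurable M"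
    and X_indep: "\<And>n. prob_space.indep_vars M (\<lambda>_. borel) (\<lambda>(i, j). X n i j) ({..<K n} \<times> {..<n})"
    and X_dist: "\<And>n i j. i < K n \<Longrightarrow> j < n \<Longrightarrow> distr M borel (X n i j) = Dist"
    \<comment> \<open>mean, covariance, moments\<close>
    and mean: "mu0 = (\<integral>x. x \<partial>Dist)"
    and beta: "4 \<le> beta"
    and moment: "integrable Dist (\<lambda>x. norm x powr beta)"
    and eig: "\<exists>c C. 0 < c \<and> (\<forall>e. is_eigenvalue (cov_matrix Dist mu0) e \<longrightarrow> c \<le> e \<and> e \<le> C)"
    and K_rate: "(\<lambda>n. real (K n)) \<in> O(\<lambda>n. real (n * K n) powr (1 - 2 / beta))"
    \<comment> \<open>global minimiser lambda-hat-star\<close>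
    and lamstar_rv: "\<And>n. lamstar n \<in> borel_measurable M"
    and lamstar_def: "\<And>n \<omega>. \<omega> \<in> space M \<Longrightarrow>
        is_argmin (g_glob (K n) n (\<lambda>i j. X n i j \<omega>) mu0) (dom_g (K n) n (\<lambda>i j. X n i j \<omega>) mu0) (lamstar n \<omega>)"
    \<comment> \<open>multi-round algorithm: lam n t = lambda-hat_t, loc n t i = lambda-hat_t^(i)\<close>
    and lam_rv: "\<And>n t. lam n t \<in> borel_measurable M"
    and loc_def: "\<And>n t i \<omega>. \<omega> \<in> space M \<Longrightarrow> t < T n \<Longrightarrow> i < K n \<Longrightarrow>
        is_argmin (surrogate (K n) n (\<lambda>i j. X n i j \<omega>) mu0 i (lam n t \<omega>))
                  (dom_gi n (\<lambda>j. X n i j \<omega>) mu0) (loc n (Suc t) i \<omega>)"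
    and lam_step: "\<And>n t \<omega>. \<omega> \<in> space M \<Longrightarrow> t < T n \<Longrightarrow>
        lam n (Suc t) \<omega> = (1 / real (K n)) *\<^sub>R (\<Sum>i<K n. loc n (Suc t) i \<omega>)"
    \<comment> \<open>initial value and number of rounds\<close>
    and init: "bigO_p M (\<lambda>n \<omega>. norm (lam n 0 \<omega> - lamstar n \<omega>)) (\<lambda>n. real n powr (-1/2))"
    and T_ge: "\<And>n. real (T n) \<ge> of_int \<lfloor>ln (real (K n)) / ln (real n)\<rfloor> + 1"
  shows "smallo_p M (\<lambda>n \<omega>. norm (lam n (T n) \<omega> - lamstar n \<omega>)) (\<lambda>n. real (n * K n) powr (-1/2))
       \<and> weak_conv_m (\<lambda>n. distr M borel (\<lambda>\<omega>. l_DEL (K n) n (\<lambda>i j. X n i j \<omega>) mu0 (lam n (T n) \<omega>)))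
                     (chi_squared CARD('d))"
proof -
  interpret prob_space M by fact
  interpret iid_array M Dist X mu0 beta K
    by unfold_locales (fact K_pos X_rv X_indep X_dist mean beta moment K_rate)+
  obtain c where c: "0 < c" "\<And>e. is_eigenvalue (cov_matrix Dist mu0) e \<Longrightarrow> c \<le> e" using eig by blast
  have coer: "c * (norm v)\<^sup>2 \<le> v \<bullet> (cov_matrix Dist mu0 *v v)" for v
    by (rule symmetric_coercive[OF cov_sym c(2)])
  interpret distributed_el M Dist X mu0 beta K c T lamstar lam loc
    by unfold_locales
       (fact c(1) coer lamstar_rv lamstar_def lam_rv loc_def lam_step init T_ge)+
  show ?thesis using estimator_rate wilks by blast
qed

end
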